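(* Let $X$ be a graph with a free action of an amenable group $\Gamma$ with finite fundamental domain, let $\sigma$ be a weakly $\Gamma$-invariant weight function on $X$ with discrete magnetic Laplacian $\Delta_\sigma$, and let $\{X_m\}_{m\ge1}$ be the regular exhaustion of $X$ corresponding to a regular exhaustion $\{\Lambda_m\}_{m\ge 1}$ of $\Gamma$. Let $N_m=\#\Lambda_m$, let $E_m(\lambda)$ be the number of eigenvalues (counted with multiplicity) less than or equal to $\lambda$ of the restricted operator $\Delta_\sigma^{(m)}$ on $X_m$, with either Dirichlet or Neumann boundary conditions, and let $F$ be the spectral density function of $\Delta_\sigma$. Suppose that $\sigma$ is rational, i.e. $\sigma^n=1$ for some positive integer $n$. Then $$\lim_{m\to\infty}\frac{E_m(\lambda)}{N_m}=F(\lambda)\qquad\text{for all }\lambda\in\mathbb{R}.$$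
   Context: Graphs and group action. $X$ is a combinatorial graph with vertex set $\mathrm{Vert}\,X$ and set $\mathrm{Edge}\,X$ of oriented edges; each unoriented edge gives two oriented edges $e,\overline e$, and $\mathfrak{o}(e),\mathfrak{t}(e)$ are the origin and terminus of $e$. $E^+\subset \mathrm{Edge}\,X$ contains exactly one orientation of each unoriented edge. $\mathcal{O}(v)$ is the valence of $v$ (the number of oriented edges with terminus $v$). $\Gamma$ is a finitely generated amenable discrete group acting on $X$ by graph automorphisms, freely (i.e. freely on the geometric realization), with finitely many orbits of vertices and edges. $\mathcal{F}$ is a fundamental domain: a finite set of vertices and unoriented edges containing exactly one element of each $\Gamma$-orbit. Weight function and DML. A weight function is $\sigma:\mathrm{Edge}\,X\to U(1)$ with $\sigma(\overline e)=\sigma(e)^{-1}$. It is weakly $\Gamma$-invariant if for each $\gamma\in\Gamma$ there is $s_\gamma:\mathrm{Vert}\,X\to U(1)$ with $\sigma(\gamma e)=\sigma(e)s_\gamma(\mathfrak{t}(e))\overline{s_\gamma(\mathfrak{o}(e))}$ for all $e$. The discrete magnetic Laplacian (DML) is the bounded self-adjoint operator on $\ell^2(\mathrm{Vert}\,X)$ $$(\Delta_\sigma f)(v)=\mathcal{O}(v)f(v)-\sum_{e\in E^+,\,\mathfrak{t}(e)=v}\sigma(e)f(\mathfrak{o}(e))-\sum_{e\in E^+,\,\mathfrak{o}(e)=v}\overline{\sigma(e)}f(\mathfrak{t}(e)).$$ Trace and spectral density. For a bounded operator $A$ commuting with all magnetic translations $(T_\gamma f)(x)=s_\gamma(\gamma^{-1}x)f(\gamma^{-1}x)$,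 $\gamma\in\Gamma$ (for instance any bounded Borel function of $\Delta_\sigma$), the von Neumann trace is $\mathrm{Tr}_{\Gamma,\sigma}(A)=\sum_{v\in\mathcal{F}\cap \mathrm{Vert}\,X}\langle A\delta_v,\delta_v\rangle$. The spectral density function of $\Delta_\sigma$ is $F(\lambda)=\mathrm{Tr}_{\Gamma,\sigma}(\chi_{(-\infty,\lambda]}(\Delta_\sigma))$. Regular exhaustions. A regular exhaustion of $\Gamma$ is an increasing sequence of nonempty finite subsets $\Lambda_m\subset\Lambda_{m+1}$ with $\bigcup_m\Lambda_m=\Gamma$ such that for every $\delta>0$, $\lim_m \#\partial_\delta\Lambda_m/\#\Lambda_m=0$, where $\partial_\delta\Lambda_m=\{\gamma\in\Gamma: d_1(\gamma,\Lambda_m)<\delta,\ d_1(\gamma,\Gamma\setminus\Lambda_m)<\delta\}$ and $d_1$ is the word metric for a finite generating set. The corresponding regular exhaustion of $X$ consists of $X_m$, the largest subgraph of $X$ contained in $\bigcup_{\gamma\in\Lambda_m}\gamma\mathcal{F}$. Restricted DML. $\Delta_\sigma^{(m)}$ is the self-adjoint operator on functions on $\mathrm{Vert}\,X_m$ given by: (Dirichlet) $P_m\Delta_\sigma P_m$, where $P_m$ is the orthogonal projection onto functions supported on $\mathrm{Vert}\,X_m$; or (Neumann) the DML of the finite graph $X_m$ itself with weight $\sigma|_{X_m}$, i.e. $(\Delta_\sigma^{(m)}f)(v)=\mathcal{O}_m(v)f(v)-\sum_{e\in E^+\cap\mathrm{Edge}\,X_m,\,\mathfrak{t}(e)=v}\sigma(e)f(\mathfrak{o}(e))-\sum_{e\in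 E^+\cap\mathrm{Edge}\,X_m,\,\mathfrak{o}(e)=v}\overline{\sigma(e)}f(\mathfrak{t}(e))$ for $v\in\mathrm{Vert}\,X_m$, where $\mathcal{O}_m(v)$ is the valence of $v$ in $X_m$. *)

theory Defs
  imports
    "HOL-Analysis.Analysis"
    "HOL-Algebra.Coset"
    "HOL-Algebra.Generated_Groups"
    "HOL-Algebra.Group_Action"
    "HOL-Library.Function_Algebras"
    "Graph_Theory.Bidirected_Digraph"
    "Graph_Theory.Digraph_Component"
begin

text \<open>
  A graph with oriented edges and edge reversal is a \<^locale>\<open>bidirected_digraph\<close>
  \<open>X bar\<close>: origin and terminus are \<open>tail X\<close> and \<open>head X\<close>, the reversal has no fixed arc
  (and, by the library convention, is the identity off \<open>arcs X\<close>), and the valence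
  \<open>in_degree X v\<close> counts the arcs with terminus \<open>v\<close>.  Loops and multiple edges are allowed.
\<close>

definition unoriented_edges :: "('v, 'e) pre_digraph \<Rightarrow> ('e \<Rightarrow> 'e) \<Rightarrow> 'e set set" where
  "unoriented_edges X bar = (\<lambda>e. {e, bar e}) ` arcs X"

definition orientation :: "('v, 'e) pre_digraph \<Rightarrow> ('e \<Rightarrow> 'e) \<Rightarrow> 'e set \<Rightarrow> bool" where
  "orientation X bar Ep \<longleftrightarrow> Ep \<subseteq> arcs X \<and> (\<forall>e\<in>arcs X. (e \<in> Ep) \<noteq> (bar e \<in> Ep))"


section \<open>Groups: amenability, word metric, regular exhaustions\<close>

definition amenable :: "('g, 'm) monoid_scheme \<Rightarrow> bool" where
  "amenable G \<longleftrightarrow> (\<exists>\<mu> :: 'g set \<Rightarrow> real.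
     (\<forall>A. A \<subseteq> carrier G \<longrightarrow> 0 \<le> \<mu> A) \<and> \<mu> (carrier G) = 1 \<and>
     (\<forall>A B. A \<subseteq> carrier G \<longrightarrow> B \<subseteq> carrier G \<longrightarrow> A \<inter> B = {} \<longrightarrow> \<mu> (A \<union> B) = \<mu> A + \<mu> B) \<and>
     (\<forall>g\<in>carrier G. \<forall>A. A \<subseteq> carrier G \<longrightarrow> \<mu> (g <#\<^bsub>G\<^esub> A) = \<mu> A))"

definition finite_generating_set :: "('g, 'm) monoid_scheme \<Rightarrow> 'g set \<Rightarrow> bool" where
  "finite_generating_set G S \<longleftrightarrow> finite S \<and> S \<subseteq> carrier G \<and> generate G S = carrier G"

definition word_length :: "('g, 'm) monoid_scheme \<Rightarrow> 'g set \<Rightarrow> 'g \<Rightarrow> nat" where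
  "word_length G S g =
     (LEAST n. \<exists>ws. length ws = n \<and> set ws \<subseteq> S \<union> (\<lambda>s. inv\<^bsub>G\<^esub> s) ` S \<and>
                    foldr (\<lambda>x y. x \<otimes>\<^bsub>G\<^esub> y) ws \<one>\<^bsub>G\<^esub> = g)"

text \<open>The left-invariant word metric.\<close>

definition word_dist :: "('g, 'm) monoid_scheme \<Rightarrow> 'g set \<Rightarrow> 'g \<Rightarrow> 'g \<Rightarrow> nat" where
  "word_dist G S g h = word_length G S (inv\<^bsub>G\<^esub> g \<otimes>\<^bsub>G\<^esub> h)"

text \<open>The distance to the empty set is \<open>\<infinity>\<close>; this matters when \<open>G\<close> is finite.\<close>

definition word_setdist :: "('g, 'm) monoid_scheme \<Rightarrow> 'g set \<Rightarrow> 'g \<Rightarrow> 'g set \<Rightarrow> ereal" where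
  "word_setdist G S g A = (INF h\<in>A. ereal (real (word_dist G S g h)))"

definition group_boundary :: "('g, 'm) monoid_scheme \<Rightarrow> 'g set \<Rightarrow> real \<Rightarrow> 'g set \<Rightarrow> 'g set" where
  "group_boundary G S \<delta> L =
     {g \<in> carrier G. word_setdist G S g L < ereal \<delta> \<and>
                     word_setdist G S g (carrier G - L) < ereal \<delta>}"

definition regular_exhaustion ::
  "('g, 'm) monoid_scheme \<Rightarrow> 'g set \<Rightarrow> (nat \<Rightarrow> 'g set) \<Rightarrow> bool" where
  "regular_exhaustion G S \<Lambda> \<longleftrightarrow>
     (\<forall>m. finite (\<Lambda> m) \<and> \<Lambda> m \<noteq> {} \<and> \<Lambda> m \<subseteq> \<Lambda> (Suc m)) \<and>
     (\<Union>m. \<Lambda> m) = carrier G \<and>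
     (\<forall>\<delta>>0. (\<lambda>m. real (card (group_boundary G S \<delta> (\<Lambda> m))) / real (card (\<Lambda> m))) \<longlonglongrightarrow> 0)"


section \<open>Free cofinite actions on graphs\<close>

definition graph_action ::
  "('g, 'm) monoid_scheme \<Rightarrow> ('v, 'e) pre_digraph \<Rightarrow> ('e \<Rightarrow> 'e) \<Rightarrow>
   ('g \<Rightarrow> 'v \<Rightarrow> 'v) \<Rightarrow> ('g \<Rightarrow> 'e \<Rightarrow> 'e) \<Rightarrow> bool" where
  "graph_action G X bar \<rho>V \<rho>E \<longleftrightarrow>
     group_action G (verts X) \<rho>V \<and> group_action G (arcs X) \<rho>E \<and>
     (\<forall>g\<in>carrier G. \<forall>e\<in>arcs X.
        tail X (\<rho>E g e) = \<rho>V g (tail X e) \<and>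
        head X (\<rho>E g e) = \<rho>V g (head X e) \<and>
        bar (\<rho>E g e) = \<rho>E g (bar e))"

text \<open>
  Freeness on the geometric realization: besides having no fixed vertex, a nontrivial element
  must not map an edge to itself, in either direction (an inversion fixes the midpoint).
\<close>

definition free_graph_action ::
  "('g, 'm) monoid_scheme \<Rightarrow> ('v, 'e) pre_digraph \<Rightarrow> ('e \<Rightarrow> 'e) \<Rightarrow>
   ('g \<Rightarrow> 'v \<Rightarrow> 'v) \<Rightarrow> ('g \<Rightarrow> 'e \<Rightarrow> 'e) \<Rightarrow> bool" where
  "free_graph_action G X bar \<rho>V \<rho>E \<longleftrightarrow>
     graph_action G X bar \<rho>V \<rho>E \<and>
     (\<forall>g\<in>carrier G. g \<noteq> \<one>\<^bsub>G\<^esub> \<longrightarrow>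
        (\<forall>v\<in>verts X. \<rho>V g v \<noteq> v) \<and>
        (\<forall>e\<in>arcs X. \<rho>E g e \<noteq> e \<and> \<rho>E g e \<noteq> bar e))"

text \<open>
  A fundamental domain consists of a set \<open>FV\<close> of vertices and a set \<open>FE\<close> of unoriented edges.
  Its existence with both sets finite says that there are finitely many orbits.
\<close>

definition fundamental_domain ::
  "('g, 'm) monoid_scheme \<Rightarrow> ('v, 'e) pre_digraph \<Rightarrow> ('e \<Rightarrow> 'e) \<Rightarrow>
   ('g \<Rightarrow> 'v \<Rightarrow> 'v) \<Rightarrow> ('g \<Rightarrow> 'e \<Rightarrow> 'e) \<Rightarrow> 'v set \<Rightarrow> 'e set set \<Rightarrow> bool" where
  "fundamental_domain G X bar \<rho>V \<rho>E FV FE \<longleftrightarrow>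
     finite FV \<and> FV \<subseteq> verts X \<and> finite FE \<and> FE \<subseteq> unoriented_edges X bar \<and>
     (\<forall>v\<in>verts X. \<exists>!w. w \<in> FV \<and> (\<exists>g\<in>carrier G. w = \<rho>V g v)) \<and>
     (\<forall>u\<in>unoriented_edges X bar. \<exists>!w. w \<in> FE \<and> (\<exists>g\<in>carrier G. w = \<rho>E g ` u))"

definition largest_subgraph_in ::
  "('v, 'e) pre_digraph \<Rightarrow> ('e \<Rightarrow> 'e) \<Rightarrow> 'v set \<Rightarrow> 'e set set \<Rightarrow> ('v, 'e) pre_digraph" where
  "largest_subgraph_in X bar W U =
     \<lparr> verts = W,
       arcs = {e \<in> arcs X. {e, bar e} \<in> U \<and> tail X e \<in> W \<and> head X e \<in> W},
       tail = tail X, head = head X \<rparr>"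

lemma largest_subgraph_in_is_subgraph:
  assumes "bidirected_digraph X bar" "W \<subseteq> verts X"
  shows "subgraph (largest_subgraph_in X bar W U) X"
    and "unoriented_edges (largest_subgraph_in X bar W U) bar \<subseteq> U"
    and "bar ` arcs (largest_subgraph_in X bar W U) \<subseteq> arcs (largest_subgraph_in X bar W U)"
proof -
  interpret bidirected_digraph X bar by fact
  show "subgraph (largest_subgraph_in X bar W U) X"
    using assms(2) wf_digraph
    by (auto simp: subgraph_def largest_subgraph_in_def compatible_def wf_digraph_def)
  show "unoriented_edges (largest_subgraph_in X bar W U) bar \<subseteq> U"
    by (auto simp: unoriented_edges_def largest_subgraph_in_def)
  show "bar ` arcs (largest_subgraph_in X bar W U) \<subseteq> arcs (largest_subgraph_in X bar W U)"
    by (auto simp: largest_subgraph_in_def insert_commute)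
qed

lemma largest_subgraph_in_greatest:
  assumes "subgraph H X" "verts H \<subseteq> W" "unoriented_edges H bar \<subseteq> U"
  shows "subgraph H (largest_subgraph_in X bar W U)"
proof -
  have wf: "wf_digraph H" and c: "tail X = tail H" "head X = head H" and a: "arcs H \<subseteq> arcs X"
    using assms(1) by (auto simp: subgraph_def compatible_def)
  have "arcs H \<subseteq> arcs (largest_subgraph_in X bar W U)"
    using assms(2,3) a c wf
    by (force simp: largest_subgraph_in_def unoriented_edges_def wf_digraph_def)
  then show ?thesis
    using assms(2) wf c
    by (auto simp: subgraph_def compatible_def largest_subgraph_in_def wf_digraph_def)
qed

text \<open>For a finite \<open>L \<subseteq> \<Gamma>\<close>, the largest subgraph contained in the union of the \<open>L\<close>-translates
  of the fundamental domain.\<close>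

definition exhaustion_graph ::
  "('v, 'e) pre_digraph \<Rightarrow> ('e \<Rightarrow> 'e) \<Rightarrow> ('g \<Rightarrow> 'v \<Rightarrow> 'v) \<Rightarrow> ('g \<Rightarrow> 'e \<Rightarrow> 'e) \<Rightarrow>
   'v set \<Rightarrow> 'e set set \<Rightarrow> 'g set \<Rightarrow> ('v, 'e) pre_digraph" where
  "exhaustion_graph X bar \<rho>V \<rho>E FV FE L =
     largest_subgraph_in X bar (\<Union>g\<in>L. \<rho>V g ` FV) (\<Union>g\<in>L. (\<lambda>u. \<rho>E g ` u) ` FE)"


section \<open>Weight functions and the discrete magnetic Laplacian\<close>

definition weight_function ::
  "('v, 'e) pre_digraph \<Rightarrow> ('e \<Rightarrow> 'e) \<Rightarrow> ('e \<Rightarrow> complex) \<Rightarrow> bool" where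
  "weight_function X bar \<sigma> \<longleftrightarrow>
     (\<forall>e\<in>arcs X. cmod (\<sigma> e) = 1 \<and> \<sigma> (bar e) = inverse (\<sigma> e))"

definition weakly_invariant ::
  "('g, 'm) monoid_scheme \<Rightarrow> ('v, 'e) pre_digraph \<Rightarrow> ('g \<Rightarrow> 'e \<Rightarrow> 'e) \<Rightarrow> ('e \<Rightarrow> complex) \<Rightarrow> bool" where
  "weakly_invariant G X \<rho>E \<sigma> \<longleftrightarrow>
     (\<forall>g\<in>carrier G. \<exists>s :: 'v \<Rightarrow> complex.
        (\<forall>v\<in>verts X. cmod (s v) = 1) \<and>
        (\<forall>e\<in>arcs X. \<sigma> (\<rho>E g e) = \<sigma> e * s (head X e) * cnj (s (tail X e))))"

definition rational_weight :: "('v, 'e) pre_digraph \<Rightarrow> ('e \<Rightarrow> complex) \<Rightarrow> bool" where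
  "rational_weight X \<sigma> \<longleftrightarrow> (\<exists>n>0. \<forall>e\<in>arcs X. \<sigma> e ^ n = 1)"

text \<open>
  Functions on a set \<open>V\<close> of vertices are represented by functions on the whole vertex type that
  vanish off \<open>V\<close>.  The same formula is used for \<open>X\<close> itself and for its subgraphs, so \<open>Ep\<close> is
  intersected with the arcs of the graph at hand.
\<close>

definition dml ::
  "('v, 'e) pre_digraph \<Rightarrow> 'e set \<Rightarrow> ('e \<Rightarrow> complex) \<Rightarrow> ('v \<Rightarrow> complex) \<Rightarrow> 'v \<Rightarrow> complex" where
  "dml X Ep \<sigma> f v =
     (if v \<in> verts X
      then of_nat (in_degree X v) * f v
           - (\<Sum>e | e \<in> Ep \<inter> arcs X \<and> head X e = v. \<sigma> e * f (tail X e))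
           - (\<Sum>e | e \<in> Ep \<inter> arcs X \<and> tail X e = v. cnj (\<sigma> e) * f (head X e))
      else 0)"

definition restrict_support :: "'v set \<Rightarrow> ('v \<Rightarrow> complex) \<Rightarrow> 'v \<Rightarrow> complex" where
  "restrict_support W f v = (if v \<in> W then f v else 0)"

datatype boundary_condition = Dirichlet | Neumann

text \<open>The restriction of the magnetic Laplacian of \<open>X\<close> to a subgraph \<open>Y\<close>.\<close>

fun restricted_dml ::
  "boundary_condition \<Rightarrow> ('v, 'e) pre_digraph \<Rightarrow> 'e set \<Rightarrow> ('e \<Rightarrow> complex) \<Rightarrow>
   ('v, 'e) pre_digraph \<Rightarrow> ('v \<Rightarrow> complex) \<Rightarrow> 'v \<Rightarrow> complex" where
  "restricted_dml Dirichlet X Ep \<sigma> Y f =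
     restrict_support (verts Y) (dml X Ep \<sigma> (restrict_support (verts Y) f))"
| "restricted_dml Neumann X Ep \<sigma> Y f = dml Y Ep \<sigma> f"


section \<open>Counting eigenvalues of an operator on functions on a finite set\<close>

abbreviation scale_fun :: "complex \<Rightarrow> ('v \<Rightarrow> complex) \<Rightarrow> 'v \<Rightarrow> complex" where
  "scale_fun c f \<equiv> (\<lambda>v. c * f v)"

lemma vector_space_scale_fun: "vector_space (scale_fun :: complex \<Rightarrow> ('v \<Rightarrow> complex) \<Rightarrow> 'v \<Rightarrow> complex)"
  by unfold_locales (auto simp: fun_eq_iff algebra_simps)

definition eigenspace ::
  "'v set \<Rightarrow> (('v \<Rightarrow> complex) \<Rightarrow> 'v \<Rightarrow> complex) \<Rightarrow> real \<Rightarrow> ('v \<Rightarrow> complex) set" where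
  "eigenspace W A \<mu> = {f. (\<forall>v. v \<notin> W \<longrightarrow> f v = 0) \<and> A f = scale_fun (of_real \<mu>) f}"

text \<open>Only used for self-adjoint \<open>A\<close> on functions on a finite \<open>W\<close>: all eigenvalues are real and
  the multiplicity of an eigenvalue is the complex dimension of its eigenspace.\<close>

definition eigenvalue_count ::
  "'v set \<Rightarrow> (('v \<Rightarrow> complex) \<Rightarrow> 'v \<Rightarrow> complex) \<Rightarrow> real \<Rightarrow> nat" where
  "eigenvalue_count W A x =
     (\<Sum>\<mu> | \<mu> \<le> x \<and> (\<exists>f\<in>eigenspace W A \<mu>. f \<noteq> (\<lambda>_. 0)).
        vector_space.dim scale_fun (eigenspace W A \<mu>))"


section \<open>The Hilbert space of square-summable functions and spectral measures\<close>

definition l2 :: "'v set \<Rightarrow> ('v \<Rightarrow> complex) set" where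
  "l2 V = {f. (\<forall>v. v \<notin> V \<longrightarrow> f v = 0) \<and> (\<lambda>v. (cmod (f v))\<^sup>2) summable_on V}"

definition l2_inner :: "('v \<Rightarrow> complex) \<Rightarrow> ('v \<Rightarrow> complex) \<Rightarrow> complex" where
  "l2_inner f g = (\<Sum>\<^sub>\<infinity>v. f v * cnj (g v))"

definition l2_norm :: "('v \<Rightarrow> complex) \<Rightarrow> real" where
  "l2_norm f = sqrt (\<Sum>\<^sub>\<infinity>v. (cmod (f v))\<^sup>2)"

definition delta :: "'v \<Rightarrow> 'v \<Rightarrow> complex" where
  "delta v w = (if w = v then 1 else 0)"

definition orthogonal_projection ::
  "'v set \<Rightarrow> (('v \<Rightarrow> complex) \<Rightarrow> 'v \<Rightarrow> complex) \<Rightarrow> bool" where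
  "orthogonal_projection V T \<longleftrightarrow>
     (\<forall>f\<in>l2 V. T f \<in> l2 V) \<and>
     (\<forall>a b. \<forall>f\<in>l2 V. \<forall>g\<in>l2 V. T (\<lambda>v. a * f v + b * g v) = (\<lambda>v. a * T f v + b * T g v)) \<and>
     (\<forall>f\<in>l2 V. T (T f) = T f) \<and>
     (\<forall>f\<in>l2 V. \<forall>g\<in>l2 V. l2_inner (T f) g = l2_inner f (T g))"

text \<open>
  Bounded projection-valued measures on the real line: strongly countably additive, multiplicative,
  and concentrated on a bounded interval.
\<close>

definition projection_valued_measure ::
  "'v set \<Rightarrow> (real set \<Rightarrow> ('v \<Rightarrow> complex) \<Rightarrow> 'v \<Rightarrow> complex) \<Rightarrow> bool" where
  "projection_valued_measure V P \<longleftrightarrow>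
     (\<forall>B\<in>sets borel. orthogonal_projection V (P B)) \<and>
     (\<forall>f\<in>l2 V. P {} f = (\<lambda>_. 0)) \<and>
     (\<exists>a>0. \<forall>f\<in>l2 V. P {-a<..<a} f = f) \<and>
     (\<forall>B\<in>sets borel. \<forall>C\<in>sets borel. \<forall>f\<in>l2 V. P B (P C f) = P (B \<inter> C) f) \<and>
     (\<forall>B :: nat \<Rightarrow> real set. range B \<subseteq> sets borel \<longrightarrow> disjoint_family B \<longrightarrow>
        (\<forall>f\<in>l2 V. (\<lambda>N. l2_norm (\<lambda>v. P (\<Union>n. B n) f v - (\<Sum>n<N. P (B n) f v))) \<longlonglongrightarrow> 0))"

text \<open>The scalar measure \<open>B \<mapsto> \<langle>P(B) f, f\<rangle>\<close>.\<close>

definition scalar_measure ::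
  "(real set \<Rightarrow> ('v \<Rightarrow> complex) \<Rightarrow> 'v \<Rightarrow> complex) \<Rightarrow> ('v \<Rightarrow> complex) \<Rightarrow> real measure" where
  "scalar_measure P f = measure_of UNIV (sets borel) (\<lambda>B. ennreal (Re (l2_inner (P B f) f)))"

text \<open>\<open>A = \<integral> t dP(t)\<close>, in the weak sense.\<close>

definition is_spectral_measure ::
  "'v set \<Rightarrow> (('v \<Rightarrow> complex) \<Rightarrow> 'v \<Rightarrow> complex) \<Rightarrow>
   (real set \<Rightarrow> ('v \<Rightarrow> complex) \<Rightarrow> 'v \<Rightarrow> complex) \<Rightarrow> bool" where
  "is_spectral_measure V A P \<longleftrightarrow>
     projection_valued_measure V P \<and>
     (\<forall>f\<in>l2 V. l2_inner (A f) f = of_real (\<integral>t. t \<partial>scalar_measure P f))"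

text \<open>
  \<open>spectral_projection V A B\<close> is \<open>\<chi>\<^sub>B(A)\<close>.  By the spectral theorem every bounded self-adjoint
  \<open>A\<close> on \<open>l2 V\<close> has a spectral measure, and its values on Borel sets are unique as operators on
  \<open>l2 V\<close>; the choice only concerns arguments outside of \<open>l2 V\<close> and non-Borel sets.
\<close>

definition spectral_projection ::
  "'v set \<Rightarrow> (('v \<Rightarrow> complex) \<Rightarrow> 'v \<Rightarrow> complex) \<Rightarrow>
   real set \<Rightarrow> ('v \<Rightarrow> complex) \<Rightarrow> 'v \<Rightarrow> complex" where
  "spectral_projection V A = (SOME P. is_spectral_measure V A P)"

definition vn_trace :: "'v set \<Rightarrow> (('v \<Rightarrow> complex) \<Rightarrow> 'v \<Rightarrow> complex) \<Rightarrow> complex" where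
  "vn_trace FV A = (\<Sum>v\<in>FV. l2_inner (A (delta v)) (delta v))"

text \<open>The trace of a projection is real, so taking the real part only changes the type.\<close>

definition spectral_density ::
  "'v set \<Rightarrow> 'v set \<Rightarrow> (('v \<Rightarrow> complex) \<Rightarrow> 'v \<Rightarrow> complex) \<Rightarrow> real \<Rightarrow> real" where
  "spectral_density V FV A x = Re (vn_trace FV (spectral_projection V A {..x}))"

end

theory Submission
  imports
    Defs
    "HOL-Probability.Helly_Selection"
    "HOL-Computational_Algebra.Fundamental_Theorem_Algebra"
    "HOL-Real_Asymp.Real_Asymp"
begin

text \<open>
  Away from the jumps of \<open>F\<close>, the statement is weak convergence of the normalised eigenvalue counting
  measures to the spectral measure: all moments converge, since the \<open>k\<close>-th powers of the restricted
  operator and of \<open>\<Delta>\<close> have the same diagonal entries at vertices that are far from the boundary, and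
  the other vertices are negligible by the Foelner property.

  A jump of \<open>F\<close> at \<open>x\<close> is inherited by the restricted operators by an argument of Elek: restrict the
  \<open>\<ell>\<^sup>2\<close>-eigenfunctions of \<open>\<Delta>\<close> for \<open>x\<close> to \<open>X\<^sub>m\<close>.  The restrictions span a space of dimension at
  least the trace of the compressed eigenprojection, and they satisfy the eigenvalue equation of the
  restricted operator off the boundary, so that at most as many dimensions as there are boundary
  vertices are lost.

  The spectral theorem is proved along the way: the scalar measures are obtained from the Hausdorff
  moment problem, and the projections from polarisation.
\<close>

section \<open>The Hausdorff moment problem\<close>

text \<open>Convergence of moments confines the limit points of the normalised counts only to the
  interval from the left limit of F at x up to F(x). The upper end needs no further work, so at a
  jump it suffices to bound from below the multiplicity of x as an eigenvalue of the restricted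
  operator. The compressed eigenprojection has trace exactly \<open>card (\<Lambda> m)\<close> times
  the jump, because vertices of one orbit have the same diagonal moments, and moments on a bounded
  interval determine a measure; the loss is a count of boundary vertices. Dirichlet and Neumann
  operators differ only in the arcs and degrees that are kept, so a single operator,
  \<open>magnetic_op\<close>, covers both. \<open>spectral_projection\<close> is an arbitrary choice
  among spectral measures: existence makes the choice meaningful, and afterwards only
  \<open>is_spectral_measure\<close> is available for the chosen one. That predicate sees the
  operator just through first moments of quadratic forms; the higher moments have to be recovered
  from multiplicativity of the projections.\<close>

lemma pascal_sum:
  fixes w :: "nat \<Rightarrow> nat \<Rightarrow> real"
  assumes rec: "\<And>a b. w a b = w (Suc a) b + w a (Suc b)"
  shows "(\<Sum>k\<le>N. real (N choose k) * w (a + k) (b + (N - k))) = w a b"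
proof (induction N arbitrary: a b)
  case 0
  then show ?case by simp
next
  case (Suc N)
  let ?t = "\<lambda>k. w (a + k) (b + (Suc N - k))"
  \<comment> \<open>Pascal's rule sorts the terms by their first step: those with
    \<open>N choose Suc k\<close>, together with \<open>?t 0\<close>, form the sum started at
    \<open>(a, Suc b)\<close>, those with \<open>N choose k\<close> the sum started at
    \<open>(Suc a, b)\<close>.\<close>
  have "(\<Sum>k\<le>Suc N. real (Suc N choose k) * ?t k)
      = ?t 0 + (\<Sum>k\<le>N. real (Suc N choose Suc k) * ?t (Suc k))"
    by (subst sum.atMost_Suc_shift) simp
  also have "\<dots> = (?t 0 + (\<Sum>k\<le>N. real (N choose Suc k) * ?t (Suc k)))
      + (\<Sum>k\<le>N. real (N choose k) * ?t (Suc k))"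
    by (simp add: algebra_simps sum.distrib)
  also have "?t 0 + (\<Sum>k\<le>N. real (N choose Suc k) * ?t (Suc k))
      = (\<Sum>k\<le>Suc N. real (N choose k) * ?t k)"
    by (subst sum.atMost_Suc_shift) simp
  also have "\<dots> = (\<Sum>k\<le>N. real (N choose k) * ?t k)"
    by simp
  also have "\<dots> = (\<Sum>k\<le>N. real (N choose k) * w (a + k) (Suc b + (N - k)))"
    by (intro sum.cong) (auto simp: Suc_diff_le)
  also have "\<dots> = w a (Suc b)"
    by (rule Suc.IH)
  also have "(\<Sum>k\<le>N. real (N choose k) * ?t (Suc k))
      = (\<Sum>k\<le>N. real (N choose k) * w (Suc a + k) (b + (N - k)))"
    by (intro sum.cong) auto
  also have "\<dots> = w (Suc a) b"
    by (rule Suc.IH)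
  finally show ?case
    using rec[of a b] by simp
qed

text \<open>If \<open>w a b\<close> is thought of as the integral of t^a (1-t)^b, this is the
  binomial identity E(k choose j) = (n choose j) t^j, integrated. Absorbing
  \<open>k choose j\<close> into \<open>n choose k\<close> leaves a Pascal sum of length
  \<open>n - j\<close> started at \<open>(j, 0)\<close>.\<close>

lemma pascal_moment:
  fixes w :: "nat \<Rightarrow> nat \<Rightarrow> real"
  assumes rec: "\<And>a b. w a b = w (Suc a) b + w a (Suc b)" and "j \<le> n"
  shows "(\<Sum>k\<le>n. real (k choose j) * (real (n choose k) * w k (n - k))) = real (n choose j) * w j 0"
proof -
  let ?g = "\<lambda>k. real (k choose j) * (real (n choose k) * w k (n - k))"
  have "(\<Sum>k\<le>n. ?g k) = (\<Sum>k\<in>{j..n}. ?g k)"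
    by (intro sum.mono_neutral_right) auto
  also have "\<dots> = (\<Sum>i\<le>n - j. ?g (j + i))"
    using assms(2) by (intro sum.reindex_bij_witness[of _ "\<lambda>i. j + i" "\<lambda>k. k - j"]) auto
  also have "\<dots> = (\<Sum>i\<le>n - j. real (n choose j) * (real ((n - j) choose i) * w (j + i) (0 + ((n - j) - i))))"
  proof (intro sum.cong refl)
    fix i assume i: "i \<in> {..n - j}"
    then have "(n choose (j + i)) * ((j + i) choose j) = (n choose j) * ((n - j) choose i)"
      using choose_mult[of j "j + i" n] assms(2) by auto
    then have "real (n choose (j + i)) * real ((j + i) choose j) = real (n choose j) * real ((n - j) choose i)"
      by (metis of_nat_mult)
    moreover have "n - (j + i) = (n - j) - i" by simp
    ultimately show "?g (j + i) = real (n choose j) * (real ((n - j) choose i) * w (j + i) (0 + ((n - j) - i)))"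
      by (simp add: algebra_simps)
  qed
  also have "\<dots> = real (n choose j) * w j 0"
    by (simp only: sum_distrib_left[symmetric] pascal_sum[of w, OF rec])
  finally show ?thesis .
qed

text \<open>\<open>pascal_moment\<close> evaluates binomial moments exactly; this passes to power
  moments. The ratio is a product of \<open>j\<close> factors (k-i)/(n-i), each close to k/n, and
  products of numbers of modulus at most 1 differ by at most the sum of the differences of their
  factors. The assumption \<open>2 * j \<le> n\<close> keeps the factors in that range even when k <
  i.\<close>

lemma choose_ratio_approx:
  assumes "k \<le> n" "2 * j \<le> n" "0 < n"
  shows "\<bar>(real k / real n) ^ j - real (k choose j) / real (n choose j)\<bar> \<le> real j * (real j / (real n - real j))"
proof -
  have r: "real (k choose j) / real (n choose j) = (\<Prod>i<j. (real k - real i) / (real n - real i))"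
  proof -
    have "real (k choose j) = (\<Prod>i<j. real k - real i) / fact j"
      "real (n choose j) = (\<Prod>i<j. real n - real i) / fact j"
      by (simp_all add: binomial_gbinomial gbinomial_prod_rev atLeast0LessThan)
    then show ?thesis
      by (simp add: prod_dividef)
  qed
  have "norm ((\<Prod>i<j. real k / real n) - (\<Prod>i<j. (real k - real i) / (real n - real i)))
      \<le> (\<Sum>i<j. norm (real k / real n - (real k - real i) / (real n - real i)))"
  proof (rule norm_prod_diff)
    fix i assume i: "i \<in> {..<j}"
    show "norm (real k / real n) \<le> 1"
      using assms by simp
    have "real i < real n - real i" and "real n - real i > 0"
      using i assms by auto
    moreover have "\<bar>real k - real i\<bar> \<le> real n - real i"
      using i assms by (auto simp: abs_le_iff)
    ultimately show "norm ((real k - real i) / (real n - real i)) \<le> 1"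
      by (simp add: abs_divide)
  qed
  also have "\<dots> \<le> (\<Sum>i<j. real j / (real n - real j))"
  proof (rule sum_mono)
    fix i assume i: "i \<in> {..<j}"
    have pos: "real n - real i > 0" "real n - real j > 0" using i assms by auto
    have "real k / real n - (real k - real i) / (real n - real i)
        = real i * (real n - real k) / (real n * (real n - real i))"
      using pos assms by (simp add: field_simps)
    also have "norm \<dots> = (real i / (real n - real i)) * ((real n - real k) / real n)"
      using pos assms by (simp add: abs_mult)
    also have "\<dots> \<le> (real i / (real n - real i)) * 1"
      using pos assms by (intro mult_left_mono) auto
    also have "\<dots> \<le> real j / (real n - real j)"
      using pos i by (auto intro!: frac_le)
    finally show "norm (real k / real n - (real k - real i) / (real n - real i)) \<le> real j / (real n - real j)" .
  qed
  finally show ?thesis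
    using r by simp
qed

text \<open>Weak convergence is tested against bounded continuous functions on the whole line, which
  powers are not; powers of \<open>clamp01\<close> are, and they agree with ordinary powers on
  \<open>{0..1}\<close>.\<close>

definition clamp01 :: "real \<Rightarrow> real" where "clamp01 t = max 0 (min 1 t)"

lemma clamp01: "0 \<le> clamp01 t" "clamp01 t \<le> 1" "0 \<le> t \<Longrightarrow> t \<le> 1 \<Longrightarrow> clamp01 t = t"
  by (auto simp: clamp01_def)

lemma continuous_clamp01: "isCont clamp01 t"
  unfolding clamp01_def by (intro continuous_intros)

lemma borel_measurable_clamp01 [measurable]: "clamp01 \<in> borel_measurable borel"
  unfolding clamp01_def by measurable

text \<open>The Bernstein weights \<open>(n choose k) * w k (n - k)\<close> placed at the points \<open>k / n\<close> are probability
  measures whose moments converge to \<open>w j 0\<close>; a limit point exists by Helly's theorem.\<close>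

lemma hausdorff_moment_prob:
  fixes w :: "nat \<Rightarrow> nat \<Rightarrow> real"
  assumes nonneg: "\<And>a b. 0 \<le> w a b" and rec: "\<And>a b. w a b = w (Suc a) b + w a (Suc b)"
    and one: "w 0 0 = 1"
  shows "\<exists>M. finite_measure M \<and> sets M = sets borel \<and> (AE t in M. t \<in> {0..1}) \<and>
    (\<forall>j. (\<integral>t. t ^ j \<partial>M) = w j 0)"
proof -
  define p where "p n k = real (n choose k) * w k (n - k)" for n k
  have p_nonneg: "0 \<le> p n k" for n k
    by (simp add: p_def nonneg)
  have p_sum: "(\<Sum>k\<le>n. p n k) = 1" for n
    using pascal_sum[of w n 0 0, OF rec] one by (simp add: p_def)
  define \<mu> where "\<mu> n = distr (point_measure {..n} (\<lambda>k. ennreal (p n k))) borel (\<lambda>k. real k / real n)" for n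
  have meas: "(\<lambda>k. real k / real n) \<in> measurable (point_measure {..n} (\<lambda>k. ennreal (p n k))) borel" for n
    by simp
  have int: "(\<integral>t. f t \<partial>\<mu> n) = (\<Sum>k\<le>n. p n k * f (real k / real n))"
    if "f \<in> borel_measurable borel" for f :: "real \<Rightarrow> real" and n
  proof -
    have "(\<integral>t. f t \<partial>\<mu> n) = (\<integral>k. f (real k / real n) \<partial>point_measure {..n} (\<lambda>k. ennreal (p n k)))"
      unfolding \<mu>_def by (intro integral_distr meas that)
    also have "\<dots> = (\<Sum>k\<le>n. p n k *\<^sub>R f (real k / real n))"
      by (intro lebesgue_integral_point_measure_finite) (auto simp: p_nonneg)
    finally show ?thesis by simp
  qed
  have dist: "real_distribution (\<mu> n)" for n
  proof -
    have "prob_space (point_measure {..n} (\<lambda>k. ennreal (p n k)))"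
    proof
      show "emeasure (point_measure {..n} (\<lambda>k. ennreal (p n k))) (space (point_measure {..n} (\<lambda>k. ennreal (p n k)))) = 1"
        using p_nonneg p_sum by (simp add: space_point_measure emeasure_point_measure_finite sum_ennreal)
    qed
    then interpret prob_space "point_measure {..n} (\<lambda>k. ennreal (p n k))" .
    have "prob_space (\<mu> n)"
      unfolding \<mu>_def by (rule prob_space_distr[OF meas])
    then show ?thesis
      by (auto simp: real_distribution_def real_distribution_axioms_def \<mu>_def)
  qed
  have tight: "tight \<mu>"
    unfolding tight_def
  proof (intro conjI allI impI)
    fix e :: real assume e: "0 < e"
    show "\<exists>a b. a < b \<and> (\<forall>n. 1 - e < measure (\<mu> n) {a<..b})"
    proof (intro exI conjI allI)
      \<comment> \<open>All mass lies in \<open>{0..1}\<close>; the half-open interval must start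
        below 0 to catch the point 0.\<close>
      show "(-1::real) < 1" by simp
      fix n
      interpret real_distribution "\<mu> n" by (rule dist)
      have "measure (\<mu> n) {-1<..1} = (\<integral>t. indicator {-1<..1} t \<partial>\<mu> n)"
        by simp
      also have "\<dots> = (\<Sum>k\<le>n. p n k * indicator {-1<..1} (real k / real n))"
        by (intro int) auto
      also have "\<dots> = (\<Sum>k\<le>n. p n k)"
      proof (intro sum.cong refl)
        fix k assume "k \<in> {..n}"
        then have "0 \<le> real k / real n" "real k / real n \<le> 1"
          by (auto simp: divide_le_eq)
        moreover from this have "-1 < real k / real n"
          by (meson less_le_trans neg_less_0_iff_less zero_less_one)
        ultimately show "p n k * indicator {-1<..1} (real k / real n) = p n k"
          by (simp add: indicator_def)
      qed
      finally show "1 - e < measure (\<mu> n) {-1<..1}"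
        using p_sum e by simp
    qed
  qed (rule dist)
  obtain r M where r: "strict_mono (r :: nat \<Rightarrow> nat)" and M: "real_distribution M"
    and conv: "weak_conv_m (\<mu> \<circ> id \<circ> r) M"
    using tight_imp_convergent_subsubsequence[OF tight strict_mono_id] by blast
  interpret M: real_distribution M by fact
  have mom: "(\<integral>t. clamp01 t ^ j \<partial>M) = w j 0" for j
  proof -
    have "(\<lambda>n. \<integral>t. clamp01 t ^ j \<partial>(\<mu> \<circ> id \<circ> r) n) \<longlonglongrightarrow> (\<integral>t. clamp01 t ^ j \<partial>M)"
    proof (rule weak_conv_imp_integral_bdd_continuous_conv[OF _ M conv, where B = 1])
      show "real_distribution ((\<mu> \<circ> id \<circ> r) n)" for n by (simp add: dist)
      show "isCont (\<lambda>t. clamp01 t ^ j) t" for t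
        by (intro isCont_power continuous_clamp01)
      show "norm (clamp01 t ^ j) \<le> 1" for t
        by (simp add: norm_power power_le_one clamp01)
    qed
    moreover have "(\<lambda>n. \<integral>t. clamp01 t ^ j \<partial>(\<mu> \<circ> id \<circ> r) n) \<longlonglongrightarrow> w j 0"
    proof -
      have "(\<lambda>n. (\<integral>t. clamp01 t ^ j \<partial>\<mu> n) - w j 0) \<longlonglongrightarrow> 0"
      proof (rule Lim_null_comparison)
        show "(\<lambda>n. real j * (real j / (real n - real j))) \<longlonglongrightarrow> 0"
          by real_asymp

        show "\<forall>\<^sub>F n in sequentially. norm ((\<integral>t. clamp01 t ^ j \<partial>\<mu> n) - w j 0) \<le> real j * (real j / (real n - real j))"
          using eventually_ge_at_top[of "2 * j + 1"]
        proof eventually_elim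
          case (elim n)
          have "(\<integral>t. clamp01 t ^ j \<partial>\<mu> n) = (\<Sum>k\<le>n. p n k * clamp01 (real k / real n) ^ j)"
            by (intro int) auto
          also have "\<dots> = (\<Sum>k\<le>n. p n k * (real k / real n) ^ j)"
            using elim by (intro sum.cong refl) (auto simp: clamp01(3) divide_le_eq)
          finally have 1: "(\<integral>t. clamp01 t ^ j \<partial>\<mu> n) = (\<Sum>k\<le>n. p n k * (real k / real n) ^ j)" .
          have c: "real (n choose j) > 0" using elim by simp
          have "(\<Sum>k\<le>n. real (k choose j) * p n k) = real (n choose j) * w j 0"
            unfolding p_def using elim by (intro pascal_moment rec) auto
          then have "w j 0 = (\<Sum>k\<le>n. real (k choose j) * p n k) / real (n choose j)"
            using c by (simp add: field_simps)
          also have "\<dots> = (\<Sum>k\<le>n. p n k * (real (k choose j) / real (n choose j)))"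
            by (simp add: sum_divide_distrib mult.commute)
          finally have "(\<integral>t. clamp01 t ^ j \<partial>\<mu> n) - w j 0
              = (\<Sum>k\<le>n. p n k * ((real k / real n) ^ j - real (k choose j) / real (n choose j)))"
            unfolding 1 by (simp add: sum_subtractf algebra_simps)
          also have "norm \<dots> \<le> (\<Sum>k\<le>n. p n k * (real j * (real j / (real n - real j))))"
          proof (rule order_trans[OF norm_sum], rule sum_mono)
            fix k assume "k \<in> {..n}"
            then show "norm (p n k * ((real k / real n) ^ j - real (k choose j) / real (n choose j)))
                \<le> p n k * (real j * (real j / (real n - real j)))"
              using mult_left_mono[OF choose_ratio_approx[of k n j] p_nonneg[of n k]] elim
              by (simp add: abs_mult p_nonneg)
          qed
          also have "\<dots> = real j * (real j / (real n - real j))"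
            unfolding sum_distrib_right[symmetric] p_sum by simp
          finally show ?case .
        qed
      qed
      then have "(\<lambda>n. \<integral>t. clamp01 t ^ j \<partial>\<mu> n) \<longlonglongrightarrow> w j 0"
        by (simp add: LIM_zero_iff)
      from LIMSEQ_subseq_LIMSEQ[OF this r] show ?thesis
        by (simp add: o_def)
    qed
    ultimately show ?thesis
      by (rule LIMSEQ_unique)
  qed
  \<comment> \<open>Pushing the limit forward along \<open>clamp01\<close> puts its support into
    \<open>{0..1}\<close> by construction and turns the clamped moments into genuine ones.\<close>
  have mc: "clamp01 \<in> measurable M borel" by simp
  show ?thesis
  proof (intro exI[of _ "distr M borel clamp01"] conjI allI)
    show "finite_measure (distr M borel clamp01)"
      by (rule M.finite_measure_distr[OF mc])
    show "AE t in distr M borel clamp01. t \<in> {0..1}"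
      by (subst AE_distr_iff[OF mc]) (auto simp: clamp01)
    show "(\<integral>t. t ^ j \<partial>distr M borel clamp01) = w j 0" for j
      by (subst integral_distr[OF mc]) (auto simp: mom)
  qed simp
qed

text \<open>Normalisation of the total mass \<open>w 0 0\<close>. If it vanishes, nonnegativity and
  the recursion force every \<open>w j 0\<close> to vanish, and the null measure serves.\<close>

lemma hausdorff_moment:
  fixes w :: "nat \<Rightarrow> nat \<Rightarrow> real"
  assumes nonneg: "\<And>a b. 0 \<le> w a b" and rec: "\<And>a b. w a b = w (Suc a) b + w a (Suc b)"
  shows "\<exists>M. finite_measure M \<and> sets M = sets borel \<and> (AE t in M. t \<in> {0..1}) \<and>
    (\<forall>j. (\<integral>t. t ^ j \<partial>M) = w j 0)"
proof (cases "w 0 0 = 0")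
  case True
  have "w j 0 = 0" for j
  proof (induction j)
    case (Suc j)
    with rec[of j 0] nonneg[of "Suc j" 0] nonneg[of j 1] show ?case by simp
  qed (rule True)
  then show ?thesis
    by (intro exI[of _ "null_measure borel"] conjI allI finite_measureI AE_I[where N = UNIV]) simp_all
next
  case False
  define c where "c = w 0 0"
  have c: "c > 0" using False nonneg[of 0 0] by (simp add: c_def)
  obtain M where M: "finite_measure M" "sets M = sets borel" "AE t in M. t \<in> {0..1}"
    and mom: "\<And>j. (\<integral>t. t ^ j \<partial>M) = w j 0 / c"
  proof -
    have "w a b / c = w (Suc a) b / c + w a (Suc b) / c" for a b
      by (subst rec) (rule add_divide_distrib)
    moreover have "0 \<le> w a b / c" for a b
      using c nonneg by simp
    moreover have "w 0 0 / c = 1"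
      using c by (simp add: c_def)
    ultimately show thesis
      using hausdorff_moment_prob[of "\<lambda>a b. w a b / c"] that by blast
  qed
  interpret M: finite_measure M by fact
  show ?thesis
  proof (intro exI[of _ "density M (\<lambda>_. ennreal c)"] conjI allI)
    show "finite_measure (density M (\<lambda>_. ennreal c))"
      by (rule finite_measureI)
        (simp add: emeasure_density M.emeasure_eq_measure ennreal_mult_eq_top_iff)
    show "AE t in density M (\<lambda>_. ennreal c). t \<in> {0..1}"
      using M(3) by (subst AE_density) auto
    have "(\<integral>t. t ^ j \<partial>density M (\<lambda>_. ennreal c)) = (\<integral>t. c * t ^ j \<partial>M)" for j
      using c M(2) by (subst integral_density) (auto simp: measurable_cong_sets[OF M(2) refl])
    then show "(\<integral>t. t ^ j \<partial>density M (\<lambda>_. ennreal c)) = w j 0" for j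
      using c by (simp add: mom)
  qed (simp add: M(2))
qed

section \<open>Functionals of integral type on bounded Borel functions\<close>

definition bdd_borel :: "real \<Rightarrow> (real \<Rightarrow> real) \<Rightarrow> bool" where
  "bdd_borel K \<phi> \<longleftrightarrow> \<phi> \<in> borel_measurable borel \<and> (\<exists>C. \<forall>t\<in>{-K..K}. \<bar>\<phi> t\<bar> \<le> C)"

text \<open>The combinations of integrals with respect to finite measures on \<open>{-K..K}\<close>, characterised by
  linearity and bounded convergence; this class is closed under polarisation and under densities, so
  that no complex measures are needed.\<close>

definition spectral_functional :: "real \<Rightarrow> ((real \<Rightarrow> real) \<Rightarrow> complex) \<Rightarrow> bool" where
  "spectral_functional K \<Theta> \<longleftrightarrow>
    (\<forall>\<phi> \<psi> c. bdd_borel K \<phi> \<longrightarrow> bdd_borel K \<psi> \<longrightarrow>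
       \<Theta> (\<lambda>t. \<phi> t + c * \<psi> t) = \<Theta> \<phi> + of_real c * \<Theta> \<psi>) \<and>
    (\<forall>\<phi>s \<phi> C. (\<forall>n :: nat. bdd_borel K (\<phi>s n)) \<longrightarrow> bdd_borel K \<phi> \<longrightarrow>
       (\<forall>n. \<forall>t\<in>{-K..K}. \<bar>\<phi>s n t\<bar> \<le> C) \<longrightarrow> (\<forall>t\<in>{-K..K}. (\<lambda>n. \<phi>s n t) \<longlonglongrightarrow> \<phi> t) \<longrightarrow>
       (\<lambda>n. \<Theta> (\<phi>s n)) \<longlonglongrightarrow> \<Theta> \<phi>)"

lemma bdd_borelI: "\<phi> \<in> borel_measurable borel \<Longrightarrow> (\<And>t. t \<in> {-K..K} \<Longrightarrow> \<bar>\<phi> t\<bar> \<le> C) \<Longrightarrow> bdd_borel K \<phi>"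
  unfolding bdd_borel_def by blast

lemma bdd_borel_continuous: "continuous_on UNIV \<phi> \<Longrightarrow> bdd_borel K \<phi>"
proof -
  assume c: "continuous_on UNIV \<phi>"
  have "compact (\<phi> ` {-K..K})"
    by (intro compact_continuous_image continuous_on_subset[OF c]) auto
  then have "bounded (\<phi> ` {-K..K})" by (rule compact_imp_bounded)
  then obtain C where "\<forall>t\<in>{-K..K}. \<bar>\<phi> t\<bar> \<le> C" by (auto simp: bounded_iff)
  then show ?thesis
    using c by (auto simp: bdd_borel_def intro: borel_measurable_continuous_onI)
qed

lemma bdd_borel_power [simp]: "bdd_borel K (\<lambda>t. t ^ k)" "bdd_borel K (\<lambda>t. t)"
  by (intro bdd_borel_continuous continuous_intros)+

lemma bdd_borel_indicator [simp]: "B \<in> sets borel \<Longrightarrow> bdd_borel K (indicator B)"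
  by (rule bdd_borelI[where C = 1]) (auto simp: indicator_def)

lemma bdd_borel_const [simp]: "bdd_borel K (\<lambda>_. c)"
  by (rule bdd_borel_continuous) auto

lemma bdd_borel_mult:
  assumes "bdd_borel K \<phi>" "bdd_borel K \<psi>"
  shows "bdd_borel K (\<lambda>t. \<phi> t * \<psi> t)"
proof -
  obtain C D where b: "\<forall>t\<in>{-K..K}. \<bar>\<phi> t\<bar> \<le> C" "\<forall>t\<in>{-K..K}. \<bar>\<psi> t\<bar> \<le> D"
    using assms by (auto simp: bdd_borel_def)
  show ?thesis
  proof (rule bdd_borelI[where C = "\<bar>C\<bar> * \<bar>D\<bar>"])
    fix t assume "t \<in> {-K..K}"
    then have "\<bar>\<phi> t\<bar> \<le> C" "\<bar>\<psi> t\<bar> \<le> D" using b by blast+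
    then have "\<bar>\<phi> t\<bar> \<le> \<bar>C\<bar>" "\<bar>\<psi> t\<bar> \<le> \<bar>D\<bar>" by linarith+
    then show "\<bar>\<phi> t * \<psi> t\<bar> \<le> \<bar>C\<bar> * \<bar>D\<bar>"
      by (simp add: abs_mult mult_mono)
  qed (use assms in \<open>auto simp: bdd_borel_def\<close>)
qed

lemma bdd_borel_add:
  assumes "bdd_borel K \<phi>" "bdd_borel K \<psi>"
  shows "bdd_borel K (\<lambda>t. \<phi> t + \<psi> t)"
proof -
  obtain C D where b: "\<forall>t\<in>{-K..K}. \<bar>\<phi> t\<bar> \<le> C" "\<forall>t\<in>{-K..K}. \<bar>\<psi> t\<bar> \<le> D"
    using assms by (auto simp: bdd_borel_def)
  show ?thesis
  proof (rule bdd_borelI[where C = "C + D"])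
    fix t assume "t \<in> {-K..K}"
    then have "\<bar>\<phi> t\<bar> \<le> C" "\<bar>\<psi> t\<bar> \<le> D" using b by auto
    then show "\<bar>\<phi> t + \<psi> t\<bar> \<le> C + D" by linarith
  qed (use assms in \<open>auto simp: bdd_borel_def\<close>)
qed

lemma bdd_borel_sum:
  "finite I \<Longrightarrow> (\<And>i. i \<in> I \<Longrightarrow> bdd_borel K (\<phi> i)) \<Longrightarrow> bdd_borel K (\<lambda>t. \<Sum>i\<in>I. \<phi> i t)"
  by (induction I rule: finite_induct) (auto simp: bdd_borel_add)

context
  fixes K :: real and \<Theta> :: "(real \<Rightarrow> real) \<Rightarrow> complex"
  assumes \<Theta>: "spectral_functional K \<Theta>"
begin

lemma spectral_functional_conv:
  assumes "\<And>n :: nat. bdd_borel K (\<phi>s n)" "bdd_borel K \<phi>"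
    and "\<And>n t. t \<in> {-K..K} \<Longrightarrow> \<bar>\<phi>s n t\<bar> \<le> C"
    and "\<And>t. t \<in> {-K..K} \<Longrightarrow> (\<lambda>n. \<phi>s n t) \<longlonglongrightarrow> \<phi> t"
  shows "(\<lambda>n. \<Theta> (\<phi>s n)) \<longlonglongrightarrow> \<Theta> \<phi>"
  using \<Theta> assms unfolding spectral_functional_def by blast

lemma spectral_functional_lin:
  "bdd_borel K \<phi> \<Longrightarrow> bdd_borel K \<psi> \<Longrightarrow> \<Theta> (\<lambda>t. \<phi> t + c * \<psi> t) = \<Theta> \<phi> + of_real c * \<Theta> \<psi>"
  using \<Theta> unfolding spectral_functional_def by blast

text \<open>Bounded convergence is demanded only on \<open>{-K..K}\<close>, so the constant sequence
  \<open>\<phi>\<close> counts as converging to \<open>\<psi>\<close>.\<close>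

lemma spectral_functional_cong:
  assumes "bdd_borel K \<phi>" "bdd_borel K \<psi>" "\<And>t. t \<in> {-K..K} \<Longrightarrow> \<phi> t = \<psi> t"
  shows "\<Theta> \<phi> = \<Theta> \<psi>"
proof -
  obtain C where C: "\<forall>t\<in>{-K..K}. \<bar>\<phi> t\<bar> \<le> C" using assms(1) by (auto simp: bdd_borel_def)
  have "(\<lambda>n. \<Theta> ((\<lambda>n :: nat. \<phi>) n)) \<longlonglongrightarrow> \<Theta> \<psi>"
    by (rule spectral_functional_conv[where C = C]) (use assms C in auto)
  then show ?thesis
    by (simp add: LIMSEQ_const_iff)
qed

lemma spectral_functional_zero: "\<Theta> (\<lambda>_. 0) = 0"
  using spectral_functional_lin[of "\<lambda>_. 0" "\<lambda>_. 0" 1] by simp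

lemma spectral_functional_add:
  "bdd_borel K \<phi> \<Longrightarrow> bdd_borel K \<psi> \<Longrightarrow> \<Theta> (\<lambda>t. \<phi> t + \<psi> t) = \<Theta> \<phi> + \<Theta> \<psi>"
  using spectral_functional_lin[of \<phi> \<psi> 1] by simp

lemma spectral_functional_cmult:
  "bdd_borel K \<phi> \<Longrightarrow> \<Theta> (\<lambda>t. c * \<phi> t) = of_real c * \<Theta> \<phi>"
  using spectral_functional_lin[of "\<lambda>_. 0" \<phi> c] spectral_functional_zero by simp

lemma spectral_functional_sum:
  "finite I \<Longrightarrow> (\<And>i. i \<in> I \<Longrightarrow> bdd_borel K (\<phi> i)) \<Longrightarrow>
    \<Theta> (\<lambda>t. \<Sum>i\<in>I. \<phi> i t) = (\<Sum>i\<in>I. \<Theta> (\<phi> i))"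
  by (induction I rule: finite_induct)
    (auto simp: spectral_functional_zero spectral_functional_add bdd_borel_sum)

text \<open>Simple functions are finite combinations of indicators, and they approximate
  \<open>\<phi>\<close> pointwise while staying below twice its modulus, so that bounded convergence
  applies.\<close>

lemma spectral_functional_eq_0_if_indicator:
  assumes ind: "\<And>B. B \<in> sets borel \<Longrightarrow> \<Theta> (indicator B) = 0" and \<phi>: "bdd_borel K \<phi>"
  shows "\<Theta> \<phi> = 0"
proof -
  have m: "\<phi> \<in> borel_measurable borel" using \<phi> by (simp add: bdd_borel_def)
  obtain C where C: "\<forall>t\<in>{-K..K}. \<bar>\<phi> t\<bar> \<le> C" using \<phi> by (auto simp: bdd_borel_def)
  obtain F where F: "\<And>i. simple_function borel (F i)" "\<And>t. (\<lambda>i. F i t) \<longlonglongrightarrow> \<phi> t"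
    and Fb: "\<And>i t. dist (F i t) 0 \<le> 2 * dist (\<phi> t) 0"
    using borel_measurable_implies_sequence_metric[OF m, of 0] by auto
  have Fbd: "bdd_borel K (F i)" and F0: "\<Theta> (F i) = 0" for i
  proof -
    have fin: "finite (range (F i))" and me: "\<And>y. F i -` {y} \<in> sets borel"
      using F(1)[of i] measurable_sets_borel[OF borel_measurable_simple_function[OF F(1)[of i]], of "{y}" for y]
      by (auto simp: simple_function_def)
    have eq: "F i = (\<lambda>t. \<Sum>y\<in>range (F i). y * indicator (F i -` {y}) t)"
    proof
      fix t
      have "(\<Sum>y\<in>range (F i). y * indicator (F i -` {y}) t) = (\<Sum>y\<in>{F i t}. y * indicator (F i -` {y}) t)"
        using fin by (intro sum.mono_neutral_right) (auto simp: indicator_def)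
      then show "F i t = (\<Sum>y\<in>range (F i). y * indicator (F i -` {y}) t)" by simp
    qed
    have b: "bdd_borel K (\<lambda>t. y * indicator (F i -` {y}) t)" for y
      using me by (intro bdd_borel_mult) auto
    show "bdd_borel K (F i)"
      by (subst eq, rule bdd_borel_sum) (use fin b in auto)
    show "\<Theta> (F i) = 0"
      by (subst eq, subst spectral_functional_sum) (use fin b me ind in \<open>auto simp: spectral_functional_cmult\<close>)
  qed
  have "(\<lambda>i. \<Theta> (F i)) \<longlonglongrightarrow> \<Theta> \<phi>"
  proof (rule spectral_functional_conv[where C = "2 * C"])
    show "\<bar>F i t\<bar> \<le> 2 * C" if "t \<in> {-K..K}" for i t
      using Fb[of i t] C that by force
  qed (use Fbd \<phi> F in auto)
  then show ?thesis
    by (simp add: F0 LIMSEQ_const_iff)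
qed

text \<open>Determinacy of the moment problem on a bounded interval. Weierstrass approximation gives
  vanishing on continuous functions, continuous ramps give half-lines, and half-lines generate the
  Borel sets. This is the main device for proving identities: two functionals agree as soon as they
  agree on powers.\<close>

lemma spectral_functional_eq_0_if_moments:
  assumes mom: "\<And>k. \<Theta> (\<lambda>t. t ^ k) = 0" and \<phi>: "bdd_borel K \<phi>"
  shows "\<Theta> \<phi> = 0"
proof (rule spectral_functional_eq_0_if_indicator[OF _ \<phi>])
  have cont: "\<Theta> f = 0" if f: "continuous_on UNIV f" for f
  proof -
    have "\<exists>g. real_polynomial_function g \<and> (\<forall>t\<in>{-K..K}. \<bar>f t - g t\<bar> < 1 / real (Suc n))" for n
      using Stone_Weierstrass_real_polynomial_function[of "{-K..K}" f "1 / real (Suc n)"]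
        continuous_on_subset[OF f] by (metis compact_Icc of_nat_0_less_iff subset_UNIV zero_less_Suc zero_less_divide_1_iff)
    then obtain g where g: "\<And>n. real_polynomial_function (g n)"
      and gf: "\<And>n t. t \<in> {-K..K} \<Longrightarrow> \<bar>f t - g n t\<bar> < 1 / real (Suc n)"
      by metis
    have g0: "\<Theta> (g n) = 0" and gb: "bdd_borel K (g n)" for n
    proof -
      obtain a N where gn: "g n = (\<lambda>x. \<Sum>i\<le>N. a i * x ^ i)"
        using g[of n] unfolding real_polynomial_function_iff_sum by auto
      have b: "bdd_borel K (\<lambda>x. a i * x ^ i)" for i by (intro bdd_borel_mult) auto
      show "bdd_borel K (g n)"
        unfolding gn by (intro bdd_borel_sum b) auto
      show "\<Theta> (g n) = 0"
        unfolding gn by (subst spectral_functional_sum) (use b mom in \<open>auto simp: spectral_functional_cmult\<close>)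
    qed
    have fb: "bdd_borel K f" by (rule bdd_borel_continuous[OF f])
    then obtain C where C: "\<forall>t\<in>{-K..K}. \<bar>f t\<bar> \<le> C" by (auto simp: bdd_borel_def)
    have "(\<lambda>n. \<Theta> (g n)) \<longlonglongrightarrow> \<Theta> f"
    proof (rule spectral_functional_conv[where C = "C + 1"])
      fix n t assume t: "t \<in> {-K..K}"
      have "1 / real (Suc n) \<le> 1" by simp
      then show "\<bar>g n t\<bar> \<le> C + 1"
        using gf[OF t, of n] C t by (smt (verit, best))
    next
      fix t assume t: "t \<in> {-K..K}"
      have "(\<lambda>n. g n t - f t) \<longlonglongrightarrow> 0"
      proof (rule Lim_null_comparison)
        show "\<forall>\<^sub>F n in sequentially. norm (g n t - f t) \<le> 1 / real (Suc n)"
          using gf[OF t] by (intro always_eventually allI) (simp add: abs_minus_commute less_imp_le)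
        show "(\<lambda>n. 1 / real (Suc n)) \<longlonglongrightarrow> 0"
          by real_asymp
      qed
      then show "(\<lambda>n. g n t) \<longlonglongrightarrow> f t" by (simp add: LIM_zero_iff)
    qed (use gb fb in auto)
    then show ?thesis
      by (simp add: g0 LIMSEQ_const_iff)
  qed
  have atMost: "\<Theta> (indicator {..x}) = 0" for x
  proof -
    \<comment> \<open>Equal to 1 on \<open>{..x}\<close> and descending to 0 on an interval of
      length 1/n to the right of x.\<close>
    define f where "f n t = max 0 (min 1 (1 - real n * (t - x)))" for n t
    have fc: "continuous_on UNIV (f n)" for n
      unfolding f_def by (intro continuous_intros)
    have "(\<lambda>n. \<Theta> (f n)) \<longlonglongrightarrow> \<Theta> (indicator {..x})"
    proof (rule spectral_functional_conv[where C = 1])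
      fix t
      show "(\<lambda>n. f n t) \<longlonglongrightarrow> indicator {..x} t"
      proof (cases "t \<le> x")
        case True
        then have "f n t = 1" for n
          using mult_nonneg_nonpos[of "real n" "t - x"] by (simp add: f_def)
        then show ?thesis using True by simp
      next
        case False
        have "\<forall>\<^sub>F n in sequentially. 1 / (t - x) < real n"
          using filterlim_real_sequentially unfolding filterlim_at_top_dense by blast
        then have "\<forall>\<^sub>F n in sequentially. f n t = 0"
        proof eventually_elim
          case (elim n)
          then have "1 < real n * (t - x)" using False by (simp add: field_simps)
          then show ?case by (simp add: f_def)
        qed
        then show ?thesis
          using False by (auto intro: tendsto_eventually)
      qed
      show "\<bar>f n t\<bar> \<le> 1" for n
        by (simp add: f_def)
    qed (simp_all add: bdd_borel_continuous[OF fc])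
    then show ?thesis
      by (simp add: cont[OF fc] LIMSEQ_const_iff)
  qed
  \<comment> \<open>Dynkin's argument: the half-lines are stable under intersection, and the sets on
    whose indicator \<open>\<Theta>\<close> vanishes are closed under complements and disjoint
    countable unions.\<close>
  fix B :: "real set" assume "B \<in> sets borel"
  then have sig: "B \<in> sigma_sets UNIV (range (\<lambda>a. {..a}))"
    unfolding borel_eq_atMost by (simp add: sets_measure_of)
  have "Int_stable (range (\<lambda>a :: real. {..a}))"
    by (auto simp: Int_stable_def)
  moreover have "range (\<lambda>a :: real. {..a}) \<subseteq> Pow UNIV" by simp
  ultimately show "\<Theta> (indicator B) = 0"
    using sig
  proof (induction B rule: sigma_sets_induct_disjoint)
    case (basic A)
    then show ?case using atMost by auto
  next
    case empty
    then show ?case using spectral_functional_zero by simp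
  next
    case (compl A)
    then have A: "A \<in> sets borel"
      unfolding borel_eq_atMost by (simp add: sets_measure_of)
    have "\<Theta> (\<lambda>t. 1) = 0" using mom[of 0] by simp
    moreover have "indicator (UNIV - A) = (\<lambda>t. 1 + (- 1) * indicator A t :: real)"
      by (auto simp: indicator_def)
    ultimately show ?case
      using spectral_functional_lin[of "\<lambda>_. 1" "indicator A" "-1"] A compl by simp
  next
    case (union A)
    then have A: "\<And>i. A i \<in> sets borel"
      unfolding borel_eq_atMost by (auto simp: sets_measure_of)
    have "(\<lambda>n. \<Theta> (\<lambda>t. \<Sum>i<n. indicator (A i) t)) \<longlonglongrightarrow> \<Theta> (indicator (\<Union>i. A i))"
    proof (rule spectral_functional_conv[where C = 1])
      fix t
      show "(\<lambda>n. \<Sum>i<n. indicator (A i) t) \<longlonglongrightarrow> (indicator (\<Union>i. A i) t :: real)"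
      proof -
        have "(\<lambda>n. indicator (\<Union>i<n. A i) t) \<longlonglongrightarrow> (indicator (\<Union>i. A i) t :: real)"
          by (rule LIMSEQ_indicator_UN)
        moreover have "(\<Sum>i<n. indicator (A i) t) = (indicator (\<Union>i<n. A i) t :: real)" for n
          using union(1) by (subst indicator_UN_disjoint) (auto simp: disjoint_family_on_def)
        ultimately show ?thesis by simp
      qed
      show "\<bar>\<Sum>i<n. indicator (A i) t\<bar> \<le> (1::real)" for n
      proof -
        have "(\<Sum>i<n. indicator (A i) t) = (indicator (\<Union>i<n. A i) t :: real)"
          using union(1) by (subst indicator_UN_disjoint) (auto simp: disjoint_family_on_def)
        then show ?thesis by (simp add: indicator_def)
      qed
    qed (use A in \<open>auto intro!: bdd_borel_sum bdd_borel_indicator sets.countable_UN\<close>)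
    moreover have "\<Theta> (\<lambda>t. \<Sum>i<n. indicator (A i) t) = 0" for n
      using A union by (subst spectral_functional_sum) auto
    ultimately show ?case
      by (simp add: LIMSEQ_const_iff)
  qed
qed

lemma spectral_functional_weight:
  assumes w: "bdd_borel K w"
  shows "spectral_functional K (\<lambda>\<phi>. \<Theta> (\<lambda>t. \<phi> t * w t))"
  unfolding spectral_functional_def
proof (intro conjI allI impI)
  fix \<phi> \<psi> c assume "bdd_borel K \<phi>" "bdd_borel K \<psi>"
  then show "\<Theta> (\<lambda>t. (\<phi> t + c * \<psi> t) * w t) = \<Theta> (\<lambda>t. \<phi> t * w t) + of_real c * \<Theta> (\<lambda>t. \<psi> t * w t)"
    using spectral_functional_lin[of "\<lambda>t. \<phi> t * w t" "\<lambda>t. \<psi> t * w t" c] w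
    by (simp add: bdd_borel_mult algebra_simps)
next
  fix \<phi>s :: "nat \<Rightarrow> real \<Rightarrow> real" and \<phi> C
  assume as: "\<forall>n. bdd_borel K (\<phi>s n)" "bdd_borel K \<phi>" "\<forall>n. \<forall>t\<in>{- K..K}. \<bar>\<phi>s n t\<bar> \<le> C"
    "\<forall>t\<in>{- K..K}. (\<lambda>n. \<phi>s n t) \<longlonglongrightarrow> \<phi> t"
  obtain D where D: "\<forall>t\<in>{-K..K}. \<bar>w t\<bar> \<le> D" using w by (auto simp: bdd_borel_def)
  show "(\<lambda>n. \<Theta> (\<lambda>t. \<phi>s n t * w t)) \<longlonglongrightarrow> \<Theta> (\<lambda>t. \<phi> t * w t)"
  proof (rule spectral_functional_conv[where C = "\<bar>C\<bar> * \<bar>D\<bar>"])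
    fix n t assume t: "t \<in> {-K..K}"
    then have "\<bar>\<phi>s n t\<bar> \<le> C" "\<bar>w t\<bar> \<le> D" using as(3) D by blast+
    then have "\<bar>\<phi>s n t\<bar> \<le> \<bar>C\<bar>" "\<bar>w t\<bar> \<le> \<bar>D\<bar>" by linarith+
    then show "\<bar>\<phi>s n t * w t\<bar> \<le> \<bar>C\<bar> * \<bar>D\<bar>"
      by (simp add: abs_mult mult_mono)
  qed (use as w in \<open>auto simp: bdd_borel_mult intro: tendsto_intros\<close>)
qed

lemma spectral_functional_scale: "spectral_functional K (\<lambda>\<phi>. c * \<Theta> \<phi>)"
  unfolding spectral_functional_def
proof (intro conjI allI impI)
  fix \<phi>s :: "nat \<Rightarrow> real \<Rightarrow> real" and \<phi> C
  assume as: "\<forall>n. bdd_borel K (\<phi>s n)" "bdd_borel K \<phi>" "\<forall>n. \<forall>t\<in>{- K..K}. \<bar>\<phi>s n t\<bar> \<le> C"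
    "\<forall>t\<in>{- K..K}. (\<lambda>n. \<phi>s n t) \<longlonglongrightarrow> \<phi> t"
  show "(\<lambda>n. c * \<Theta> (\<phi>s n)) \<longlonglongrightarrow> c * \<Theta> \<phi>"
    by (intro tendsto_intros spectral_functional_conv[where C = C]) (use as in auto)
qed (simp add: spectral_functional_lin algebra_simps)

lemma spectral_functional_cnj: "spectral_functional K (\<lambda>\<phi>. cnj (\<Theta> \<phi>))"
  unfolding spectral_functional_def
proof (intro conjI allI impI)
  fix \<phi>s :: "nat \<Rightarrow> real \<Rightarrow> real" and \<phi> C
  assume as: "\<forall>n. bdd_borel K (\<phi>s n)" "bdd_borel K \<phi>" "\<forall>n. \<forall>t\<in>{- K..K}. \<bar>\<phi>s n t\<bar> \<le> C"
    "\<forall>t\<in>{- K..K}. (\<lambda>n. \<phi>s n t) \<longlonglongrightarrow> \<phi> t"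
  show "(\<lambda>n. cnj (\<Theta> (\<phi>s n))) \<longlonglongrightarrow> cnj (\<Theta> \<phi>)"
    by (intro tendsto_intros spectral_functional_conv[where C = C]) (use as in auto)
qed (simp add: spectral_functional_lin)

end

lemma spectral_functional_plus:
  assumes \<Theta>: "spectral_functional K \<Theta>" and \<Psi>: "spectral_functional K \<Psi>"
  shows "spectral_functional K (\<lambda>\<phi>. \<Theta> \<phi> + \<Psi> \<phi>)"
  unfolding spectral_functional_def
proof (intro conjI allI impI)
  fix \<phi>s :: "nat \<Rightarrow> real \<Rightarrow> real" and \<phi> C
  assume as: "\<forall>n. bdd_borel K (\<phi>s n)" "bdd_borel K \<phi>" "\<forall>n. \<forall>t\<in>{- K..K}. \<bar>\<phi>s n t\<bar> \<le> C"
    "\<forall>t\<in>{- K..K}. (\<lambda>n. \<phi>s n t) \<longlonglongrightarrow> \<phi> t"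
  show "(\<lambda>n. \<Theta> (\<phi>s n) + \<Psi> (\<phi>s n)) \<longlonglongrightarrow> \<Theta> \<phi> + \<Psi> \<phi>"
    by (intro tendsto_intros spectral_functional_conv[OF \<Theta>, where C = C]
        spectral_functional_conv[OF \<Psi>, where C = C]) (use as in auto)
qed (simp add: spectral_functional_lin[OF \<Theta>] spectral_functional_lin[OF \<Psi>] algebra_simps)

lemma spectral_functional_minus:
  assumes "spectral_functional K \<Theta>" "spectral_functional K \<Psi>"
  shows "spectral_functional K (\<lambda>\<phi>. \<Theta> \<phi> - \<Psi> \<phi>)"
  using spectral_functional_plus[OF assms(1) spectral_functional_scale[OF assms(2), of "-1"]] by simp

lemma spectral_functional_eq_if_moments:
  assumes "spectral_functional K \<Theta>" "spectral_functional K \<Psi>"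
    and "\<And>k. \<Theta> (\<lambda>t. t ^ k) = \<Psi> (\<lambda>t. t ^ k)" "bdd_borel K \<phi>"
  shows "\<Theta> \<phi> = \<Psi> \<phi>"
  using spectral_functional_eq_0_if_moments[OF spectral_functional_minus[OF assms(1,2)] _ assms(4)] assms(3)
  by simp

lemma spectral_functional_eq_if_indicator:
  assumes "spectral_functional K \<Theta>" "spectral_functional K \<Psi>"
    and "\<And>B. B \<in> sets borel \<Longrightarrow> \<Theta> (indicator B) = \<Psi> (indicator B)" "bdd_borel K \<phi>"
  shows "\<Theta> \<phi> = \<Psi> \<phi>"
  using spectral_functional_eq_0_if_indicator[OF spectral_functional_minus[OF assms(1,2)] _ assms(4)] assms(3)
  by simp

section \<open>Finite measures carried by a bounded interval\<close>

locale interval_measure = finite_measure M for M :: "real measure" +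
  fixes K :: real
  assumes sets_M [measurable_cong, simp]: "sets M = sets borel"
    and AE_interval: "AE t in M. t \<in> {-K..K}"
begin

lemma space_M [simp]: "space M = UNIV"
  using sets_eq_imp_space_eq[OF sets_M] by simp

lemma borel_measurable_M [simp]: "borel_measurable M = borel_measurable borel"
  by (rule measurable_cong_sets[OF sets_M refl])

lemma integrable_bdd_borel: "bdd_borel K \<phi> \<Longrightarrow> integrable M \<phi>"
proof -
  assume \<phi>: "bdd_borel K \<phi>"
  then obtain C where "\<forall>t\<in>{-K..K}. \<bar>\<phi> t\<bar> \<le> C" by (auto simp: bdd_borel_def)
  then have "AE t in M. norm (\<phi> t) \<le> C"
    by (intro AE_mp[OF AE_interval AE_I2]) simp
  then show ?thesis
    using \<phi> by (intro integrable_const_bound[where B = C]) (auto simp: bdd_borel_def)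
qed

lemma spectral_functional_integral: "spectral_functional K (\<lambda>\<phi>. of_real (\<integral>t. \<phi> t \<partial>M))"
  unfolding spectral_functional_def
proof (intro conjI allI impI)
  fix \<phi> \<psi> c assume "bdd_borel K \<phi>" "bdd_borel K \<psi>"
  then show "complex_of_real (\<integral>t. \<phi> t + c * \<psi> t \<partial>M) = of_real (\<integral>t. \<phi> t \<partial>M) + of_real c * of_real (\<integral>t. \<psi> t \<partial>M)"
    by (simp add: integrable_bdd_borel)
next
  fix \<phi>s :: "nat \<Rightarrow> real \<Rightarrow> real" and \<phi> C
  assume as: "\<forall>n. bdd_borel K (\<phi>s n)" "bdd_borel K \<phi>" "\<forall>n. \<forall>t\<in>{- K..K}. \<bar>\<phi>s n t\<bar> \<le> C"
    "\<forall>t\<in>{- K..K}. (\<lambda>n. \<phi>s n t) \<longlonglongrightarrow> \<phi> t"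
  have "(\<lambda>n. \<integral>t. \<phi>s n t \<partial>M) \<longlonglongrightarrow> (\<integral>t. \<phi> t \<partial>M)"
  proof (rule integral_dominated_convergence[where w = "\<lambda>_. C"])
    show "AE t in M. (\<lambda>n. \<phi>s n t) \<longlonglongrightarrow> \<phi> t"
      by (intro AE_mp[OF AE_interval AE_I2] impI) (use as(4) in blast)
    show "AE t in M. norm (\<phi>s n t) \<le> C" for n
      by (intro AE_mp[OF AE_interval AE_I2] impI) (use as(3) in simp)
  qed (use as in \<open>auto simp: bdd_borel_def\<close>)
  then show "(\<lambda>n. complex_of_real (\<integral>t. \<phi>s n t \<partial>M)) \<longlonglongrightarrow> of_real (\<integral>t. \<phi> t \<partial>M)"
    by (intro tendsto_intros)
qed

end

section \<open>Square-summable functions\<close>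

lemma l2_iff:
  "f \<in> l2 V \<longleftrightarrow> (\<forall>v. v \<notin> V \<longrightarrow> f v = 0) \<and> (\<lambda>v. (cmod (f v))\<^sup>2) summable_on UNIV"
proof -
  have "(\<lambda>v. (cmod (f v))\<^sup>2) summable_on V \<longleftrightarrow> (\<lambda>v. (cmod (f v))\<^sup>2) summable_on UNIV"
    if "\<forall>v. v \<notin> V \<longrightarrow> f v = 0"
    by (rule summable_on_cong_neutral) (use that in auto)
  then show ?thesis
    by (auto simp: l2_def)
qed

lemma l2_outside: "f \<in> l2 V \<Longrightarrow> v \<notin> V \<Longrightarrow> f v = 0"
  by (simp add: l2_def)

lemma l2_summable: "f \<in> l2 V \<Longrightarrow> (\<lambda>v. (cmod (f v))\<^sup>2) summable_on UNIV"
  by (simp add: l2_iff)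

lemma l2_finite: "finite W \<Longrightarrow> f \<in> l2 W \<longleftrightarrow> (\<forall>v. v \<notin> W \<longrightarrow> f v = 0)"
  by (simp add: l2_def)

lemma l2_mono: "f \<in> l2 W \<Longrightarrow> W \<subseteq> V \<Longrightarrow> f \<in> l2 V"
  by (auto simp: l2_iff)

lemma l2_lincomb:
  assumes "f \<in> l2 V" "g \<in> l2 V"
  shows "(\<lambda>v. a * f v + b * g v) \<in> l2 V"
proof -
  have "(\<lambda>v. (cmod (a * f v + b * g v))\<^sup>2) summable_on UNIV"
  proof (rule summable_on_comparison_test)
    show "(\<lambda>v. (2 * (cmod a)\<^sup>2) * (cmod (f v))\<^sup>2 + (2 * (cmod b)\<^sup>2) * (cmod (g v))\<^sup>2) summable_on UNIV"
      using assms by (intro summable_on_add summable_on_cmult_right) (auto simp: l2_summable)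
    fix v
    have "(cmod (a * f v + b * g v))\<^sup>2 \<le> (cmod (a * f v) + cmod (b * g v))\<^sup>2"
      by (intro power_mono norm_triangle_ineq) auto
    also have "\<dots> \<le> 2 * (cmod (a * f v))\<^sup>2 + 2 * (cmod (b * g v))\<^sup>2"
      using zero_le_power2[of "cmod (a * f v) - cmod (b * g v)"] by (simp add: power2_eq_square algebra_simps)
    finally show "(cmod (a * f v + b * g v))\<^sup>2
        \<le> (2 * (cmod a)\<^sup>2) * (cmod (f v))\<^sup>2 + (2 * (cmod b)\<^sup>2) * (cmod (g v))\<^sup>2"
      by (simp add: norm_mult power_mult_distrib)
  qed auto
  then show ?thesis
    using assms by (auto simp: l2_iff)
qed

lemma l2_zero [simp]: "(\<lambda>_. 0) \<in> l2 V"
  by (simp add: l2_def)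

lemma l2_scale: "f \<in> l2 V \<Longrightarrow> (\<lambda>v. a * f v) \<in> l2 V"
  using l2_lincomb[of f V f a 0] by simp

lemma l2_add: "f \<in> l2 V \<Longrightarrow> g \<in> l2 V \<Longrightarrow> (\<lambda>v. f v + g v) \<in> l2 V"
  using l2_lincomb[of f V g 1 1] by simp

lemma l2_diff: "f \<in> l2 V \<Longrightarrow> g \<in> l2 V \<Longrightarrow> (\<lambda>v. f v - g v) \<in> l2 V"
  using l2_lincomb[of f V g 1 "-1"] by simp

lemma l2_sum: "finite I \<Longrightarrow> (\<And>i. i \<in> I \<Longrightarrow> f i \<in> l2 V) \<Longrightarrow> (\<lambda>v. \<Sum>i\<in>I. c i * f i v) \<in> l2 V"
  by (induction I rule: finite_induct) (auto intro!: l2_add l2_scale)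

lemma l2_delta [simp]: "v \<in> V \<Longrightarrow> delta v \<in> l2 V"
proof -
  assume "v \<in> V"
  moreover have "(\<lambda>w. (cmod (delta v w))\<^sup>2) summable_on UNIV"
    by (rule summable_on_cong_neutral[THEN iffD1, of "UNIV" "{v}" _ "\<lambda>w. (cmod (delta v w))\<^sup>2"])
      (auto simp: delta_def)
  ultimately show ?thesis
    by (auto simp: l2_iff delta_def)
qed

lemma l2_prod_abs_summable:
  assumes "f \<in> l2 V" "g \<in> l2 W"
  shows "(\<lambda>v. norm (f v * cnj (g v))) summable_on UNIV"
proof (rule Infinite_Sum.abs_summable_on_comparison_test')
  show "(\<lambda>v. (cmod (f v))\<^sup>2 + (cmod (g v))\<^sup>2) summable_on UNIV"
    using assms by (intro summable_on_add) (auto simp: l2_summable)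
  show "norm (f v * cnj (g v)) \<le> (cmod (f v))\<^sup>2 + (cmod (g v))\<^sup>2" for v
    using sum_squares_bound[of "cmod (f v)" "cmod (g v)"] mult_nonneg_nonneg[OF norm_ge_zero[of "f v"] norm_ge_zero[of "g v"]]
    unfolding norm_mult complex_mod_cnj mult.assoc by linarith
qed

lemma l2_prod_summable:
  "f \<in> l2 V \<Longrightarrow> g \<in> l2 W \<Longrightarrow> (\<lambda>v. f v * cnj (g v)) summable_on UNIV"
  by (rule abs_summable_summable[OF l2_prod_abs_summable])

lemma l2_inner_commute: "l2_inner g f = cnj (l2_inner f g)"
  unfolding l2_inner_def infsum_cnj[symmetric] by (simp add: mult.commute)

lemma l2_inner_lin_left:
  assumes "f \<in> l2 V" "g \<in> l2 V" "h \<in> l2 V"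
  shows "l2_inner (\<lambda>v. a * f v + b * g v) h = a * l2_inner f h + b * l2_inner g h"
proof -
  have "l2_inner (\<lambda>v. a * f v + b * g v) h = (\<Sum>\<^sub>\<infinity>v. a * (f v * cnj (h v)) + b * (g v * cnj (h v)))"
    unfolding l2_inner_def by (simp add: algebra_simps)
  also have "\<dots> = (\<Sum>\<^sub>\<infinity>v. a * (f v * cnj (h v))) + (\<Sum>\<^sub>\<infinity>v. b * (g v * cnj (h v)))"
    using assms by (intro infsum_add summable_on_cmult_right l2_prod_summable)
  finally show ?thesis
    by (simp add: l2_inner_def infsum_cmult_right')
qed

lemma l2_inner_lin_right:
  assumes "f \<in> l2 V" "g \<in> l2 V" "h \<in> l2 V"
  shows "l2_inner h (\<lambda>v. a * f v + b * g v) = cnj a * l2_inner h f + cnj b * l2_inner h g"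
  using l2_inner_lin_left[OF assms, of a b] l2_inner_commute[of h] by (metis complex_cnj_add complex_cnj_mult)

lemma l2_inner_zero [simp]: "l2_inner (\<lambda>_. 0) f = 0" "l2_inner f (\<lambda>_. 0) = 0"
  by (simp_all add: l2_inner_def)

lemma l2_inner_scale_left: "l2_inner (\<lambda>v. a * f v) h = a * l2_inner f h"
  by (simp add: l2_inner_def mult.assoc infsum_cmult_right')

lemma l2_inner_scale_right: "l2_inner f (\<lambda>v. a * h v) = cnj a * l2_inner f h"
  by (metis complex_cnj_mult l2_inner_commute l2_inner_scale_left)

lemma l2_inner_add_left:
  "f \<in> l2 V \<Longrightarrow> g \<in> l2 V \<Longrightarrow> h \<in> l2 V \<Longrightarrow> l2_inner (\<lambda>v. f v + g v) h = l2_inner f h + l2_inner g h"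
  using l2_inner_lin_left[of f V g h 1 1] by simp

lemma l2_inner_diff_left:
  "f \<in> l2 V \<Longrightarrow> g \<in> l2 V \<Longrightarrow> h \<in> l2 V \<Longrightarrow> l2_inner (\<lambda>v. f v - g v) h = l2_inner f h - l2_inner g h"
  using l2_inner_lin_left[of f V g h 1 "-1"] by simp

lemma l2_inner_diff_right:
  "f \<in> l2 V \<Longrightarrow> g \<in> l2 V \<Longrightarrow> h \<in> l2 V \<Longrightarrow> l2_inner h (\<lambda>v. f v - g v) = l2_inner h f - l2_inner h g"
  using l2_inner_lin_right[of f V g h 1 "-1"] by simp

lemma l2_inner_sum_left:
  "finite I \<Longrightarrow> (\<And>i. i \<in> I \<Longrightarrow> f i \<in> l2 V) \<Longrightarrow> h \<in> l2 V \<Longrightarrow>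
    l2_inner (\<lambda>v. \<Sum>i\<in>I. c i * f i v) h = (\<Sum>i\<in>I. c i * l2_inner (f i) h)"
proof (induction I rule: finite_induct)
  case (insert i I)
  then have "l2_inner (\<lambda>v. c i * f i v + (\<Sum>i\<in>I. c i * f i v)) h
      = l2_inner (\<lambda>v. c i * f i v) h + l2_inner (\<lambda>v. \<Sum>i\<in>I. c i * f i v) h"
    by (intro l2_inner_add_left[where V = V] l2_scale l2_sum) auto
  then show ?case using insert by (simp add: l2_inner_scale_left)
qed simp

lemma l2_inner_self:
  assumes "f \<in> l2 V"
  shows "l2_inner f f = of_real ((l2_norm f)\<^sup>2)"
proof -
  have "((\<lambda>v. (cmod (f v))\<^sup>2) has_sum (\<Sum>\<^sub>\<infinity>v. (cmod (f v))\<^sup>2)) UNIV"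
    using l2_summable[OF assms] by (rule has_sum_infsum)
  then have "((\<lambda>v. of_real ((cmod (f v))\<^sup>2)) has_sum complex_of_real (\<Sum>\<^sub>\<infinity>v. (cmod (f v))\<^sup>2)) UNIV"
    by (rule has_sum_of_real)
  then have "l2_inner f f = complex_of_real (\<Sum>\<^sub>\<infinity>v. (cmod (f v))\<^sup>2)"
    unfolding l2_inner_def complex_norm_square[symmetric] by (rule infsumI)
  moreover have "(\<Sum>\<^sub>\<infinity>v. (cmod (f v))\<^sup>2) = (l2_norm f)\<^sup>2"
    unfolding l2_norm_def by (simp add: infsum_nonneg)
  ultimately show ?thesis by simp
qed

lemma l2_norm_nonneg [simp]: "0 \<le> l2_norm f"
  by (simp add: l2_norm_def infsum_nonneg)

lemma l2_norm_eq_0: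
  assumes "f \<in> l2 V" "l2_norm f = 0"
  shows "f = (\<lambda>_. 0)"
proof
  fix v
  have "(\<Sum>\<^sub>\<infinity>v. (cmod (f v))\<^sup>2) \<le> 0"
    using assms(2) by (simp add: l2_norm_def infsum_nonneg)
  then have "(cmod (f v))\<^sup>2 = 0"
    using l2_summable[OF assms(1)] by (rule nonneg_infsum_le_0D) auto
  then show "f v = 0" by simp
qed

lemma l2_inner_delta [simp]: "l2_inner f (delta v) = f v"
proof -
  have "((\<lambda>w. f w * cnj (delta v w)) has_sum f v) UNIV"
    by (rule has_sum_finite_neutralI[of "{v}"]) (auto simp: delta_def)
  then show ?thesis
    unfolding l2_inner_def by (rule infsumI)
qed

lemma l2_eqI:
  assumes "f \<in> l2 V" "g \<in> l2 V" "\<And>h. h \<in> l2 V \<Longrightarrow> l2_inner f h = l2_inner g h"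
  shows "f = g"
proof
  fix v
  show "f v = g v"
    using assms(3)[of "delta v"] l2_outside[OF assms(1)] l2_outside[OF assms(2)]
    by (cases "v \<in> V") auto
qed

lemma l2_inner_finite:
  assumes "finite W" "\<And>v. v \<notin> W \<Longrightarrow> f v = 0 \<or> g v = 0"
  shows "l2_inner f g = (\<Sum>v\<in>W. f v * cnj (g v))"
proof -
  have "((\<lambda>w. f w * cnj (g w)) has_sum (\<Sum>v\<in>W. f v * cnj (g v))) UNIV"
    by (rule has_sum_finite_neutralI[of W]) (use assms in auto)
  then show ?thesis
    unfolding l2_inner_def by (rule infsumI)
qed

text \<open>Stated for any positive semidefinite form, since it serves the inner product and also
  the forms \<open>ip f g (indicator B)\<close>, whose boundedness is what produces the spectral
  projections.\<close>

lemma hermitian_form_cauchy_schwarz: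
  fixes q :: "('v \<Rightarrow> complex) \<Rightarrow> ('v \<Rightarrow> complex) \<Rightarrow> complex"
  assumes lin: "\<And>a b f g h. f \<in> l2 V \<Longrightarrow> g \<in> l2 V \<Longrightarrow> h \<in> l2 V \<Longrightarrow>
      q (\<lambda>v. a * f v + b * g v) h = a * q f h + b * q g h"
    and herm: "\<And>f g. f \<in> l2 V \<Longrightarrow> g \<in> l2 V \<Longrightarrow> q g f = cnj (q f g)"
    and pos: "\<And>f. f \<in> l2 V \<Longrightarrow> 0 \<le> Re (q f f)"
    and f: "f \<in> l2 V" and g: "g \<in> l2 V"
  shows "(cmod (q f g))\<^sup>2 \<le> Re (q f f) * Re (q g g)"
proof -
  define x where "x = q f g"
  have real: "q h h = of_real (Re (q h h))" if "h \<in> l2 V" for h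
    using herm[OF that that] by (simp add: complex_eq_iff)
  have key: "0 \<le> Re (q f f) - 2 * t * (cmod x)\<^sup>2 + t\<^sup>2 * (cmod x)\<^sup>2 * Re (q g g)" for t
  proof -
    \<comment> \<open>The test vector f - t q(f,g) g makes the form a real polynomial in t, of
      degree at most 2, without choosing a phase for q(f,g).\<close>
    define c where "c = - of_real t * x"
    define h where "h = (\<lambda>v. 1 * f v + c * g v)"
    have h: "h \<in> l2 V" unfolding h_def by (intro l2_lincomb f g)
    have 1: "q h k = q f k + c * q g k" if "k \<in> l2 V" for k
      unfolding h_def using lin[OF f g that, of 1 c] by simp
    have "q h h = q f h + c * q g h" by (rule 1[OF h])
    also have "q f h = cnj (q h f)" using herm[OF h f] by simp
    also have "q g h = cnj (q h g)" using herm[OF h g] by simp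
    also have "q h f = q f f + c * cnj x" using 1[OF f] herm[OF f g] by (simp add: x_def)
    also have "q h g = x + c * q g g" using 1[OF g] by (simp add: x_def)
    finally have "q h h = cnj (q f f) + cnj c * x + c * cnj x + c * cnj c * cnj (q g g)"
      by (simp add: algebra_simps)
    also have "\<dots> = of_real (Re (q f f)) - 2 * of_real t * (x * cnj x) + of_real (t\<^sup>2) * (x * cnj x) * of_real (Re (q g g))"
      using real[OF f] real[OF g] by (simp add: c_def algebra_simps power2_eq_square) (metis complex_cnj_complex_of_real)
    also have "\<dots> = of_real (Re (q f f) - 2 * t * (cmod x)\<^sup>2 + t\<^sup>2 * (cmod x)\<^sup>2 * Re (q g g))"
      by (simp flip: complex_norm_square)
    finally show ?thesis
      using pos[OF h] by simp
  qed
  have p: "0 \<le> Re (q f f)" "0 \<le> Re (q g g)" using pos f g by auto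
  show ?thesis
  proof (cases "Re (q g g) = 0")
    case True
    have "(cmod x)\<^sup>2 = 0"
    proof (rule ccontr)
      assume "(cmod x)\<^sup>2 \<noteq> 0"
      then have x0: "(cmod x)\<^sup>2 > 0" by simp
      \<comment> \<open>Here \<open>key\<close> is affine in t with slope -2|x|^2, and this t makes
        its right-hand side equal to -1.\<close>
      show False
        using key[of "(Re (q f f) + 1) / (2 * (cmod x)\<^sup>2)"] True x0 by (simp add: field_simps)
    qed
    then show ?thesis using True by (simp add: x_def)
  next
    case False
    then have "0 < Re (q g g)" using p by simp
    \<comment> \<open>The quadratic polynomial in \<open>key\<close> is minimal at t = 1 /
      q(g,g).\<close>
    then show ?thesis
      using key[of "1 / Re (q g g)"] by (simp add: field_simps power2_eq_square x_def)
  qed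
qed

lemma l2_cauchy_schwarz:
  assumes "f \<in> l2 V" "g \<in> l2 V"
  shows "cmod (l2_inner f g) \<le> l2_norm f * l2_norm g"
proof -
  have "(cmod (l2_inner f g))\<^sup>2 \<le> Re (l2_inner f f) * Re (l2_inner g g)"
  proof (rule hermitian_form_cauchy_schwarz[OF _ _ _ assms])
    show "l2_inner g f = cnj (l2_inner f g)" for f g :: "'a \<Rightarrow> complex" by (rule l2_inner_commute)
  qed (auto simp: l2_inner_lin_left l2_inner_self)
  then have "(cmod (l2_inner f g))\<^sup>2 \<le> (l2_norm f * l2_norm g)\<^sup>2"
    using assms by (simp add: l2_inner_self power_mult_distrib)
  then show ?thesis
    by (rule power2_le_imp_le) simp
qed

lemma restrict_support_eq_sum:
  "finite F \<Longrightarrow> restrict_support F g = (\<lambda>v. \<Sum>w\<in>F. g w * delta w v)"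
  by (auto simp: restrict_support_def delta_def fun_eq_iff sum.delta if_distrib cong: if_cong)

lemma restrict_support_l2: "g \<in> l2 V \<Longrightarrow> restrict_support F g \<in> l2 V"
  unfolding l2_iff restrict_support_def
  by (auto elim!: summable_on_comparison_test)

lemma l2_norm_tail:
  assumes g: "g \<in> l2 V" and e: "0 < e"
  shows "\<exists>F. finite F \<and> F \<subseteq> V \<and> (l2_norm (\<lambda>v. g v - restrict_support F g v))\<^sup>2 \<le> e"
proof -
  have s: "(\<lambda>v. (cmod (g v))\<^sup>2) summable_on V" using g by (simp add: l2_def)
  obtain F where F: "finite F" "F \<subseteq> V"
    and d: "dist (\<Sum>v\<in>F. (cmod (g v))\<^sup>2) (\<Sum>\<^sub>\<infinity>v\<in>V. (cmod (g v))\<^sup>2) \<le> e"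
    using infsum_finite_approximation[OF s e] by auto
  have "(\<Sum>\<^sub>\<infinity>v\<in>V. (cmod (g v))\<^sup>2) = (\<Sum>\<^sub>\<infinity>v\<in>F. (cmod (g v))\<^sup>2) + (\<Sum>\<^sub>\<infinity>v\<in>V - F. (cmod (g v))\<^sup>2)"
    using F s summable_on_subset_banach[OF s] by (subst infsum_Un_disjoint[symmetric]) (auto simp: Un_absorb1)
  then have "(\<Sum>\<^sub>\<infinity>v\<in>V - F. (cmod (g v))\<^sup>2) \<le> e"
    using d F by (simp add: dist_real_def)
  moreover have "(l2_norm (\<lambda>v. g v - restrict_support F g v))\<^sup>2 = (\<Sum>\<^sub>\<infinity>v. (cmod (g v - restrict_support F g v))\<^sup>2)"
    by (simp add: l2_norm_def infsum_nonneg)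
  moreover have "\<dots> = (\<Sum>\<^sub>\<infinity>v\<in>V - F. (cmod (g v))\<^sup>2)"
    by (rule infsum_cong_neutral) (use l2_outside[OF g] in \<open>auto simp: restrict_support_def\<close>)
  ultimately show ?thesis using F by auto
qed

text \<open>The representing vector is written down by its coordinates \<open>L (delta v)\<close>,
  which avoids orthogonal complements of closed subspaces. Boundedness of \<open>L\<close> on
  finitely supported functions gives square-summability; equality with \<open>L\<close> holds on
  these functions and extends to \<open>l2 V\<close> by density. \<open>L\<close> is antilinear
  because \<open>l2_inner\<close> is antilinear in its second argument.\<close>

lemma l2_riesz:
  fixes L :: "('v \<Rightarrow> complex) \<Rightarrow> complex"
  assumes lin: "\<And>a b f g. f \<in> l2 V \<Longrightarrow> g \<in> l2 V \<Longrightarrow>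
      L (\<lambda>v. a * f v + b * g v) = cnj a * L f + cnj b * L g"
    and bound: "\<And>g. g \<in> l2 V \<Longrightarrow> cmod (L g) \<le> C * l2_norm g"
  defines "T \<equiv> (\<lambda>v. if v \<in> V then L (delta v) else 0)"
  shows "T \<in> l2 V" and "g \<in> l2 V \<Longrightarrow> l2_inner T g = L g"
proof -
  have L0: "L (\<lambda>_. 0) = 0"
    using lin[of "\<lambda>_. 0" "\<lambda>_. 0" 0 0] by simp
  have Lsum: "L (\<lambda>v. \<Sum>w\<in>F. c w * delta w v) = (\<Sum>w\<in>F. cnj (c w) * T w)" if "finite F" "F \<subseteq> V" for c F
    using that
  proof (induction F rule: finite_induct)
    case (insert w F)
    have "(\<lambda>v. \<Sum>w\<in>F. c w * delta w v) \<in> l2 V"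
      using insert by (intro l2_sum) auto
    then have "L (\<lambda>v. c w * delta w v + 1 * (\<Sum>w\<in>F. c w * delta w v))
        = cnj (c w) * L (delta w) + cnj 1 * L (\<lambda>v. \<Sum>w\<in>F. c w * delta w v)"
      using insert by (intro lin) auto
    then show ?case using insert by (simp add: T_def)
  qed (simp add: L0)
  have partial: "(\<Sum>w\<in>F. (cmod (T w))\<^sup>2) \<le> C\<^sup>2" if F: "finite F" "F \<subseteq> V" for F
  proof -
    define s where "s = (\<Sum>w\<in>F. (cmod (T w))\<^sup>2)"
    define h where "h = (\<lambda>v. \<Sum>w\<in>F. T w * delta w v)"
    have h: "h \<in> l2 V" unfolding h_def using F by (intro l2_sum) auto
    have hT: "h = restrict_support F T"
      unfolding h_def by (rule restrict_support_eq_sum[OF F(1), symmetric])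
    have "l2_inner h h = (\<Sum>w\<in>F. h w * cnj (h w))"
      by (rule l2_inner_finite[OF F(1)]) (simp add: hT restrict_support_def)
    also have "\<dots> = of_real s"
      unfolding s_def of_real_sum hT by (intro sum.cong refl) (simp add: restrict_support_def flip: complex_norm_square)
    finally have ns: "(l2_norm h)\<^sup>2 = s"
      unfolding l2_inner_self[OF h] by (metis of_real_eq_iff)
    \<comment> \<open>\<open>h\<close> truncates \<open>T\<close> to \<open>F\<close>, so that both
      \<open>L h\<close> and its squared norm equal s; boundedness then reads s \<le> C
      sqrt(s).\<close>
    have "L h = of_real s"
      unfolding h_def Lsum[OF F] s_def of_real_sum
      by (intro sum.cong refl) (simp add: mult.commute flip: complex_norm_square)
    then have "s \<le> C * l2_norm h"
      using bound[OF h] by (simp add: abs_le_iff)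
    moreover have "0 \<le> s" by (simp add: s_def sum_nonneg)
    ultimately have "s\<^sup>2 \<le> (C * l2_norm h)\<^sup>2"
      by (intro power_mono) auto
    then have "s\<^sup>2 \<le> C\<^sup>2 * s" by (simp only: power_mult_distrib ns)
    then have "s * s \<le> C\<^sup>2 * s" by (simp only: power2_eq_square)
    then have "s \<le> C\<^sup>2"
      using \<open>0 \<le> s\<close> by (cases "s = 0") (auto simp: mult_le_cancel_right)
    then show ?thesis by (simp add: s_def)
  qed
  have "(\<lambda>v. (cmod (T v))\<^sup>2) summable_on V"
    by (rule nonneg_bdd_above_summable_on) (auto intro!: bdd_aboveI[of _ "C\<^sup>2"] partial)
  then show T: "T \<in> l2 V"
    by (simp add: l2_def T_def)
  assume g: "g \<in> l2 V"
  \<comment> \<open>The finite part of \<open>g\<close> contributes nothing to the difference, and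
    the tail is controlled by Cauchy-Schwarz for \<open>T\<close> and by the bound on
    \<open>L\<close>.\<close>
  have approx: "cmod (l2_inner T g - L g) \<le> (l2_norm T + \<bar>C\<bar>) * d" if "0 < d" for d
  proof -
    obtain F where F: "finite F" "F \<subseteq> V" and n: "(l2_norm (\<lambda>v. g v - restrict_support F g v))\<^sup>2 \<le> d\<^sup>2"
      using l2_norm_tail[OF g, of "d\<^sup>2"] \<open>0 < d\<close> by auto
    define k where "k = restrict_support F g"
    define r where "r = (\<lambda>v. g v - k v)"
    have k: "k \<in> l2 V" unfolding k_def by (rule restrict_support_l2[OF g])
    have r: "r \<in> l2 V" unfolding r_def by (rule l2_diff[OF g k])
    have nr: "l2_norm r \<le> d"
      unfolding r_def k_def by (rule power2_le_imp_le[OF n]) (use \<open>0 < d\<close> in simp)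
    have "l2_inner T k = (\<Sum>v\<in>F. T v * cnj (k v))"
      by (rule l2_inner_finite[OF F(1)]) (simp add: k_def restrict_support_def)
    also have "\<dots> = (\<Sum>v\<in>F. cnj (g v) * T v)"
      by (intro sum.cong) (auto simp: k_def restrict_support_def)
    also have "\<dots> = L k"
      unfolding k_def restrict_support_eq_sum[OF F(1), of g] by (rule Lsum[OF F, symmetric])
    finally have 1: "l2_inner T k = L k" .
    have "L r = L g - L k"
      using lin[OF g k, of 1 "-1"] by (simp add: r_def)
    moreover have "l2_inner T r = l2_inner T g - l2_inner T k"
      unfolding r_def by (rule l2_inner_diff_right[OF g k T])
    ultimately have "l2_inner T g - L g = l2_inner T r - L r" using 1 by simp
    also have "cmod \<dots> \<le> cmod (l2_inner T r) + cmod (L r)" by (rule norm_triangle_ineq4)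
    also have "\<dots> \<le> l2_norm T * l2_norm r + C * l2_norm r"
      by (intro add_mono l2_cauchy_schwarz[OF T r] bound[OF r])
    also have "\<dots> \<le> (l2_norm T + \<bar>C\<bar>) * l2_norm r"
      using mult_right_mono[OF abs_ge_self[of C] l2_norm_nonneg[of r]] by (simp add: algebra_simps)
    also have "\<dots> \<le> (l2_norm T + \<bar>C\<bar>) * d"
      by (intro mult_left_mono nr) auto
    finally show ?thesis .
  qed
  have "cmod (l2_inner T g - L g) \<le> 0 + e" if "0 < e" for e
  proof -
    have p: "l2_norm T + \<bar>C\<bar> + 1 > 0"
      using l2_norm_nonneg[of T] by linarith
    have "cmod (l2_inner T g - L g) \<le> (l2_norm T + \<bar>C\<bar>) * (e / (l2_norm T + \<bar>C\<bar> + 1))"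
      using p \<open>0 < e\<close> by (intro approx) auto
    also have "\<dots> \<le> e"
      using p \<open>0 < e\<close> by (simp add: field_simps)
    finally show ?thesis by simp
  qed
  then have "cmod (l2_inner T g - L g) \<le> 0"
    by (rule field_le_epsilon)
  then show "l2_inner T g = L g" by simp
qed

section \<open>Symmetric linear operators on square-summable functions and their powers\<close>

locale l2_selfadjoint =
  fixes V :: "'v set" and A :: "('v \<Rightarrow> complex) \<Rightarrow> 'v \<Rightarrow> complex"
  assumes A_l2: "f \<in> l2 V \<Longrightarrow> A f \<in> l2 V"
    and A_lin: "f \<in> l2 V \<Longrightarrow> g \<in> l2 V \<Longrightarrow> A (\<lambda>v. a * f v + b * g v) = (\<lambda>v. a * A f v + b * A g v)"
    and A_sym: "f \<in> l2 V \<Longrightarrow> g \<in> l2 V \<Longrightarrow> l2_inner (A f) g = l2_inner f (A g)"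
begin

lemma pow_l2: "f \<in> l2 V \<Longrightarrow> (A ^^ k) f \<in> l2 V"
  by (induction k) (auto intro: A_l2)

lemma pow_lin: "f \<in> l2 V \<Longrightarrow> g \<in> l2 V \<Longrightarrow>
    (A ^^ k) (\<lambda>v. a * f v + b * g v) = (\<lambda>v. a * (A ^^ k) f v + b * (A ^^ k) g v)"
  by (induction k) (auto simp: A_lin pow_l2)

lemma pow_sym: "f \<in> l2 V \<Longrightarrow> g \<in> l2 V \<Longrightarrow> l2_inner ((A ^^ k) f) g = l2_inner f ((A ^^ k) g)"
  by (induction k arbitrary: f g) (auto simp: A_sym pow_l2 funpow_swap1 A_l2)

lemma A_diff: "f \<in> l2 V \<Longrightarrow> g \<in> l2 V \<Longrightarrow> A (\<lambda>v. f v - g v) = (\<lambda>v. A f v - A g v)"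
  using A_lin[of f g 1 "-1"] by simp

lemma A_zero: "A (\<lambda>_. 0) = (\<lambda>_. 0)"
  using A_lin[of "\<lambda>_. 0" "\<lambda>_. 0" 0 0] by simp

lemma A_sum: "finite I \<Longrightarrow> (\<And>i. i \<in> I \<Longrightarrow> f i \<in> l2 V) \<Longrightarrow>
    A (\<lambda>v. \<Sum>i\<in>I. c i * f i v) = (\<lambda>v. \<Sum>i\<in>I. c i * A (f i) v)"
proof (induction I rule: finite_induct)
  case (insert i I)
  have "A (\<lambda>v. c i * f i v + 1 * (\<Sum>i\<in>I. c i * f i v)) = (\<lambda>v. c i * A (f i) v + 1 * A (\<lambda>v. \<Sum>i\<in>I. c i * f i v) v)"
    using insert by (intro A_lin l2_sum) auto
  then show ?case using insert by simp
qed (simp add: A_zero)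

lemma quadratic_real: "f \<in> l2 V \<Longrightarrow> l2_inner (A f) f = of_real (Re (l2_inner (A f) f))"
  using A_sym[of f f] l2_inner_commute[of f "A f"] by (simp add: complex_eq_iff)

lemma selfadjoint_pow: "l2_selfadjoint V (A ^^ k)"
  by unfold_locales (auto simp: pow_l2 pow_lin pow_sym)

end

section \<open>Spectral measures of bounded self-adjoint operators\<close>

text \<open>The polarisation identity for forms that are linear in the first argument and antilinear
  in the second, as a formula that makes sense for an arbitrary function \<open>q\<close>.\<close>

definition polar :: "(('v \<Rightarrow> complex) \<Rightarrow> complex) \<Rightarrow> ('v \<Rightarrow> complex) \<Rightarrow> ('v \<Rightarrow> complex) \<Rightarrow> complex" where
  "polar q f g = (q (\<lambda>v. f v + g v) - q (\<lambda>v. f v - g v)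
     + \<i> * q (\<lambda>v. f v + \<i> * g v) - \<i> * q (\<lambda>v. f v - \<i> * g v)) / 4"

lemma polar_form:
  assumes T: "\<And>f. f \<in> l2 V \<Longrightarrow> T f \<in> l2 V"
    and lin: "\<And>f g a b. f \<in> l2 V \<Longrightarrow> g \<in> l2 V \<Longrightarrow> T (\<lambda>v. a * f v + b * g v) = (\<lambda>v. a * T f v + b * T g v)"
    and f: "f \<in> l2 V" and g: "g \<in> l2 V"
  shows "polar (\<lambda>h. l2_inner (T h) h) f g = l2_inner (T f) g"
proof -
  have exp: "l2_inner (T (\<lambda>v. 1 * f v + c * g v)) (\<lambda>v. 1 * f v + c * g v)
      = l2_inner (T f) f + cnj c * l2_inner (T f) g + c * l2_inner (T g) f + c * cnj c * l2_inner (T g) g" for c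
    using l2_inner_lin_left[OF T[OF f] T[OF g] l2_lincomb[OF f g, of 1 c], of 1 c]
      l2_inner_lin_right[OF f g T[OF f], of 1 c] l2_inner_lin_right[OF f g T[OF g], of 1 c]
    unfolding lin[OF f g] by (simp add: algebra_simps)
  have e1: "l2_inner (T (\<lambda>v. f v + g v)) (\<lambda>v. f v + g v)
      = l2_inner (T f) f + l2_inner (T f) g + l2_inner (T g) f + l2_inner (T g) g"
    using exp[of 1] by simp
  have e2: "l2_inner (T (\<lambda>v. f v - g v)) (\<lambda>v. f v - g v)
      = l2_inner (T f) f - l2_inner (T f) g - l2_inner (T g) f + l2_inner (T g) g"
    using exp[of "-1"] by simp
  have e3: "l2_inner (T (\<lambda>v. f v + \<i> * g v)) (\<lambda>v. f v + \<i> * g v)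
      = l2_inner (T f) f - \<i> * l2_inner (T f) g + \<i> * l2_inner (T g) f + l2_inner (T g) g"
    using exp[of "\<i>"] by simp
  have e4: "l2_inner (T (\<lambda>v. f v - \<i> * g v)) (\<lambda>v. f v - \<i> * g v)
      = l2_inner (T f) f + \<i> * l2_inner (T f) g - \<i> * l2_inner (T g) f + l2_inner (T g) g"
    using exp[of "-\<i>"] by simp
  have i: "\<i> * (\<i> * z) = - z" for z :: complex by (simp add: mult.assoc[symmetric])
  show ?thesis
    unfolding polar_def e1 e2 e3 e4 by (simp add: algebra_simps i)
qed

lemma polar_cong:
  assumes "\<And>h. h \<in> l2 V \<Longrightarrow> q h = r h" "f \<in> l2 V" "g \<in> l2 V"
  shows "polar q f g = polar r f g"
  using assms by (simp add: polar_def l2_add l2_diff l2_scale)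

section \<open>From a family of scalar measures to a projection-valued measure\<close>

locale measure_family =
  fixes V :: "'v set" and K :: real and N :: "('v \<Rightarrow> complex) \<Rightarrow> real measure"
  assumes interval: "f \<in> l2 V \<Longrightarrow> interval_measure (N f) K"
begin

text \<open>Once \<open>N\<close> carries the moments of an operator \<open>A\<close>, this is the
  matrix element \<langle>\<phi>(A) f, g\<rangle>; in itself it is the integral of
  \<open>\<phi>\<close> against a complex combination of four positive measures.\<close>

definition ip :: "('v \<Rightarrow> complex) \<Rightarrow> ('v \<Rightarrow> complex) \<Rightarrow> (real \<Rightarrow> real) \<Rightarrow> complex" where
  "ip f g \<phi> = polar (\<lambda>h. of_real (\<integral>t. \<phi> t \<partial>N h)) f g"

lemma ip_functional:
  assumes f: "f \<in> l2 V" and g: "g \<in> l2 V"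
  shows "spectral_functional K (ip f g)"
proof -
  have sf: "spectral_functional K (\<lambda>\<phi>. of_real (\<integral>t. \<phi> t \<partial>N (\<lambda>v. f v + g v)))"
    "spectral_functional K (\<lambda>\<phi>. of_real (\<integral>t. \<phi> t \<partial>N (\<lambda>v. f v - g v)))"
    "spectral_functional K (\<lambda>\<phi>. of_real (\<integral>t. \<phi> t \<partial>N (\<lambda>v. f v + \<i> * g v)))"
    "spectral_functional K (\<lambda>\<phi>. of_real (\<integral>t. \<phi> t \<partial>N (\<lambda>v. f v - \<i> * g v)))"
    by (intro interval_measure.spectral_functional_integral interval l2_add l2_diff l2_scale f g)+
  have "spectral_functional K (\<lambda>\<phi>. (1/4) * (of_real (\<integral>t. \<phi> t \<partial>N (\<lambda>v. f v + g v))
      - of_real (\<integral>t. \<phi> t \<partial>N (\<lambda>v. f v - g v))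
      + \<i> * of_real (\<integral>t. \<phi> t \<partial>N (\<lambda>v. f v + \<i> * g v))
      - \<i> * of_real (\<integral>t. \<phi> t \<partial>N (\<lambda>v. f v - \<i> * g v))))"
    by (intro spectral_functional_scale[of K _ "1/4"] spectral_functional_minus spectral_functional_plus
        spectral_functional_scale[of K _ "\<i>"] sf)
  then show ?thesis
    unfolding ip_def polar_def by simp
qed

lemma N_functional: "f \<in> l2 V \<Longrightarrow> spectral_functional K (\<lambda>\<phi>. of_real (\<integral>t. \<phi> t \<partial>N f))"
  by (intro interval_measure.spectral_functional_integral interval)

end

locale moment_family = measure_family V K N + l2_selfadjoint V A for V :: "'v set" and K N A +
  assumes moments: "f \<in> l2 V \<Longrightarrow> of_real (\<integral>t. t ^ k \<partial>N f) = l2_inner ((A ^^ k) f) f"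
begin

lemma ip_moments: "f \<in> l2 V \<Longrightarrow> g \<in> l2 V \<Longrightarrow> ip f g (\<lambda>t. t ^ k) = l2_inner ((A ^^ k) f) g"
proof -
  assume f: "f \<in> l2 V" and g: "g \<in> l2 V"
  have "ip f g (\<lambda>t. t ^ k) = polar (\<lambda>h. l2_inner ((A ^^ k) h) h) f g"
    unfolding ip_def by (rule polar_cong[OF moments f g])
  also have "\<dots> = l2_inner ((A ^^ k) f) g"
    by (rule polar_form[where V = V]) (auto simp: pow_l2 pow_lin f g)
  finally show ?thesis .
qed

text \<open>The measures are given for each function separately, and nothing relates
  \<open>N\<close> at a sum to \<open>N\<close> at the summands. The relation comes from the
  moments: as functionals of \<open>\<phi>\<close> both sides have the same ones. The symmetry, the
  diagonal values and the product rules below are obtained in the same way.\<close>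

lemma ip_lin_left:
  assumes "f \<in> l2 V" "g \<in> l2 V" "h \<in> l2 V" "bdd_borel K \<phi>"
  shows "ip (\<lambda>v. a * f v + b * g v) h \<phi> = a * ip f h \<phi> + b * ip g h \<phi>"
proof (rule spectral_functional_eq_if_moments[OF _ _ _ assms(4)])
  show "spectral_functional K (ip (\<lambda>v. a * f v + b * g v) h)"
    by (intro ip_functional l2_lincomb assms)
  show "spectral_functional K (\<lambda>\<phi>. a * ip f h \<phi> + b * ip g h \<phi>)"
    by (intro spectral_functional_plus spectral_functional_scale ip_functional assms)
  show "ip (\<lambda>v. a * f v + b * g v) h (\<lambda>t. t ^ k) = a * ip f h (\<lambda>t. t ^ k) + b * ip g h (\<lambda>t. t ^ k)" for k
    using assms by (simp add: ip_moments l2_lincomb pow_lin l2_inner_lin_left[where V = V] pow_l2)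
qed

lemma ip_commute:
  assumes "f \<in> l2 V" "g \<in> l2 V" "bdd_borel K \<phi>"
  shows "ip g f \<phi> = cnj (ip f g \<phi>)"
proof (rule spectral_functional_eq_if_moments[OF _ _ _ assms(3)])
  show "spectral_functional K (\<lambda>\<phi>. cnj (ip f g \<phi>))"
    by (intro spectral_functional_cnj ip_functional assms)
  show "ip g f (\<lambda>t. t ^ k) = cnj (ip f g (\<lambda>t. t ^ k))" for k
    using assms pow_sym[of g f k] l2_inner_commute[of g "(A ^^ k) f"] by (simp add: ip_moments)
qed (intro ip_functional assms)

lemma ip_lin_right:
  assumes "f \<in> l2 V" "g \<in> l2 V" "h \<in> l2 V" "bdd_borel K \<phi>"
  shows "ip h (\<lambda>v. a * f v + b * g v) \<phi> = cnj a * ip h f \<phi> + cnj b * ip h g \<phi>"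
proof -
  have "ip h (\<lambda>v. a * f v + b * g v) \<phi> = cnj (ip (\<lambda>v. a * f v + b * g v) h \<phi>)"
    by (rule ip_commute[OF l2_lincomb[OF assms(1,2)] assms(3,4)])
  also have "\<dots> = cnj a * cnj (ip f h \<phi>) + cnj b * cnj (ip g h \<phi>)"
    by (simp add: ip_lin_left[OF assms])
  also have "cnj (ip f h \<phi>) = ip h f \<phi>"
    by (rule ip_commute[OF assms(1,3,4), symmetric])
  also have "cnj (ip g h \<phi>) = ip h g \<phi>"
    by (rule ip_commute[OF assms(2,3,4), symmetric])
  finally show ?thesis .
qed

lemma ip_diag:
  assumes "f \<in> l2 V" "bdd_borel K \<phi>"
  shows "ip f f \<phi> = of_real (\<integral>t. \<phi> t \<partial>N f)"
  by (rule spectral_functional_eq_if_moments[OF ip_functional[OF assms(1,1)] N_functional[OF assms(1)] _ assms(2)])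
    (simp add: ip_moments moments assms)

lemma ip_power_right:
  assumes "f \<in> l2 V" "g \<in> l2 V" "bdd_borel K \<phi>"
  shows "ip f ((A ^^ k) g) \<phi> = ip f g (\<lambda>t. \<phi> t * t ^ k)"
proof (rule spectral_functional_eq_if_moments[OF _ _ _ assms(3)])
  show "spectral_functional K (\<lambda>\<phi>. ip f g (\<lambda>t. \<phi> t * t ^ k))"
    by (rule spectral_functional_weight[OF ip_functional]) (auto simp: assms)
  show "ip f ((A ^^ k) g) (\<lambda>t. t ^ j) = ip f g (\<lambda>t. t ^ j * t ^ k)" for j
    using assms
    by (simp add: ip_moments pow_l2 pow_sym[symmetric] power_add[symmetric] add.commute[of j k] funpow_add)
qed (intro ip_functional pow_l2 assms)

lemma ip_const: "f \<in> l2 V \<Longrightarrow> g \<in> l2 V \<Longrightarrow> ip f g (\<lambda>_. c) = of_real c * l2_inner f g"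
  using spectral_functional_cmult[OF ip_functional, of f g "\<lambda>_. 1" c] ip_moments[of f g 0] by simp

lemma mass: "f \<in> l2 V \<Longrightarrow> measure (N f) UNIV = (l2_norm f)\<^sup>2"
proof -
  assume f: "f \<in> l2 V"
  interpret interval_measure "N f" K by (rule interval[OF f])
  have "complex_of_real (measure (N f) UNIV) = of_real ((l2_norm f)\<^sup>2)"
    using moments[OF f, of 0] l2_inner_self[OF f] by simp
  then show ?thesis by (simp only: of_real_eq_iff)
qed

text \<open>The coordinates of the vector that \<open>l2_riesz\<close> assigns to the antilinear
  form \<open>ip f g (indicator B)\<close> in \<open>g\<close>.\<close>

definition sproj :: "real set \<Rightarrow> ('v \<Rightarrow> complex) \<Rightarrow> 'v \<Rightarrow> complex" where
  "sproj B f = (\<lambda>v. if v \<in> V then ip f (delta v) (indicator B) else 0)"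

text \<open>Cauchy-Schwarz for the semidefinite form given by \<open>indicator B\<close>: its
  diagonal value at h is \<open>measure (N h) B\<close>, which is at most the total mass, the
  squared norm of h.\<close>

lemma ip_indicator_bound:
  assumes B: "B \<in> sets borel" and f: "f \<in> l2 V" and g: "g \<in> l2 V"
  shows "cmod (ip f g (indicator B)) \<le> l2_norm f * l2_norm g"
proof -
  have diag: "Re (ip h h (indicator B)) = measure (N h) B" if "h \<in> l2 V" for h
  proof -
    interpret interval_measure "N h" K by (rule interval[OF that])
    show ?thesis using that B by (simp add: ip_diag)
  qed
  have le: "measure (N h) B \<le> (l2_norm h)\<^sup>2" if "h \<in> l2 V" for h
  proof -
    interpret interval_measure "N h" K by (rule interval[OF that])
    have "measure (N h) B \<le> measure (N h) (space (N h))" by (rule bounded_measure)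
    then show ?thesis using mass[OF that] by simp
  qed
  have "(cmod (ip f g (indicator B)))\<^sup>2 \<le> Re (ip f f (indicator B)) * Re (ip g g (indicator B))"
  proof (rule hermitian_form_cauchy_schwarz[OF _ _ _ f g, where q = "\<lambda>f g. ip f g (indicator B)"])
    show "ip g f (indicator B) = cnj (ip f g (indicator B))" if "f \<in> l2 V" "g \<in> l2 V" for f g
      by (rule ip_commute[OF that]) (simp add: B)
  qed (simp_all add: B ip_lin_left diag)
  also have "\<dots> \<le> (l2_norm f)\<^sup>2 * (l2_norm g)\<^sup>2"
    using f g le by (simp add: diag mult_mono)
  finally have "(cmod (ip f g (indicator B)))\<^sup>2 \<le> (l2_norm f * l2_norm g)\<^sup>2"
    by (simp add: power_mult_distrib)
  then show ?thesis
    by (rule power2_le_imp_le) simp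
qed

context
  fixes B :: "real set"
  assumes B: "B \<in> sets borel"
begin

lemma sproj_l2: "f \<in> l2 V \<Longrightarrow> sproj B f \<in> l2 V"
  unfolding sproj_def
  by (rule l2_riesz(1)[of V "\<lambda>g. ip f g (indicator B)" "l2_norm f"])
    (auto simp: ip_lin_right ip_indicator_bound B)

lemma sproj_inner: "f \<in> l2 V \<Longrightarrow> g \<in> l2 V \<Longrightarrow> l2_inner (sproj B f) g = ip f g (indicator B)"
  unfolding sproj_def
  by (rule l2_riesz(2)[of V "\<lambda>g. ip f g (indicator B)" "l2_norm f"])
    (auto simp: ip_lin_right ip_indicator_bound B)

lemma sproj_sym: "f \<in> l2 V \<Longrightarrow> g \<in> l2 V \<Longrightarrow> l2_inner (sproj B f) g = l2_inner f (sproj B g)"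
  using sproj_inner[of f g] sproj_inner[of g f] ip_commute[of f g "indicator B"]
    l2_inner_commute[of f "sproj B g"] B by simp

lemma sproj_lin: "f \<in> l2 V \<Longrightarrow> g \<in> l2 V \<Longrightarrow>
    sproj B (\<lambda>v. a * f v + b * g v) = (\<lambda>v. a * sproj B f v + b * sproj B g v)"
  by (auto simp: sproj_def fun_eq_iff ip_lin_left B)

text \<open>The source of multiplicativity. On a power \<open>t ^ k\<close> the operator power can
  be moved to \<open>g\<close>, where \<open>ip_power_right\<close> turns it into a factor under the
  integral.\<close>

lemma ip_sproj:
  assumes "f \<in> l2 V" "g \<in> l2 V" "bdd_borel K \<phi>"
  shows "ip (sproj B f) g \<phi> = ip f g (\<lambda>t. \<phi> t * indicator B t)"
proof (rule spectral_functional_eq_if_moments[OF _ _ _ assms(3)])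
  show "spectral_functional K (ip (sproj B f) g)"
    by (intro ip_functional sproj_l2 assms)
  show "spectral_functional K (\<lambda>\<phi>. ip f g (\<lambda>t. \<phi> t * indicator B t))"
    by (rule spectral_functional_weight[OF ip_functional]) (auto simp: assms B)
  fix k
  have "ip (sproj B f) g (\<lambda>t. t ^ k) = l2_inner (sproj B f) ((A ^^ k) g)"
    using assms by (simp add: ip_moments sproj_l2 pow_sym)
  also have "\<dots> = ip f g (\<lambda>t. indicator B t * t ^ k)"
    using assms B by (simp add: sproj_inner pow_l2 ip_power_right)
  finally show "ip (sproj B f) g (\<lambda>t. t ^ k) = ip f g (\<lambda>t. t ^ k * indicator B t)"
    by (simp add: mult.commute)
qed

end

lemma sproj_mult:
  assumes "B \<in> sets borel" "C \<in> sets borel" "f \<in> l2 V"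
  shows "sproj B (sproj C f) = sproj (B \<inter> C) f"
proof (rule l2_eqI[where V = V])
  fix h assume h: "h \<in> l2 V"
  have "l2_inner (sproj B (sproj C f)) h = ip f h (\<lambda>t. indicator B t * indicator C t)"
    using assms h by (simp add: sproj_inner sproj_l2 ip_sproj)
  also have "(\<lambda>t. indicator B t * indicator C t) = (indicator (B \<inter> C) :: real \<Rightarrow> real)"
    by (auto simp: indicator_def)
  finally show "l2_inner (sproj B (sproj C f)) h = l2_inner (sproj (B \<inter> C) f) h"
    using assms h by (simp add: sproj_inner)
qed (use assms in \<open>auto simp: sproj_l2\<close>)

lemma sproj_full:
  assumes "B \<in> sets borel" "{-K..K} \<subseteq> B" "f \<in> l2 V"
  shows "sproj B f = f"
proof (rule l2_eqI[where V = V])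
  fix h assume h: "h \<in> l2 V"
  have "ip f h (indicator B) = ip f h (\<lambda>_. 1)"
  proof (rule spectral_functional_cong[OF ip_functional[OF assms(3) h]])
    show "indicator B t = 1" if "t \<in> {-K..K}" for t
      using that assms(2) by (simp add: indicator_def subsetD)
  qed (simp_all add: assms(1))
  then show "l2_inner (sproj B f) h = l2_inner f h"
    using assms h by (simp add: sproj_inner ip_const)
qed (use assms in \<open>auto simp: sproj_l2\<close>)

text \<open>The remainder after n terms is again a projection, namely that of the leftover set
  \<open>S n\<close>. Its squared norm is the value of \<open>ip f f\<close> at
  \<open>indicator (S n)\<close>, and every point lies outside \<open>S n\<close> for large
  n.\<close>

lemma sproj_sigma_additive:
  fixes B :: "nat \<Rightarrow> real set"
  assumes B: "range B \<subseteq> sets borel" and disj: "disjoint_family B" and f: "f \<in> l2 V"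
  shows "(\<lambda>n. l2_norm (\<lambda>v. sproj (\<Union>n. B n) f v - (\<Sum>i<n. sproj (B i) f v))) \<longlonglongrightarrow> 0"
proof -
  define S where "S n = (\<Union>n. B n) - (\<Union>i<n. B i)" for n
  have Bi [simp]: "B i \<in> sets borel" for i using B by auto
  have UB [simp]: "(\<Union>n. B n) \<in> sets borel" by (rule sets.countable_UN[OF B])
  have Sn [simp]: "S n \<in> sets borel" for n unfolding S_def by (intro sets.Diff UB sets.finite_UN) auto
  have eq: "(\<lambda>v. sproj (\<Union>n. B n) f v - (\<Sum>i<n. sproj (B i) f v)) = sproj (S n) f" for n
  proof
    fix v
    have ind: "indicator (\<Union>n. B n) = (\<lambda>t. indicator (S n) t + (\<Sum>i<n. indicator (B i) t) :: real)"
    proof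
      fix t
      have "(\<Sum>i<n. indicator (B i) t) = (indicator (\<Union>i<n. B i) t :: real)"
        using disj by (subst indicator_UN_disjoint) (auto simp: disjoint_family_on_def)
      then show "indicator (\<Union>n. B n) t = indicator (S n) t + (\<Sum>i<n. indicator (B i) t :: real)"
        by (auto simp: S_def indicator_def)
    qed
    show "sproj (\<Union>n. B n) f v - (\<Sum>i<n. sproj (B i) f v) = sproj (S n) f v"
    proof (cases "v \<in> V")
      case True
      have sf: "spectral_functional K (ip f (delta v))" by (intro ip_functional f l2_delta True)
      have "ip f (delta v) (indicator (\<Union>n. B n))
          = ip f (delta v) (indicator (S n)) + (\<Sum>i<n. ip f (delta v) (indicator (B i)))"
        unfolding ind by (subst spectral_functional_add[OF sf])
          (auto simp: spectral_functional_sum[OF sf] intro!: bdd_borel_sum)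
      then show ?thesis using True by (simp add: sproj_def)
    qed (simp add: sproj_def)
  qed
  have sf: "spectral_functional K (ip f f)" by (intro ip_functional f)
  have "(\<lambda>n. ip f f (indicator (S n))) \<longlonglongrightarrow> ip f f (\<lambda>_. 0)"
  proof (rule spectral_functional_conv[OF sf, where C = 1])
    fix t
    have "\<forall>\<^sub>F n in sequentially. indicator (S n) t = (0::real)"
    proof (cases "t \<in> (\<Union>n. B n)")
      case True
      then obtain i where "t \<in> B i" by auto
      then have "indicator (S n) t = (0::real)" if "n > i" for n
        using that by (auto simp: S_def indicator_def)
      then show ?thesis
        using eventually_gt_at_top[of i] by (rule eventually_mono[rotated])
    qed (auto simp: S_def)
    then show "(\<lambda>n. indicator (S n) t) \<longlonglongrightarrow> (0::real)"
      by (rule tendsto_eventually)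
    show "\<bar>indicator (S n) t\<bar> \<le> (1::real)" for n by (simp add: indicator_def)
  qed auto
  moreover have "ip f f (indicator (S n)) = of_real ((l2_norm (sproj (S n) f))\<^sup>2)" for n
  proof -
    have "of_real ((l2_norm (sproj (S n) f))\<^sup>2) = l2_inner (sproj (S n) f) (sproj (S n) f)"
      by (simp add: l2_inner_self[where V = V] sproj_l2 f)
    also have "\<dots> = l2_inner (sproj (S n) (sproj (S n) f)) f"
      by (simp add: sproj_sym sproj_l2 f)
    also have "\<dots> = ip f f (indicator (S n))"
      by (simp add: sproj_mult sproj_inner f)
    finally show ?thesis by simp
  qed
  ultimately have "(\<lambda>n. complex_of_real ((l2_norm (sproj (S n) f))\<^sup>2)) \<longlonglongrightarrow> of_real 0"
    by (simp add: spectral_functional_zero[OF sf])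
  then have "(\<lambda>n. (l2_norm (sproj (S n) f))\<^sup>2) \<longlonglongrightarrow> 0"
    by (simp only: tendsto_of_real_iff)
  then have "(\<lambda>n. sqrt ((l2_norm (sproj (S n) f))\<^sup>2)) \<longlonglongrightarrow> sqrt 0"
    by (rule tendsto_real_sqrt)
  then show ?thesis by (simp add: eq)
qed

lemma scalar_measure_sproj:
  assumes f: "f \<in> l2 V"
  shows "scalar_measure sproj f = N f"
proof -
  interpret interval_measure "N f" K by (rule interval[OF f])
  have "scalar_measure sproj f = measure_of UNIV (sets borel) (emeasure (N f))"
    unfolding scalar_measure_def
  proof (rule measure_of_eq)
    fix B :: "real set" assume "B \<in> sigma_sets UNIV (sets borel)"
    then have B: "B \<in> sets borel"
      using sets.sigma_sets_eq[of "borel :: real measure"] by simp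
    show "ennreal (Re (l2_inner (sproj B f) f)) = emeasure (N f) B"
      using B f by (simp add: sproj_inner ip_diag emeasure_eq_measure)
  qed simp
  also have "\<dots> = N f"
    using measure_of_of_measure[of "N f"] by simp
  finally show ?thesis .
qed

lemma spectral_measure_sproj: "is_spectral_measure V A sproj"
  unfolding is_spectral_measure_def projection_valued_measure_def orthogonal_projection_def
proof (intro conjI ballI allI impI)
  fix f assume f: "f \<in> l2 V"
  show "sproj {} f = (\<lambda>_. 0)"
  proof (rule l2_eqI[where V = V])
    fix h assume h: "h \<in> l2 V"
    have "(indicator {} :: real \<Rightarrow> real) = (\<lambda>_. 0)" by (simp add: fun_eq_iff)
    then show "l2_inner (sproj {} f) h = l2_inner (\<lambda>_. 0) h"
      using f h spectral_functional_zero[OF ip_functional[OF f h]] by (simp add: sproj_inner)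
  qed (auto simp: sproj_l2 f)
  show "l2_inner (A f) f = complex_of_real (\<integral>t. t \<partial>scalar_measure sproj f)"
    using moments[OF f, of 1] by (simp add: scalar_measure_sproj f)
next
  show "\<exists>a>0. \<forall>f\<in>l2 V. sproj {- a<..<a} f = f"
    by (rule exI[of _ "\<bar>K\<bar> + 1"]) (auto intro!: sproj_full)
next
  fix B :: "nat \<Rightarrow> real set" and f
  assume "range B \<subseteq> sets borel" "disjoint_family B" "f \<in> l2 V"
  then show "(\<lambda>n. l2_norm (\<lambda>v. sproj (\<Union>n. B n) f v - (\<Sum>n<n. sproj (B n) f v))) \<longlonglongrightarrow> 0"
    by (rule sproj_sigma_additive)
qed (auto simp: sproj_l2 sproj_lin sproj_mult sproj_sym)

end

section \<open>Existence of the spectral measure of a bounded operator\<close>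

locale l2_effect = l2_selfadjoint +
  assumes nonneg: "f \<in> l2 V \<Longrightarrow> 0 \<le> Re (l2_inner (A f) f)"
    and le_one: "f \<in> l2 V \<Longrightarrow> Re (l2_inner (A f) f) \<le> (l2_norm f)\<^sup>2"
begin

definition co :: "('a \<Rightarrow> complex) \<Rightarrow> 'a \<Rightarrow> complex" where "co f = (\<lambda>v. f v - A f v)"

lemma co_l2: "f \<in> l2 V \<Longrightarrow> co f \<in> l2 V"
  unfolding co_def by (intro l2_diff A_l2)

lemma co_sym: "f \<in> l2 V \<Longrightarrow> g \<in> l2 V \<Longrightarrow> l2_inner (co f) g = l2_inner f (co g)"
  unfolding co_def by (simp add: l2_inner_diff_left[where V = V] l2_inner_diff_right[where V = V] A_l2 A_sym)

lemma A_co: "f \<in> l2 V \<Longrightarrow> A (co f) = co (A f)"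
  unfolding co_def by (simp add: A_diff A_l2)

lemma co_nonneg: "f \<in> l2 V \<Longrightarrow> 0 \<le> Re (l2_inner (co f) f)"
  unfolding co_def using le_one[of f] by (simp add: l2_inner_diff_left[where V = V] A_l2 l2_inner_self)

lemma co_pow_l2: "f \<in> l2 V \<Longrightarrow> (co ^^ k) f \<in> l2 V"
  by (induction k) (auto intro: co_l2)

lemma A_co_pow: "f \<in> l2 V \<Longrightarrow> (co ^^ k) (A f) = A ((co ^^ k) f)"
  by (induction k) (auto simp: A_co co_pow_l2)

lemma A_pow_co: "f \<in> l2 V \<Longrightarrow> (A ^^ k) (co f) = co ((A ^^ k) f)"
  by (induction k) (auto simp: A_co pow_l2)

text \<open>The integrals of t^a (1-t)^b that the spectral measure at \<open>f\<close> must have;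
  \<open>weight_rec\<close> reflects t + (1-t) = 1.\<close>

definition weight :: "('a \<Rightarrow> complex) \<Rightarrow> nat \<Rightarrow> nat \<Rightarrow> real" where
  "weight f a b = Re (l2_inner ((A ^^ a) ((co ^^ b) f)) f)"

lemma weight_rec: "f \<in> l2 V \<Longrightarrow> weight f a b = weight f (Suc a) b + weight f a (Suc b)"
  by (simp add: weight_def A_pow_co co_pow_l2) (simp add: co_def l2_inner_diff_left[where V = V] A_l2 pow_l2 co_pow_l2)

lemma weight_shift_A:
  assumes f: "f \<in> l2 V" shows "weight f (a + 2) b = weight (A f) a b"
proof -
  have "(A ^^ (a + 2)) h = A ((A ^^ a) (A h))" for h
    by (simp only: add_2_eq_Suc' funpow.simps o_apply funpow_swap1)
  then have "weight f (a + 2) b = Re (l2_inner (A ((A ^^ a) (A ((co ^^ b) f)))) f)"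
    by (simp add: weight_def)
  also have "\<dots> = weight (A f) a b"
    by (simp add: weight_def A_sym A_co_pow f pow_l2 A_l2 co_pow_l2)
  finally show ?thesis .
qed

lemma weight_shift_co:
  assumes f: "f \<in> l2 V" shows "weight f a (b + 2) = weight (co f) a b"
proof -
  have "(co ^^ (b + 2)) f = co ((co ^^ b) (co f))"
    by (simp only: add_2_eq_Suc' funpow.simps o_apply funpow_swap1)
  then have "weight f a (b + 2) = Re (l2_inner ((A ^^ a) (co ((co ^^ b) (co f)))) f)"
    by (simp add: weight_def)
  also have "\<dots> = weight (co f) a b"
    by (simp add: weight_def A_pow_co co_sym f pow_l2 co_l2 co_pow_l2)
  finally show ?thesis .
qed

text \<open>\<open>A\<close> and \<open>co\<close> are symmetric and commute, so two equal factors
  can be placed one on each side of the inner product; this lowers an exponent by 2 and replaces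
  \<open>f\<close> by \<open>A f\<close> or \<open>co f\<close>. Only exponents 0 and 1
  remain.\<close>

lemma weight_nonneg: "f \<in> l2 V \<Longrightarrow> 0 \<le> weight f a b"
proof (induction "a + b" arbitrary: a b f rule: less_induct)
  case less
  consider a' where "a = a' + 2" | b' where "b = b' + 2" | "a \<le> 1" "b \<le> 1"
    by (metis add.commute le_Suc_ex not_less_eq_eq numeral_2_eq_2 One_nat_def)
  then show ?case
  proof cases
    case 1
    then show ?thesis using less by (simp add: weight_shift_A[simplified] A_l2)
  next
    case 2
    then show ?thesis using less by (simp add: weight_shift_co[simplified] co_l2)
  next
    case 3
    note f = less.prems
    have "0 \<le> weight f 0 0"
      using f by (simp add: weight_def l2_inner_self)
    moreover have "0 \<le> weight f 1 0" using f by (simp add: weight_def nonneg)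
    moreover have "0 \<le> weight f 0 1" using f by (simp add: weight_def co_nonneg)
    \<comment> \<open>Positivity of A(1-A) without a square root: A(1-A) = A(1-A)A + (1-A)A(1-A),
      and both summands are visibly positive.\<close>
    moreover have "0 \<le> weight f 1 1"
    proof -
      have "0 \<le> Re (l2_inner (co (A f)) (A f))" using f by (simp add: co_nonneg A_l2)
      moreover have "0 \<le> Re (l2_inner (A (co f)) (co f))" using f by (simp add: nonneg co_l2)
      moreover have "l2_inner (A (co f)) f = l2_inner (co (A f)) (A f) + l2_inner (A (co f)) (co f)"
        using l2_inner_diff_right[OF f A_l2[OF f] A_l2[OF co_l2[OF f]]]
        by (simp add: A_co[OF f] flip: co_def)
      ultimately show ?thesis by (simp add: weight_def)
    qed
    moreover have "a = 0 \<or> a = 1" "b = 0 \<or> b = 1" using 3 by auto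
    ultimately show ?thesis by auto
  qed
qed

lemma moment_family_exists: "\<exists>N. moment_family V 1 N A"
proof -
  have "\<exists>M. finite_measure M \<and> sets M = sets borel \<and> (AE t in M. t \<in> {0..1}) \<and>
      (\<forall>j. (\<integral>t. t ^ j \<partial>M) = weight f j 0)" if "f \<in> l2 V" for f
    by (rule hausdorff_moment[of "weight f", OF weight_nonneg[OF that] weight_rec[OF that]])
  then obtain N where N: "\<And>f. f \<in> l2 V \<Longrightarrow> finite_measure (N f)" "\<And>f. f \<in> l2 V \<Longrightarrow> sets (N f) = sets borel"
    "\<And>f. f \<in> l2 V \<Longrightarrow> AE t in N f. t \<in> {0..1}" "\<And>f j. f \<in> l2 V \<Longrightarrow> (\<integral>t. t ^ j \<partial>N f) = weight f j 0"
    by metis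
  have "moment_family V 1 N A"
  proof (intro moment_family.intro measure_family.intro moment_family_axioms.intro l2_selfadjoint_axioms)
    fix f assume f: "f \<in> l2 V"
    interpret F: finite_measure "N f" by (rule N(1)[OF f])
    \<comment> \<open>\<open>interval_measure\<close> asks for a symmetric interval, so that
      \<open>{0..1}\<close> is enlarged to \<open>{-1..1}\<close>.\<close>
    show "interval_measure (N f) 1"
    proof
      show "AE t in N f. t \<in> {- 1..1}" by (rule AE_mp[OF N(3)[OF f]]) auto
    qed (rule N(2)[OF f])
    show "complex_of_real (\<integral>t. t ^ k \<partial>N f) = l2_inner ((A ^^ k) f) f" for k
      using l2_selfadjoint.quadratic_real[OF selfadjoint_pow f] by (simp add: N(4)[OF f] weight_def)
  qed
  then show ?thesis by (intro exI)
qed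

end

context l2_selfadjoint
begin

text \<open>The affine change B = (A + K)/(2K) maps the numerical range from [-K, K] into [0, 1],
  where the moment problem is solved; the measures of \<open>B\<close> are then transported back
  along the inverse map \<open>\<phi>\<close>.\<close>

theorem spectral_measure_exists:
  assumes "0 < K" and bound: "\<And>f. f \<in> l2 V \<Longrightarrow> \<bar>Re (l2_inner (A f) f)\<bar> \<le> K * (l2_norm f)\<^sup>2"
  shows "\<exists>P. is_spectral_measure V A P"
proof -
  define B where "B f = (\<lambda>v. (1 / 2) * f v + of_real (1 / (2 * K)) * A f v)" for f
  have Re_B: "Re (l2_inner (B f) f) = ((l2_norm f)\<^sup>2 + Re (l2_inner (A f) f) / K) / 2" if "f \<in> l2 V" for f
    unfolding B_def using that l2_inner_lin_left[of f V "A f" f "1/2" "of_real (1 / (2 * K))"]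
    by (simp add: A_l2 l2_inner_self add_divide_distrib)
  interpret B: l2_effect V B
  proof
    fix f g :: "'v \<Rightarrow> complex" and a b assume f: "f \<in> l2 V"
    show "B f \<in> l2 V" unfolding B_def by (intro l2_lincomb f A_l2)
    have "Re (l2_inner (A f) f) / K \<le> (l2_norm f)\<^sup>2" "- (Re (l2_inner (A f) f) / K) \<le> (l2_norm f)\<^sup>2"
      using bound[OF f] \<open>0 < K\<close> by (simp_all add: field_simps abs_le_iff)
    then show "0 \<le> Re (l2_inner (B f) f)" "Re (l2_inner (B f) f) \<le> (l2_norm f)\<^sup>2"
      by (simp_all add: Re_B[OF f])
    assume g: "g \<in> l2 V"
    show "B (\<lambda>v. a * f v + b * g v) = (\<lambda>v. a * B f v + b * B g v)"
      unfolding B_def by (simp add: A_lin f g algebra_simps)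
    show "l2_inner (B f) g = l2_inner f (B g)"
      unfolding B_def using l2_inner_lin_left[OF f A_l2[OF f] g, of "1/2" "of_real (1 / (2 * K))"]
        l2_inner_lin_right[OF g A_l2[OF g] f, of "1/2" "of_real (1 / (2 * K))"] A_sym[OF f g] by simp
  qed
  obtain N where "moment_family V 1 N B" using B.moment_family_exists ..
  then interpret N: moment_family V 1 N B .
  define \<phi> where "\<phi> t = 2 * K * t - K" for t
  have \<phi> [measurable]: "\<phi> \<in> borel_measurable borel" unfolding \<phi>_def by measurable
  have A_B: "A f = (\<lambda>v. of_real (2 * K) * B f v + of_real (- K) * f v)" for f
    using \<open>0 < K\<close> by (simp add: B_def fun_eq_iff field_simps)
  \<comment> \<open>Since \<open>A\<close> is the function \<open>\<phi>\<close> of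
    \<open>B\<close>, moving \<open>A\<close> inside the integral produces the factor
    \<open>\<phi>\<close>; iteration yields the moments of \<open>A\<close>.\<close>
  have step: "N.ip f (A g) \<psi> = N.ip f g (\<lambda>t. \<psi> t * \<phi> t)"
    if f: "f \<in> l2 V" and g: "g \<in> l2 V" and \<psi>: "bdd_borel 1 \<psi>" for f g \<psi>
  proof -
    have b: "bdd_borel 1 (\<lambda>t. \<psi> t * t)" by (intro bdd_borel_mult \<psi>) auto
    have "N.ip f (A g) \<psi> = of_real (2 * K) * N.ip f (B g) \<psi> + of_real (- K) * N.ip f g \<psi>"
      unfolding A_B[of g] by (subst N.ip_lin_right) (auto simp: f g \<psi> B.A_l2)
    also have "N.ip f (B g) \<psi> = N.ip f g (\<lambda>t. \<psi> t * t)"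
      using N.ip_power_right[OF f g \<psi>, of 1] by simp
    also have "of_real (2 * K) * N.ip f g (\<lambda>t. \<psi> t * t) + of_real (- K) * N.ip f g \<psi>
        = N.ip f g (\<lambda>t. 2 * K * (\<psi> t * t) + (- K) * \<psi> t)"
      using b by (subst spectral_functional_lin[OF N.ip_functional[OF f g]])
        (auto simp: spectral_functional_cmult[OF N.ip_functional[OF f g] b] \<psi> intro!: bdd_borel_mult)
    also have "(\<lambda>t. 2 * K * (\<psi> t * t) + (- K) * \<psi> t) = (\<lambda>t. \<psi> t * \<phi> t)"
      by (simp add: \<phi>_def algebra_simps)
    finally show ?thesis .
  qed
  have bpow: "bdd_borel 1 (\<lambda>t. \<phi> t ^ k)" for k
    unfolding \<phi>_def by (intro bdd_borel_continuous continuous_intros)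
  have mom: "N.ip f g (\<lambda>t. \<phi> t ^ k) = l2_inner ((A ^^ k) f) g" if "f \<in> l2 V" "g \<in> l2 V" for f g k
    using that
  proof (induction k arbitrary: f g)
    case 0
    then show ?case using N.ip_const[of f g 1] by simp
  next
    case (Suc k)
    have "N.ip f g (\<lambda>t. \<phi> t ^ Suc k) = N.ip f (A g) (\<lambda>t. \<phi> t ^ k)"
      using step[OF Suc.prems bpow] by (simp add: mult.commute)
    also have "\<dots> = l2_inner ((A ^^ k) f) (A g)" using Suc by (simp add: A_l2)
    also have "\<dots> = l2_inner ((A ^^ Suc k) f) g" using Suc by (simp add: A_sym pow_l2)
    finally show ?case .
  qed
  have "moment_family V (3 * K) (\<lambda>f. distr (N f) borel \<phi>) A"
  proof (intro moment_family.intro measure_family.intro moment_family_axioms.intro l2_selfadjoint_axioms)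
    fix f assume f: "f \<in> l2 V"
    interpret F: interval_measure "N f" 1 by (rule N.interval[OF f])
    have m: "\<phi> \<in> measurable (N f) borel" by simp
    interpret D: finite_measure "distr (N f) borel \<phi>" by (rule F.finite_measure_distr[OF m])
    \<comment> \<open>The bound 3K arises because \<open>\<phi>\<close> maps the symmetric interval
      \<open>{-1..1}\<close>, all that is recorded about the support, onto [-3K, K].\<close>
    show "interval_measure (distr (N f) borel \<phi>) (3 * K)"
    proof
      have "AE t in N f. \<phi> t \<in> {- (3 * K)..3 * K}"
      proof (rule AE_mp[OF F.AE_interval AE_I2], rule impI)
        fix t :: real assume "t \<in> {-1..1}"
        then have "K * (-1) \<le> K * t" "K * t \<le> K * 1"
          using \<open>0 < K\<close> mult_left_mono[of "-1" t K] mult_left_mono[of t 1 K] by auto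
        then show "\<phi> t \<in> {- (3 * K)..3 * K}"
          using \<open>0 < K\<close> by (simp add: \<phi>_def)
      qed
      then show "AE t in distr (N f) borel \<phi>. t \<in> {- (3 * K)..3 * K}"
        by (subst AE_distr_iff[OF m]) auto
    qed simp
    show "complex_of_real (\<integral>t. t ^ k \<partial>distr (N f) borel \<phi>) = l2_inner ((A ^^ k) f) f" for k
      using mom[OF f f, of k] N.ip_diag[OF f bpow] by (subst integral_distr[OF m]) auto
  qed
  then interpret D: moment_family V "3 * K" "\<lambda>f. distr (N f) borel \<phi>" A .
  show ?thesis using D.spectral_measure_sproj by blast
qed

end

section \<open>Functional calculus of a given spectral measure\<close>

locale spectral_operator = l2_selfadjoint V A for V :: "'v set" and A +
  fixes Q :: "real set \<Rightarrow> ('v \<Rightarrow> complex) \<Rightarrow> 'v \<Rightarrow> complex" and a :: real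
  assumes spectral: "is_spectral_measure V A Q"
    and full: "f \<in> l2 V \<Longrightarrow> Q {-a<..<a} f = f"
begin

lemma orthogonal_projection_Q: "B \<in> sets borel \<Longrightarrow> orthogonal_projection V (Q B)"
  using spectral unfolding is_spectral_measure_def projection_valued_measure_def by simp

lemma Q_l2: "B \<in> sets borel \<Longrightarrow> f \<in> l2 V \<Longrightarrow> Q B f \<in> l2 V"
  using orthogonal_projection_Q[of B] unfolding orthogonal_projection_def by simp

lemma Q_lin: "B \<in> sets borel \<Longrightarrow> f \<in> l2 V \<Longrightarrow> g \<in> l2 V \<Longrightarrow>
    Q B (\<lambda>v. c * f v + d * g v) = (\<lambda>v. c * Q B f v + d * Q B g v)"
  using orthogonal_projection_Q[of B] unfolding orthogonal_projection_def by simp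

lemma Q_sym: "B \<in> sets borel \<Longrightarrow> f \<in> l2 V \<Longrightarrow> g \<in> l2 V \<Longrightarrow> l2_inner (Q B f) g = l2_inner f (Q B g)"
  using orthogonal_projection_Q[of B] unfolding orthogonal_projection_def by simp

lemma Q_empty: "f \<in> l2 V \<Longrightarrow> Q {} f = (\<lambda>_. 0)"
  using spectral unfolding is_spectral_measure_def projection_valued_measure_def by simp

lemma Q_Int: "B \<in> sets borel \<Longrightarrow> C \<in> sets borel \<Longrightarrow> f \<in> l2 V \<Longrightarrow> Q B (Q C f) = Q (B \<inter> C) f"
  using spectral unfolding is_spectral_measure_def projection_valued_measure_def by simp

lemma Q_sigma: "range Bs \<subseteq> sets borel \<Longrightarrow> disjoint_family Bs \<Longrightarrow> f \<in> l2 V \<Longrightarrow>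
    (\<lambda>N. l2_norm (\<lambda>v. Q (\<Union>n. Bs n) f v - (\<Sum>n<N. Q (Bs n) f v))) \<longlonglongrightarrow> 0"
  using spectral unfolding is_spectral_measure_def projection_valued_measure_def by simp

lemma A_integral: "f \<in> l2 V \<Longrightarrow> l2_inner (A f) f = of_real (\<integral>t. t \<partial>scalar_measure Q f)"
  using spectral unfolding is_spectral_measure_def by simp

lemma Q_inner_self: "B \<in> sets borel \<Longrightarrow> f \<in> l2 V \<Longrightarrow> l2_inner (Q B f) f = of_real ((l2_norm (Q B f))\<^sup>2)"
  using Q_sym[of B "Q B f" f] Q_Int[of B B f] l2_inner_self[OF Q_l2[of B f]] by (simp add: Q_l2)

text \<open>\<open>measure_of\<close> returns the intended values only for a countably additive set
  function. This is derived from the strong convergence of the projections: pairing the remainder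
  with \<open>f\<close> is controlled by Cauchy-Schwarz.\<close>

lemma emeasure_scalar:
  assumes B: "B \<in> sets borel" and f: "f \<in> l2 V"
  shows "emeasure (scalar_measure Q f) B = ennreal (Re (l2_inner (Q B f) f))"
  unfolding scalar_measure_def
proof (rule emeasure_measure_of_sigma)
  show "sigma_algebra UNIV (sets (borel :: real measure))"
    using sets.sigma_algebra_axioms[of "borel :: real measure"] by simp
  show "positive (sets borel) (\<lambda>B. ennreal (Re (l2_inner (Q B f) f)))"
    by (simp add: positive_def Q_empty f)
  show "countably_additive (sets borel) (\<lambda>B. ennreal (Re (l2_inner (Q B f) f)))"
  proof (rule countably_additiveI)
    fix Bs :: "nat \<Rightarrow> real set"
    assume Bs: "range Bs \<subseteq> sets borel" and disj: "disjoint_family Bs" and U: "(\<Union>i. Bs i) \<in> sets borel"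
    have Bi: "Bs i \<in> sets borel" for i using Bs by auto
    define D where "D N = (\<lambda>v. Q (\<Union>n. Bs n) f v - (\<Sum>n<N. Q (Bs n) f v))" for N
    have sum_l2: "(\<lambda>v. \<Sum>n<N. 1 * Q (Bs n) f v) \<in> l2 V" for N
      by (intro l2_sum Q_l2 Bi f) simp
    have D: "D N \<in> l2 V" for N
      unfolding D_def using sum_l2[of N] by (intro l2_diff Q_l2 U f) simp
    have DN: "l2_inner (D N) f = l2_inner (Q (\<Union>n. Bs n) f) f - (\<Sum>n<N. l2_inner (Q (Bs n) f) f)" for N
      unfolding D_def using l2_inner_diff_left[OF Q_l2[OF U f] sum_l2[of N] f]
        l2_inner_sum_left[of "{..<N}" "\<lambda>n. Q (Bs n) f" V f "\<lambda>_. 1"] by (simp add: Q_l2 Bi f)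
    have "(\<lambda>N. l2_inner (D N) f) \<longlonglongrightarrow> 0"
    proof (rule Lim_null_comparison)
      show "\<forall>\<^sub>F N in sequentially. norm (l2_inner (D N) f) \<le> l2_norm (D N) * l2_norm f"
        by (intro always_eventually allI l2_cauchy_schwarz[OF D f])
      show "(\<lambda>N. l2_norm (D N) * l2_norm f) \<longlonglongrightarrow> 0"
        using tendsto_mult_right[OF Q_sigma[OF Bs disj f], of "l2_norm f"] by (simp add: D_def)
    qed
    then have "(\<lambda>N. Re (l2_inner (D N) f)) \<longlonglongrightarrow> 0"
      using tendsto_Re by fastforce
    then have "(\<lambda>N. Re (l2_inner (Q (\<Union>n. Bs n) f) f) - Re (l2_inner (D N) f))
        \<longlonglongrightarrow> Re (l2_inner (Q (\<Union>n. Bs n) f) f) - 0"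
      by (intro tendsto_diff tendsto_const)
    then have "(\<lambda>n. Re (l2_inner (Q (Bs n) f) f)) sums Re (l2_inner (Q (\<Union>n. Bs n) f) f)"
      by (simp add: DN sums_def)
    then show "(\<Sum>i. ennreal (Re (l2_inner (Q (Bs i) f) f))) = ennreal (Re (l2_inner (Q (\<Union>i. Bs i) f) f))"
      by (intro suminf_ennreal_eq) (auto simp: Q_inner_self Bi f)
  qed
qed (rule B)

lemma measure_scalar:
  "B \<in> sets borel \<Longrightarrow> f \<in> l2 V \<Longrightarrow> measure (scalar_measure Q f) B = (l2_norm (Q B f))\<^sup>2"
  by (simp add: measure_def emeasure_scalar Q_inner_self)

text \<open>By multiplicativity the projection of the complement of (-a, a) annihilates
  \<open>Q {-a<..<a} f\<close>, which is \<open>f\<close> itself.\<close>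

lemma interval_scalar: assumes f: "f \<in> l2 V" shows "interval_measure (scalar_measure Q f) a"
proof -
  have s: "sets (scalar_measure Q f) = sets borel" and sp: "space (scalar_measure Q f) = UNIV"
    using sets.sigma_sets_eq[of "borel :: real measure"]
    by (auto simp: scalar_measure_def sets_measure_of_conv space_measure_of_conv)
  interpret finite_measure "scalar_measure Q f"
    by (rule finite_measureI) (simp add: sp emeasure_scalar f)
  have "Q (- {-a<..<a}) f = Q (- {-a<..<a}) (Q {-a<..<a} f)"
    by (simp add: full f)
  also have "\<dots> = (\<lambda>_. 0)"
    by (subst Q_Int) (auto simp: f Q_empty)
  finally have z: "emeasure (scalar_measure Q f) (- {-a<..<a}) = 0"
    by (simp add: emeasure_scalar f)
  show ?thesis
  proof
    show "AE t in scalar_measure Q f. t \<in> {- a..a}"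
      by (rule AE_I[OF _ z]) (auto simp: s)
  qed (rule s)
qed

sublocale fam: measure_family V a "scalar_measure Q"
  by (rule measure_family.intro[OF interval_scalar])

lemma ip_indicator:
  assumes B: "B \<in> sets borel" and f: "f \<in> l2 V" and g: "g \<in> l2 V"
  shows "fam.ip f g (indicator B) = l2_inner (Q B f) g"
proof -
  have "of_real (\<integral>t. indicator B t \<partial>scalar_measure Q h) = l2_inner (Q B h) h" if h: "h \<in> l2 V" for h
  proof -
    interpret interval_measure "scalar_measure Q h" a by (rule interval_scalar[OF h])
    show ?thesis
      using B by (simp add: measure_scalar[OF B h] Q_inner_self[OF B h])
  qed
  then have "fam.ip f g (indicator B) = polar (\<lambda>h. l2_inner (Q B h) h) f g"
    unfolding fam.ip_def by (rule polar_cong[OF _ f g])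
  also have "\<dots> = l2_inner (Q B f) g"
    by (rule polar_form[where V = V]) (auto simp: Q_l2 Q_lin B f g)
  finally show ?thesis .
qed

lemma ip_id:
  assumes f: "f \<in> l2 V" and g: "g \<in> l2 V"
  shows "fam.ip f g (\<lambda>t. t) = l2_inner (A f) g"
proof -
  have "fam.ip f g (\<lambda>t. t) = polar (\<lambda>h. l2_inner (A h) h) f g"
    unfolding fam.ip_def by (rule polar_cong[OF A_integral[symmetric] f g])
  also have "\<dots> = l2_inner (A f) g"
    by (rule polar_form[where V = V]) (auto simp: A_l2 A_lin f g)
  finally show ?thesis .
qed

text \<open>Tested on indicators this is multiplicativity of \<open>Q\<close>. Moments are of no use
  at this stage, since only the first of them is known.\<close>

lemma ip_Q:
  assumes B: "B \<in> sets borel" and f: "f \<in> l2 V" and g: "g \<in> l2 V" and \<phi>: "bdd_borel a \<phi>"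
  shows "fam.ip (Q B f) g \<phi> = fam.ip f g (\<lambda>t. \<phi> t * indicator B t)"
proof (rule spectral_functional_eq_if_indicator[OF _ _ _ \<phi>])
  show "spectral_functional a (fam.ip (Q B f) g)"
    by (intro fam.ip_functional Q_l2 B f g)
  show "spectral_functional a (\<lambda>\<phi>. fam.ip f g (\<lambda>t. \<phi> t * indicator B t))"
    by (rule spectral_functional_weight[OF fam.ip_functional]) (auto simp: f g B)
  fix C :: "real set" assume C: "C \<in> sets borel"
  have "(\<lambda>t. indicator C t * indicator B t) = (indicator (C \<inter> B) :: real \<Rightarrow> real)"
    by (auto simp: indicator_def)
  then show "fam.ip (Q B f) g (indicator C) = fam.ip f g (\<lambda>t. indicator C t * indicator B t)"
    using B C f g by (simp add: ip_indicator Q_l2 Q_Int)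
qed

text \<open>The first moment identity, applied to \<open>Q B f\<close> in place of \<open>f\<close>,
  localises it to an arbitrary Borel set: symmetry moves \<open>A\<close> to \<open>Q B f\<close>,
  and \<open>ip_Q\<close> turns the projection into the factor \<open>indicator B\<close>.\<close>

lemma ip_A:
  assumes f: "f \<in> l2 V" and g: "g \<in> l2 V" and \<phi>: "bdd_borel a \<phi>"
  shows "fam.ip f (A g) \<phi> = fam.ip f g (\<lambda>t. \<phi> t * t)"
proof (rule spectral_functional_eq_if_indicator[OF _ _ _ \<phi>])
  show "spectral_functional a (fam.ip f (A g))"
    by (intro fam.ip_functional A_l2 f g)
  show "spectral_functional a (\<lambda>\<phi>. fam.ip f g (\<lambda>t. \<phi> t * t))"
    by (rule spectral_functional_weight[OF fam.ip_functional]) (auto simp: f g)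
  fix B :: "real set" assume B: "B \<in> sets borel"
  have "fam.ip f (A g) (indicator B) = l2_inner (A (Q B f)) g"
    by (simp add: ip_indicator B f g A_l2 Q_l2 A_sym)
  also have "\<dots> = fam.ip f g (\<lambda>t. t * indicator B t)"
    by (simp add: ip_id[symmetric] Q_l2 ip_Q B f g)
  finally show "fam.ip f (A g) (indicator B) = fam.ip f g (\<lambda>t. indicator B t * t)"
    by (simp add: mult.commute)
qed

lemma ip_power:
  "f \<in> l2 V \<Longrightarrow> g \<in> l2 V \<Longrightarrow> fam.ip f g (\<lambda>t. t ^ k) = l2_inner ((A ^^ k) f) g"
proof (induction k arbitrary: f g)
  case 0
  have "(\<lambda>t. t ^ 0) = (indicator UNIV :: real \<Rightarrow> real)"
    by (simp add: fun_eq_iff)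
  then have "fam.ip f g (\<lambda>t. t ^ 0) = l2_inner (Q UNIV f) g"
    using ip_indicator[OF _ 0, of UNIV] by simp
  also have "Q UNIV f = Q UNIV (Q {-a<..<a} f)"
    using full[OF 0(1)] by simp
  also have "\<dots> = f"
    using Q_Int[of UNIV "{-a<..<a}", OF _ _ 0(1)] full[OF 0(1)] by simp
  finally show ?case by simp
next
  case (Suc k)
  have "fam.ip f g (\<lambda>t. t ^ Suc k) = fam.ip f (A g) (\<lambda>t. t ^ k)"
    using Suc.prems by (simp add: ip_A mult.commute)
  also have "\<dots> = l2_inner ((A ^^ k) f) (A g)" using Suc by (simp add: A_l2)
  also have "\<dots> = l2_inner ((A ^^ Suc k) f) g" using Suc.prems by (simp add: A_sym pow_l2)
  finally show ?case .
qed

sublocale fam: moment_family V a "scalar_measure Q" A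
proof
  fix f k assume f: "f \<in> l2 V"
  interpret interval_measure "scalar_measure Q f" a by (rule interval_scalar[OF f])
  have "fam.ip f f (\<lambda>t. t ^ k) = of_real (\<integral>t. t ^ k \<partial>scalar_measure Q f)"
  proof (rule spectral_functional_eq_if_indicator[OF fam.ip_functional[OF f f] fam.N_functional[OF f]])
    show "fam.ip f f (indicator B) = of_real (\<integral>t. indicator B t \<partial>scalar_measure Q f)"
      if B: "B \<in> sets borel" for B
      using B by (simp add: ip_indicator[OF B f f] Q_inner_self[OF B f] measure_scalar[OF B f])
  qed simp
  then show "complex_of_real (\<integral>t. t ^ k \<partial>scalar_measure Q f) = l2_inner ((A ^^ k) f) f"
    using ip_power[OF f f, of k] by simp
qed

text \<open>On the set \<open>{x}\<close> the functions t and x coincide, so every value of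
  \<open>Q {x}\<close> is an eigenfunction for x. These are the eigenfunctions whose restrictions
  are counted on the finite subgraphs.\<close>

lemma A_atom: "f \<in> l2 V \<Longrightarrow> A (Q {x} f) = (\<lambda>v. of_real x * Q {x} f v)"
proof -
  assume f: "f \<in> l2 V"
  show ?thesis
  proof (rule l2_eqI[where V = V])
    fix g assume g: "g \<in> l2 V"
    have "l2_inner (A (Q {x} f)) g = fam.ip f g (\<lambda>t. t * indicator {x} t)"
      by (simp add: ip_id[symmetric] Q_l2 ip_Q f g)
    also have "(\<lambda>t. t * indicator {x} t) = (\<lambda>t. x * indicator {x} t)"
      by (auto simp: indicator_def)
    also have "fam.ip f g \<dots> = of_real x * fam.ip f g (indicator {x})"
      by (rule spectral_functional_cmult[OF fam.ip_functional[OF f g]]) simp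
    also have "\<dots> = l2_inner (\<lambda>v. of_real x * Q {x} f v) g"
      by (simp add: ip_indicator f g l2_inner_scale_left)
    finally show "l2_inner (A (Q {x} f)) g = l2_inner (\<lambda>v. of_real x * Q {x} f v) g" .
  qed (auto intro!: A_l2 Q_l2 l2_scale f)
qed

lemma scalar_eq:
  assumes "B \<in> sets borel" "f \<in> l2 V"
  shows "Re (l2_inner (Q B f) f) = measure (scalar_measure Q f) B"
  using assms by (simp add: measure_scalar Q_inner_self)

end

section \<open>Self-adjoint operators on functions on a finite set\<close>

text \<open>Gaussian elimination, with arbitrary index types for equations and unknowns, so that
  later the equations may be indexed by a disjoint sum. An equation with a nonzero coefficient at
  \<open>p\<close> is solved for the unknown \<open>p\<close> and substituted into the
  others.\<close>

lemma underdetermined_system: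
  fixes c :: "'e \<Rightarrow> 'j \<Rightarrow> complex"
  assumes "finite E" "finite J" "card E < card J"
  shows "\<exists>x. (\<exists>j\<in>J. x j \<noteq> 0) \<and> (\<forall>e\<in>E. (\<Sum>j\<in>J. c e j * x j) = 0)"
  using assms
proof (induction E arbitrary: J c rule: finite_induct)
  case empty
  then obtain j where "j \<in> J" by fastforce
  then show ?case by (auto intro!: exI[of _ "\<lambda>_. 1"])
next
  case (insert e E)
  show ?case
  proof (cases "\<forall>j\<in>J. c e j = 0")
    case True
    have "\<exists>x. (\<exists>j\<in>J. x j \<noteq> 0) \<and> (\<forall>e\<in>E. (\<Sum>j\<in>J. c e j * x j) = 0)"
      by (rule insert.IH) (use insert in auto)
    then show ?thesis using True by auto
  next
    case False
    then obtain p where p: "p \<in> J" "c e p \<noteq> 0" by auto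
    let ?J = "J - {p}" and ?c = "\<lambda>d j. c d j - c d p * (c e j / c e p)"
    have "card E < card ?J" using insert.prems insert.hyps p by simp
    then obtain x where x: "\<exists>j\<in>?J. x j \<noteq> 0" "\<forall>d\<in>E. (\<Sum>j\<in>?J. ?c d j * x j) = 0"
      using insert.IH[of ?J ?c] insert.prems by auto
    define s where "s = (\<Sum>j\<in>?J. (c e j / c e p) * x j)"
    define y where "y = x(p := - s)"
    have y: "(\<Sum>j\<in>J. c d j * y j) = (\<Sum>j\<in>?J. c d j * x j) - c d p * s" for d
    proof -
      have "(\<Sum>j\<in>J. c d j * y j) = c d p * y p + (\<Sum>j\<in>?J. c d j * y j)"
        using p insert.prems by (intro sum.remove)
      also have "(\<Sum>j\<in>?J. c d j * y j) = (\<Sum>j\<in>?J. c d j * x j)"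
        by (intro sum.cong) (auto simp: y_def)
      finally show ?thesis by (simp add: y_def)
    qed
    have "(\<Sum>j\<in>J. c e j * y j) = 0"
      unfolding y s_def sum_distrib_left using p by (simp add: sum_subtractf[symmetric])
    moreover have "(\<Sum>j\<in>J. c d j * y j) = 0" if "d \<in> E" for d
    proof -
      have "(\<Sum>j\<in>?J. c d j * x j) - c d p * s = (\<Sum>j\<in>?J. ?c d j * x j)"
        unfolding s_def sum_distrib_left by (simp add: sum_subtractf[symmetric] algebra_simps)
      then show ?thesis using x that by (simp add: y)
    qed
    moreover have "\<exists>j\<in>J. y j \<noteq> 0" using x by (auto simp: y_def)
    ultimately show ?thesis by auto
  qed
qed

section \<open>Orthonormal families\<close>

definition orthonormal :: "'i set \<Rightarrow> ('i \<Rightarrow> 'v \<Rightarrow> complex) \<Rightarrow> bool" where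
  "orthonormal I u \<longleftrightarrow> (\<forall>i\<in>I. \<forall>j\<in>I. l2_inner (u i) (u j) = (if i = j then 1 else 0))"

lemma orthonormal_coeff:
  assumes "orthonormal I u" "finite I" "\<And>i. i \<in> I \<Longrightarrow> u i \<in> l2 V" "j \<in> I"
  shows "l2_inner (\<lambda>v. \<Sum>i\<in>I. c i * u i v) (u j) = c j"
proof -
  have "l2_inner (\<lambda>v. \<Sum>i\<in>I. c i * u i v) (u j) = (\<Sum>i\<in>I. c i * l2_inner (u i) (u j))"
    by (rule l2_inner_sum_left[where V = V]) (use assms in auto)
  also have "\<dots> = (\<Sum>i\<in>I. if i = j then c i else 0)"
    using assms by (intro sum.cong) (auto simp: orthonormal_def)
  also have "\<dots> = c j"
    using assms by (simp add: sum.delta)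
  finally show ?thesis .
qed

lemma orthonormal_inj: "orthonormal I u \<Longrightarrow> inj_on u I"
  unfolding orthonormal_def inj_on_def by (metis one_neq_zero)

lemma sum_fun_apply: "(\<Sum>i\<in>I. f i) x = (\<Sum>i\<in>I. f i x)"
  by (induction I rule: infinite_finite_induct) auto

lemma dim_span_orthonormal:
  fixes u :: "'i \<Rightarrow> 'v \<Rightarrow> complex"
  assumes u: "orthonormal I u" and fin: "finite I" and l2: "\<And>i. i \<in> I \<Longrightarrow> u i \<in> l2 V"
    and S: "S = {\<lambda>v. \<Sum>i\<in>I. c i * u i v |c. True}"
  shows "vector_space.dim scale_fun S = card I"
proof -
  interpret fs: vector_space "scale_fun :: complex \<Rightarrow> ('v \<Rightarrow> complex) \<Rightarrow> 'v \<Rightarrow> complex"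
    by (rule vector_space_scale_fun)
  have inj: "inj_on u I" by (rule orthonormal_inj[OF u])
  show ?thesis
  proof (rule fs.dim_unique)
    show "u ` I \<subseteq> S"
    proof
      fix f assume "f \<in> u ` I"
      then obtain i where i: "i \<in> I" "f = u i" by auto
      have "(\<lambda>v. \<Sum>j\<in>I. (if j = i then 1 else 0) * u j v) = f"
        using i fin by (simp add: fun_eq_iff if_distrib[of "\<lambda>x. x * _"] sum.delta cong: if_cong)
      from this[symmetric] show "f \<in> S" unfolding S by (intro CollectI exI conjI TrueI)
    qed
    show "S \<subseteq> fs.span (u ` I)"
    proof
      fix f assume "f \<in> S"
      then obtain c where "f = (\<lambda>v. \<Sum>i\<in>I. c i * u i v)" unfolding S by blast
      then have "f = (\<Sum>i\<in>I. scale_fun (c i) (u i))" by (simp add: fun_eq_iff sum_fun_apply)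
      also have "\<dots> \<in> fs.span (u ` I)"
        by (intro fs.span_sum fs.span_scale fs.span_base) auto
      finally show "f \<in> fs.span (u ` I)" .
    qed
    show "fs.independent (u ` I)"
      unfolding fs.dependent_finite[OF finite_imageI[OF fin]]
    proof (rule notI, elim exE conjE bexE imageE)
      fix c f i assume 0: "(\<Sum>f\<in>u ` I. scale_fun (c f) f) = 0" and i: "i \<in> I"
        and nz: "c f \<noteq> 0" "f = u i"
      have "(\<lambda>v. \<Sum>j\<in>I. c (u j) * u j v) = (\<Sum>f\<in>u ` I. scale_fun (c f) f)"
        by (subst sum.reindex[OF inj]) (simp add: fun_eq_iff sum_fun_apply)
      then have "(\<lambda>v. \<Sum>j\<in>I. c (u j) * u j v) = (\<lambda>_. 0)"
        using 0 by (simp add: fun_eq_iff)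
      then show False
        using orthonormal_coeff[OF u fin l2 i, of "\<lambda>j. c (u j)"] nz by simp
    qed
    show "card (u ` I) = card I" by (rule card_image[OF inj])
  qed
qed

text \<open>A nonzero residual \<open>g\<close> would extend the family to more pairwise orthogonal
  nonzero functions than there are points. A linear relation among them exists by counting, and
  pairing it with each member kills every coefficient.\<close>

lemma orthonormal_complete:
  assumes W: "finite W" and u: "orthonormal {..<card W} u"
    and l2: "\<And>i. i < card W \<Longrightarrow> u i \<in> l2 W" and f: "f \<in> l2 W"
  shows "f = (\<lambda>v. \<Sum>i<card W. l2_inner f (u i) * u i v)"
proof (rule ccontr)
  let ?n = "card W"
  define p where "p = (\<lambda>v. \<Sum>i<?n. l2_inner f (u i) * u i v)"
  define g where "g = (\<lambda>v. f v - p v)"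
  assume "f \<noteq> (\<lambda>v. \<Sum>i<card W. l2_inner f (u i) * u i v)"
  then have g0: "g \<noteq> (\<lambda>_. 0)" by (auto simp: g_def p_def fun_eq_iff)
  have p: "p \<in> l2 W" unfolding p_def by (intro l2_sum l2) auto
  have g: "g \<in> l2 W" unfolding g_def by (intro l2_diff f p)
  have gu: "l2_inner g (u i) = 0" if "i < ?n" for i
    unfolding g_def using l2_inner_diff_left[OF f p l2[OF that]] orthonormal_coeff[OF u, of W i "\<lambda>i. l2_inner f (u i)"] l2 that
    by (simp add: p_def)
  define y where "y j = (if j < ?n then u j else g)" for j
  have "\<exists>x. (\<exists>j\<in>{..?n}. x j \<noteq> 0) \<and> (\<forall>w\<in>W. (\<Sum>j\<le>?n. y j w * x j) = 0)"
    by (rule underdetermined_system) (use W in auto)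
  then obtain x where x: "\<exists>j\<in>{..?n}. x j \<noteq> 0" and xs: "\<And>w. w \<in> W \<Longrightarrow> (\<Sum>j\<le>?n. y j w * x j) = 0"
    by blast
  have yl2: "y j \<in> l2 W" for j by (simp add: y_def l2 g)
  have z: "(\<lambda>w. \<Sum>j\<le>?n. x j * y j w) = (\<lambda>_. 0)"
  proof
    fix w show "(\<Sum>j\<le>?n. x j * y j w) = 0"
      using xs[of w] l2_outside[OF yl2] by (cases "w \<in> W") (auto simp: mult.commute)
  qed
  have inner: "(\<Sum>j\<le>?n. x j * l2_inner (y j) h) = 0" if "h \<in> l2 W" for h
    using l2_inner_sum_left[of "{..?n}" y W h x] yl2 that z by simp
  have xi: "x i = 0" if "i < ?n" for i
  proof -
    have "(\<Sum>j\<le>?n. x j * l2_inner (y j) (u i)) = (\<Sum>j\<le>?n. if j = i then x j else 0)"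
      using u gu that by (intro sum.cong) (auto simp: y_def orthonormal_def)
    then show ?thesis using inner[OF l2[OF that]] that by (simp add: sum.delta)
  qed
  have "(\<Sum>j\<le>?n. x j * l2_inner (y j) g) = (\<Sum>j\<le>?n. if j = ?n then x j * l2_inner g g else 0)"
    by (intro sum.cong) (auto simp: xi y_def)
  then have "x ?n * l2_inner g g = 0" using inner[OF g] by (simp add: sum.delta)
  moreover have "l2_inner g g \<noteq> 0"
    using l2_norm_eq_0[OF g] g0 by (auto simp: l2_inner_self[OF g])
  ultimately have "x ?n = 0" by simp
  then show False using x xi by (metis atMost_iff le_neq_implies_less)
qed

section \<open>Diagonalisation on a finite vertex set\<close>

locale finite_selfadjoint = l2_selfadjoint W A for W :: "'v set" and A +
  assumes finite_W: "finite W"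
begin

text \<open>With a root z of \<open>p\<close> split off, either (A - z) f = 0 and \<open>f\<close>
  is the eigenvector, or (A - z) f is a nonzero element of \<open>N\<close> annihilated by the
  quotient polynomial. \<open>N\<close> is kept general so that the eigenvector can be found in an
  orthogonal complement.\<close>

lemma poly_eigenvector:
  fixes p :: "complex poly"
  assumes N: "\<And>f. f \<in> N \<Longrightarrow> f \<in> l2 W" "\<And>f z. f \<in> N \<Longrightarrow> (\<lambda>v. A f v - z * f v) \<in> N"
    and f: "f \<in> N" "f \<noteq> (\<lambda>_. 0)" and p: "p \<noteq> 0"
    and pf: "\<And>v. (\<Sum>i\<le>degree p. coeff p i * (A ^^ i) f v) = 0"
  shows "\<exists>g\<in>N. g \<noteq> (\<lambda>_. 0) \<and> (\<exists>z. A g = (\<lambda>v. z * g v))"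
  using f p pf
proof (induction "degree p" arbitrary: p f)
  case 0
  then have "coeff p 0 \<noteq> 0" by (metis leading_coeff_neq_0)
  then show ?case using 0 by (auto simp: fun_eq_iff)
next
  case (Suc d)
  have "\<not> constant (poly p)" using Suc.hyps(2) by (simp add: constant_degree)
  then obtain z where "poly p z = 0" using fundamental_theorem_of_algebra by blast
  then obtain r where r: "p = [:-z, 1:] * r" by (metis poly_eq_0_iff_dvd dvdE)
  have r0: "r \<noteq> 0" using r Suc.prems by auto
  have dr: "degree p = Suc (degree r)" unfolding r using r0 by (subst degree_mult_eq) auto
  define h where "h = (\<lambda>v. A f v - z * f v)"
  have f: "f \<in> l2 W" using N Suc.prems by auto
  have hN: "h \<in> N" unfolding h_def using N Suc.prems by auto
  show ?case
  proof (cases "h = (\<lambda>_. 0)")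
    case True
    then have "A f = (\<lambda>v. z * f v)" by (auto simp: h_def fun_eq_iff)
    then show ?thesis using Suc.prems by blast
  next
    case False
    have Ah: "(A ^^ i) h v = (A ^^ Suc i) f v - z * (A ^^ i) f v" for i v
      using pow_lin[OF A_l2[OF f] f, of i 1 "-z"] by (simp add: h_def funpow_swap1)
    show ?thesis
    proof (rule Suc.hyps(1)[OF _ hN False r0])
      show "d = degree r" using dr Suc.hyps(2) by simp
      fix v
      have c: "coeff p i = (case i of 0 \<Rightarrow> 0 | Suc j \<Rightarrow> coeff r j) - z * coeff r i" for i
        unfolding r by (simp add: coeff_pCons split: nat.split)
      have "0 = (\<Sum>i\<le>Suc (degree r). coeff p i * (A ^^ i) f v)"
        using Suc.prems(4)[of v] dr by simp
      also have "\<dots> = (\<Sum>i\<le>Suc (degree r). (case i of 0 \<Rightarrow> 0 | Suc j \<Rightarrow> coeff r j) * (A ^^ i) f v)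
          - (\<Sum>i\<le>Suc (degree r). z * coeff r i * (A ^^ i) f v)"
        by (simp only: c left_diff_distrib sum_subtractf)
      also have "(\<Sum>i\<le>Suc (degree r). (case i of 0 \<Rightarrow> 0 | Suc j \<Rightarrow> coeff r j) * (A ^^ i) f v)
          = (\<Sum>i\<le>degree r. coeff r i * (A ^^ Suc i) f v)"
        by (subst sum.atMost_Suc_shift) simp
      also have "(\<Sum>i\<le>Suc (degree r). z * coeff r i * (A ^^ i) f v)
          = (\<Sum>i\<le>degree r. z * coeff r i * (A ^^ i) f v)"
        by (simp add: coeff_eq_0)
      also have "(\<Sum>i\<le>degree r. coeff r i * (A ^^ Suc i) f v) - \<dots> = (\<Sum>i\<le>degree r. coeff r i * (A ^^ i) h v)"
        unfolding Ah by (simp add: sum_subtractf[symmetric] algebra_simps)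
      finally show "(\<Sum>i\<le>degree r. coeff r i * (A ^^ i) h v) = 0" by simp
    qed
  qed
qed

text \<open>The iterates of \<open>f\<close> up to exponent \<open>card W\<close> are one more than
  the number of points, hence dependent; the relation is the polynomial needed for
  \<open>poly_eigenvector\<close>. Symmetry makes the eigenvalue real.\<close>

lemma eigenvector_exists:
  assumes N: "\<And>f. f \<in> N \<Longrightarrow> f \<in> l2 W" "\<And>f z. f \<in> N \<Longrightarrow> (\<lambda>v. A f v - z * f v) \<in> N"
    and f: "f \<in> N" "f \<noteq> (\<lambda>_. 0)"
  shows "\<exists>g\<in>N. g \<noteq> (\<lambda>_. 0) \<and> (\<exists>x. A g = (\<lambda>v. of_real x * g v))"
proof -
  have fl2: "f \<in> l2 W" using N f by auto
  have "\<exists>x. (\<exists>j\<in>{..card W}. x j \<noteq> 0) \<and> (\<forall>w\<in>W. (\<Sum>j\<le>card W. (A ^^ j) f w * x j) = 0)"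
    by (rule underdetermined_system) (use finite_W in auto)
  then obtain x where x: "\<exists>j\<in>{..card W}. x j \<noteq> 0" and xs: "\<And>w. w \<in> W \<Longrightarrow> (\<Sum>j\<le>card W. (A ^^ j) f w * x j) = 0"
    by blast
  define p where "p = (\<Sum>j\<le>card W. monom (x j) j)"
  have cp: "coeff p i = (if i \<le> card W then x i else 0)" for i
    by (simp add: p_def coeff_sum sum.delta' if_distrib cong: if_cong)
  have "p \<noteq> 0"
    using x cp by (metis atMost_iff coeff_0)
  have dp: "degree p \<le> card W"
    by (rule degree_le) (simp add: cp)
  have "(\<Sum>i\<le>degree p. coeff p i * (A ^^ i) f v) = 0" for v
  proof -
    have "(\<Sum>i\<le>degree p. coeff p i * (A ^^ i) f v) = (\<Sum>i\<le>card W. coeff p i * (A ^^ i) f v)"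
      using dp by (intro sum.mono_neutral_left) (auto simp: coeff_eq_0)
    also have "\<dots> = (\<Sum>i\<le>card W. (A ^^ i) f v * x i)"
      by (intro sum.cong) (auto simp: cp)
    also have "\<dots> = 0"
      using xs[of v] l2_outside[OF pow_l2[OF fl2], of v] by (cases "v \<in> W") auto
    finally show ?thesis .
  qed
  then obtain g z where g: "g \<in> N" "g \<noteq> (\<lambda>_. 0)" "A g = (\<lambda>v. z * g v)"
    using poly_eigenvector[OF N f \<open>p \<noteq> 0\<close>] by blast
  have gl2: "g \<in> l2 W" using N g by auto
  have nz: "l2_norm g \<noteq> 0" using l2_norm_eq_0[OF gl2] g by auto
  have "z * of_real ((l2_norm g)\<^sup>2) = of_real (Re (l2_inner (A g) g))"
    using quadratic_real[OF gl2] by (simp add: g(3) l2_inner_scale_left l2_inner_self[OF gl2])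
  then have "z = of_real (Re (l2_inner (A g) g) / (l2_norm g)\<^sup>2)"
    using nz by (simp add: field_simps)
  then show ?thesis using g by blast
qed

definition eigenbasis :: "(nat \<Rightarrow> 'v \<Rightarrow> complex) \<Rightarrow> (nat \<Rightarrow> real) \<Rightarrow> bool" where
  "eigenbasis u \<mu> \<longleftrightarrow> orthonormal {..<card W} u \<and>
    (\<forall>i<card W. u i \<in> l2 W \<and> A (u i) = (\<lambda>v. of_real (\<mu> i) * u i v))"

theorem eigenbasis_exists: "\<exists>u \<mu>. eigenbasis u \<mu>"
proof -
  have "\<exists>u \<mu>. orthonormal {..<k} u \<and> (\<forall>i<k. u i \<in> l2 W \<and> A (u i) = (\<lambda>v. of_real (\<mu> i) * u i v))"
    if "k \<le> card W" for k
    using that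
  proof (induction k)
    case 0
    then show ?case by (simp add: orthonormal_def)
  next
    case (Suc k)
    then obtain u and \<mu> :: "nat \<Rightarrow> real" where u: "orthonormal {..<k} u" "\<And>i. i < k \<Longrightarrow> u i \<in> l2 W"
      and \<mu>: "\<And>i. i < k \<Longrightarrow> A (u i) = (\<lambda>v. of_real (\<mu> i) * u i v)" by auto
    \<comment> \<open>The orthogonal complement of the eigenvectors found so far: invariant by
      symmetry, and nonzero because \<open>k\<close> linear conditions cannot exhaust
      \<open>card W\<close> dimensions.\<close>
    define N where "N = {f \<in> l2 W. \<forall>i<k. l2_inner f (u i) = 0}"
    have "\<exists>x. (\<exists>w\<in>W. x w \<noteq> 0) \<and> (\<forall>i\<in>{..<k}. (\<Sum>w\<in>W. cnj (u i w) * x w) = 0)"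
      by (rule underdetermined_system) (use Suc.prems finite_W in auto)
    then obtain x where x: "\<exists>w\<in>W. x w \<noteq> 0" "\<And>i. i < k \<Longrightarrow> (\<Sum>w\<in>W. cnj (u i w) * x w) = 0"
      by blast
    define f where "f = restrict_support W x"
    have fl2: "f \<in> l2 W" by (simp add: l2_finite[OF finite_W] f_def restrict_support_def)
    have "l2_inner f (u i) = 0" if "i < k" for i
    proof -
      have "l2_inner f (u i) = (\<Sum>w\<in>W. f w * cnj (u i w))"
        by (rule l2_inner_finite[OF finite_W]) (simp add: f_def restrict_support_def)
      also have "\<dots> = (\<Sum>w\<in>W. cnj (u i w) * x w)"
        by (intro sum.cong) (auto simp: f_def restrict_support_def)
      finally show ?thesis using x(2)[OF that] by simp
    qed
    then have fN: "f \<in> N" using fl2 by (simp add: N_def)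
    have f0: "f \<noteq> (\<lambda>_. 0)" using x(1) by (auto simp: f_def restrict_support_def fun_eq_iff)
    have inv: "(\<lambda>v. A g v - z * g v) \<in> N" if "g \<in> N" for g z
    proof -
      have g: "g \<in> l2 W" using that by (simp add: N_def)
      have "l2_inner (\<lambda>v. A g v - z * g v) (u i) = 0" if "i < k" for i
        using l2_inner_diff_left[OF A_l2[OF g] l2_scale[OF g] u(2)[OF that], of z] \<open>g \<in> N\<close> that
          A_sym[OF g u(2)[OF that]]
        by (simp add: l2_inner_scale_left l2_inner_scale_right N_def \<mu>)
      then show ?thesis using g by (simp add: N_def l2_diff A_l2 l2_scale)
    qed
    obtain g m where g: "g \<in> N" "g \<noteq> (\<lambda>_. 0)" "A g = (\<lambda>v. of_real m * g v)"
      using eigenvector_exists[of N f, OF _ inv fN f0] by (auto simp: N_def)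
    have gl2: "g \<in> l2 W" using g by (simp add: N_def)
    define r where "r = l2_norm g"
    have r: "r > 0" using l2_norm_eq_0[OF gl2] g l2_norm_nonneg[of g] unfolding r_def by linarith
    define e where "e = (\<lambda>v. of_real (1 / r) * g v)"
    have el2: "e \<in> l2 W" unfolding e_def by (rule l2_scale[OF gl2])
    have ee: "l2_inner e e = 1"
      unfolding e_def l2_inner_scale_left l2_inner_scale_right l2_inner_self[OF gl2]
      using r by (simp add: r_def[symmetric] power2_eq_square)
    have eu: "l2_inner e (u i) = 0" "l2_inner (u i) e = 0" if "i < k" for i
    proof -
      show "l2_inner e (u i) = 0"
        unfolding e_def l2_inner_scale_left using g(1) that by (simp add: N_def)
      then show "l2_inner (u i) e = 0"
        using l2_inner_commute[of "u i" e] by simp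
    qed
    have Ae: "A e = (\<lambda>v. of_real m * e v)"
      using A_lin[OF gl2 gl2, of "of_real (1 / r)" 0] g by (simp add: e_def fun_eq_iff)
    show ?case
    proof (intro exI conjI allI impI)
      show "orthonormal {..<Suc k} (u(k := e))"
        using u ee eu by (auto simp: orthonormal_def less_Suc_eq)
      show "(u(k := e)) i \<in> l2 W" if "i < Suc k" for i
        using that u el2 by (auto simp: less_Suc_eq)
      show "A ((u(k := e)) i) = (\<lambda>v. of_real ((\<mu>(k := m)) i) * (u(k := e)) i v)" if "i < Suc k" for i
        using that \<mu> Ae by (auto simp: less_Suc_eq)
    qed
  qed
  from this[of "card W"] show ?thesis by (simp add: eigenbasis_def)
qed

context
  fixes u \<mu>
  assumes eb: "eigenbasis u \<mu>"
begin

lemma eb_l2: "i < card W \<Longrightarrow> u i \<in> l2 W"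
  and eb_eigen: "i < card W \<Longrightarrow> A (u i) = (\<lambda>v. of_real (\<mu> i) * u i v)"
  and eb_on: "orthonormal {..<card W} u"
  using eb by (auto simp: eigenbasis_def)

lemma eb_expand: "f \<in> l2 W \<Longrightarrow> f = (\<lambda>v. \<Sum>i<card W. l2_inner f (u i) * u i v)"
  by (rule orthonormal_complete[OF finite_W eb_on eb_l2])

lemma eb_nonzero: "i < card W \<Longrightarrow> u i \<noteq> (\<lambda>_. 0)"
proof
  assume "i < card W" "u i = (\<lambda>_. 0)"
  moreover from this have "l2_inner (u i) (u i) = 1"
    using eb_on unfolding orthonormal_def by (metis lessThan_iff)
  ultimately show False by simp
qed

lemma eigen_coeff:
  assumes f: "f \<in> l2 W" and Af: "A f = (\<lambda>v. of_real x * f v)" and i: "i < card W" "\<mu> i \<noteq> x"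
  shows "l2_inner f (u i) = 0"
  using A_sym[OF f eb_l2[OF i(1)]] i by (simp add: Af eb_eigen l2_inner_scale_left l2_inner_scale_right)

lemma eigenspace_eq:
  "eigenspace W A x = {\<lambda>v. \<Sum>i\<in>{i. i < card W \<and> \<mu> i = x}. c i * u i v |c. True}"
proof (intro equalityI subsetI)
  fix f assume "f \<in> eigenspace W A x"
  then have f: "f \<in> l2 W" and Af: "A f = (\<lambda>v. of_real x * f v)"
    by (auto simp: eigenspace_def l2_finite[OF finite_W])
  have "f = (\<lambda>v. \<Sum>i<card W. l2_inner f (u i) * u i v)" by (rule eb_expand[OF f])
  also have "\<dots> = (\<lambda>v. \<Sum>i\<in>{i. i < card W \<and> \<mu> i = x}. l2_inner f (u i) * u i v)"
    by (intro ext sum.mono_neutral_right) (auto simp: eigen_coeff[OF f Af])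
  finally show "f \<in> {\<lambda>v. \<Sum>i\<in>{i. i < card W \<and> \<mu> i = x}. c i * u i v |c. True}"
    by (intro CollectI exI conjI TrueI)
next
  fix f assume "f \<in> {\<lambda>v. \<Sum>i\<in>{i. i < card W \<and> \<mu> i = x}. c i * u i v |c. True}"
  then obtain c where f: "f = (\<lambda>v. \<Sum>i\<in>{i. i < card W \<and> \<mu> i = x}. c i * u i v)" by blast
  have fl2: "f \<in> l2 W" unfolding f by (rule l2_sum) (auto simp: eb_l2)
  have "A f = (\<lambda>v. \<Sum>i\<in>{i. i < card W \<and> \<mu> i = x}. c i * A (u i) v)"
    unfolding f by (rule A_sum) (auto simp: eb_l2)
  also have "\<dots> = (\<lambda>v. of_real x * f v)"
    unfolding f sum_distrib_left by (intro ext sum.cong) (auto simp: eb_eigen)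
  finally show "f \<in> eigenspace W A x"
    using fl2 by (simp add: eigenspace_def l2_finite[OF finite_W])
qed

lemma dim_eigenspace: "vector_space.dim scale_fun (eigenspace W A x) = card {i. i < card W \<and> \<mu> i = x}"
proof (rule dim_span_orthonormal[OF _ _ _ eigenspace_eq, where V = W])
  show "orthonormal {i. i < card W \<and> \<mu> i = x} u" using eb_on by (auto simp: orthonormal_def)
qed (auto simp: eb_l2)

lemma eigenvalue_count_eq: "eigenvalue_count W A x = card {i. i < card W \<and> \<mu> i \<le> x}"
proof -
  let ?I = "{i. i < card W \<and> \<mu> i \<le> x}"
  have eq: "{m. m \<le> x \<and> (\<exists>f\<in>eigenspace W A m. f \<noteq> (\<lambda>_. 0))} = \<mu> ` ?I"
  proof (intro equalityI subsetI)
    fix m assume "m \<in> {m. m \<le> x \<and> (\<exists>f\<in>eigenspace W A m. f \<noteq> (\<lambda>_. 0))}"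
    then obtain f where m: "m \<le> x" and f: "f \<in> eigenspace W A m" "f \<noteq> (\<lambda>_. 0)" by blast
    have "{i. i < card W \<and> \<mu> i = m} \<noteq> {}"
    proof
      assume e: "{i. i < card W \<and> \<mu> i = m} = {}"
      show False using f unfolding eigenspace_eq e by auto
    qed
    then show "m \<in> \<mu> ` ?I" using m by auto
  next
    fix m assume "m \<in> \<mu> ` ?I"
    then obtain i where i: "i < card W" "\<mu> i \<le> x" "m = \<mu> i" by auto
    have "u i \<in> eigenspace W A m"
      using i eb_l2[OF i(1)] by (simp add: eigenspace_def l2_finite[OF finite_W] eb_eigen)
    then show "m \<in> {m. m \<le> x \<and> (\<exists>f\<in>eigenspace W A m. f \<noteq> (\<lambda>_. 0))}"
      using i eb_nonzero by auto
  qed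
  have "eigenvalue_count W A x = (\<Sum>m\<in>\<mu> ` ?I. card {i. i < card W \<and> \<mu> i = m})"
    unfolding eigenvalue_count_def eq dim_eigenspace ..
  also have "\<dots> = (\<Sum>m\<in>\<mu> ` ?I. card {i \<in> ?I. \<mu> i = m})"
    by (intro sum.cong arg_cong[of _ _ card]) auto
  also have "\<dots> = card ?I"
    using sum.image_gen[of ?I "\<lambda>_. 1 :: nat" \<mu>] by simp
  finally show ?thesis .
qed

lemma trace_power: "(\<Sum>v\<in>W. (A ^^ k) (delta v) v) = of_real (\<Sum>i<card W. \<mu> i ^ k)"
proof -
  have Ak: "(A ^^ k) (u i) = (\<lambda>v. of_real (\<mu> i ^ k) * u i v)" if i: "i < card W" for i
  proof (induction k)
    case (Suc k)
    have "A (\<lambda>v. of_real (\<mu> i ^ k) * u i v + 0 * u i v) = (\<lambda>v. of_real (\<mu> i ^ k) * A (u i) v + 0 * A (u i) v)"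
      by (intro A_lin eb_l2 i)
    then show ?case using Suc i by (simp add: eb_eigen mult_ac)
  qed simp
  have d: "(A ^^ k) (delta v) v = (\<Sum>i<card W. of_real (\<mu> i ^ k) * (u i v * cnj (u i v)))" if v: "v \<in> W" for v
  proof -
    have "l2_inner (delta v) (u i) = cnj (u i v)" for i
      using l2_inner_commute[of "delta v" "u i"] by simp
    then have "delta v = (\<lambda>w. \<Sum>i<card W. cnj (u i v) * u i w)"
      using eb_expand[OF l2_delta[OF v]] by simp
    then have "(A ^^ k) (delta v) = (A ^^ k) (\<lambda>w. \<Sum>i<card W. cnj (u i v) * u i w)" by simp
    also have "\<dots> = (\<lambda>w. \<Sum>i<card W. cnj (u i v) * (A ^^ k) (u i) w)"
      by (rule l2_selfadjoint.A_sum[OF selfadjoint_pow]) (auto simp: eb_l2)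
    finally show ?thesis by (simp add: Ak mult_ac)
  qed
  have "(\<Sum>v\<in>W. (A ^^ k) (delta v) v) = (\<Sum>v\<in>W. \<Sum>i<card W. of_real (\<mu> i ^ k) * (u i v * cnj (u i v)))"
    by (simp add: d)
  also have "\<dots> = (\<Sum>i<card W. \<Sum>v\<in>W. of_real (\<mu> i ^ k) * (u i v * cnj (u i v)))"
    by (rule sum.swap)
  also have "\<dots> = (\<Sum>i<card W. of_real (\<mu> i ^ k) * l2_inner (u i) (u i))"
  proof (intro sum.cong refl)
    fix i assume "i \<in> {..<card W}"
    then have "l2_inner (u i) (u i) = (\<Sum>v\<in>W. u i v * cnj (u i v))"
      using l2_outside[OF eb_l2[of i]] by (intro l2_inner_finite finite_W) auto
    then show "(\<Sum>v\<in>W. of_real (\<mu> i ^ k) * (u i v * cnj (u i v))) = of_real (\<mu> i ^ k) * l2_inner (u i) (u i)"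
      by (simp add: sum_distrib_left)
  qed
  also have "\<dots> = of_real (\<Sum>i<card W. \<mu> i ^ k)"
    using eb_on by (simp add: orthonormal_def)
  finally show ?thesis .
qed

text \<open>The range of \<open>T\<close> consists of functions that satisfy the eigenvalue equation of \<open>A\<close> outside the
  set \<open>D\<close>; since \<open>0 \<le> T \<le> 1\<close>, its dimension is at least the trace of \<open>T\<close>, and imposing the equation
  on \<open>D\<close> costs at most \<open>card D\<close> dimensions.\<close>

lemma trace_le_eigenspace:
  assumes T: "l2_selfadjoint W T"
    and nonneg: "\<And>f. f \<in> l2 W \<Longrightarrow> 0 \<le> Re (l2_inner (T f) f)"
    and le1: "\<And>f. f \<in> l2 W \<Longrightarrow> Re (l2_inner (T f) f) \<le> (l2_norm f)\<^sup>2"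
    and D: "finite D" and eq: "\<And>f v. f \<in> l2 W \<Longrightarrow> v \<in> W - D \<Longrightarrow> A (T f) v = of_real x * T f v"
  shows "Re (\<Sum>v\<in>W. T (delta v) v) \<le> real (card {i. i < card W \<and> \<mu> i = x} + card D)"
proof -
  interpret T: finite_selfadjoint W T
    using T finite_W by (simp add: finite_selfadjoint_def finite_selfadjoint_axioms_def)
  obtain e \<tau> where et: "T.eigenbasis e \<tau>" using T.eigenbasis_exists by blast
  note e = T.eb_l2[OF et] T.eb_eigen[OF et] T.eb_on[OF et]
  define J where "J = {i. i < card W \<and> \<tau> i \<noteq> 0}"
  define M where "M = {i. i < card W \<and> \<mu> i = x}"
  have fin: "finite J" "finite M" by (auto simp: J_def M_def)
  have \<tau>: "\<tau> i \<le> 1" if i: "i < card W" for i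
  proof -
    have n: "(l2_norm (e i))\<^sup>2 = 1"
      using e(3) i l2_inner_self[OF e(1)[OF i]] unfolding orthonormal_def
      by (metis (no_types, lifting) lessThan_iff of_real_eq_1_iff)
    then show ?thesis
      using le1[OF e(1)[OF i]] by (simp add: e(2)[OF i] l2_inner_scale_left l2_inner_self[OF e(1)[OF i]])
  qed
  have "(\<Sum>v\<in>W. T (delta v) v) = of_real (\<Sum>i<card W. \<tau> i)"
    using T.trace_power[OF et, of 1] by simp
  then have "Re (\<Sum>v\<in>W. T (delta v) v) = (\<Sum>i<card W. \<tau> i)" by simp
  also have "\<dots> = (\<Sum>i\<in>J. \<tau> i)"
    unfolding J_def by (intro sum.mono_neutral_right) auto
  also have "\<dots> \<le> (\<Sum>i\<in>J. 1)"
    by (intro sum_mono \<tau>) (auto simp: J_def)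
  also have "\<dots> = real (card J)" by simp
  finally have tr: "Re (\<Sum>v\<in>W. T (delta v) v) \<le> real (card J)" .
  have "card J \<le> card M + card D"
  proof (rule ccontr)
    assume big: "\<not> card J \<le> card M + card D"
    \<comment> \<open>The conditions on a combination \<open>h\<close> of the eigenvectors of
      \<open>T\<close> with nonzero eigenvalue: orthogonality to each eigenvector of
      \<open>A\<close> for x (\<open>Inl\<close>), and the eigenvalue equation at each point of
      \<open>D\<close> (\<open>Inr\<close>). Such an \<open>h\<close> lies in the eigenspace for x
      and is orthogonal to it, hence vanishes.\<close>
    define c where "c q i = (case q of Inl j \<Rightarrow> l2_inner (e i) (u j) | Inr v \<Rightarrow> A (e i) v - of_real x * e i v)" for q i
    have "card (M <+> D) < card J" using big fin D by (simp add: card_Plus)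
    then obtain y where y: "\<exists>i\<in>J. y i \<noteq> 0" "\<And>q. q \<in> M <+> D \<Longrightarrow> (\<Sum>i\<in>J. c q i * y i) = 0"
      using underdetermined_system[of "M <+> D" J c] fin D by auto
    define h where "h = (\<lambda>v. \<Sum>i\<in>J. y i * e i v)"
    have eJ: "e i \<in> l2 W" if "i \<in> J" for i using that e by (auto simp: J_def)
    have h: "h \<in> l2 W" unfolding h_def by (intro l2_sum fin eJ)
    have onJ: "orthonormal J e" using e(3) by (auto simp: orthonormal_def J_def)
    have Ah: "A h = (\<lambda>v. \<Sum>i\<in>J. y i * A (e i) v)"
      unfolding h_def by (rule A_sum[OF fin(1) eJ])
    have "A h = (\<lambda>v. of_real x * h v)"
    proof
      fix v
      consider "v \<notin> W" | "v \<in> D" | "v \<in> W - D" by blast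
      then show "A h v = of_real x * h v"
      proof cases
        case 1
        then show ?thesis using l2_outside[OF h] l2_outside[OF A_l2[OF h]] by simp
      next
        case 2
        then have "(\<Sum>i\<in>J. (A (e i) v - of_real x * e i v) * y i) = 0"
          using y(2)[of "Inr v"] by (simp add: c_def InrI)
        then show ?thesis
          unfolding Ah unfolding h_def by (simp add: sum_subtractf algebra_simps sum_distrib_left)
      next
        case 3
        \<comment> \<open>Since \<open>\<tau> i\<close> is nonzero, \<open>e i\<close> is a multiple
          of \<open>T (e i)\<close> and inherits the equation valid on the range of
          \<open>T\<close>.\<close>
        have "A (e i) v = of_real x * e i v" if i: "i \<in> J" for i
        proof -
          have i': "i < card W" "\<tau> i \<noteq> 0" using i by (auto simp: J_def)
          have "of_real (\<tau> i) * A (e i) v = A (T (e i)) v"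
            using A_lin[OF e(1)[OF i'(1)] e(1)[OF i'(1)], of "of_real (\<tau> i)" 0] by (simp add: e(2)[OF i'(1)])
          also have "\<dots> = of_real x * (of_real (\<tau> i) * e i v)"
            using eq[OF e(1)[OF i'(1)] 3] by (simp add: e(2)[OF i'(1)])
          finally show ?thesis using i' by simp
        qed
        then show ?thesis unfolding Ah unfolding h_def by (simp add: sum_distrib_left mult_ac)
      qed
    qed
    then have "l2_inner h (u j) = 0" if "j < card W" "j \<notin> M" for j
      using eigen_coeff[OF h, of x j] that by (auto simp: M_def)
    moreover have "l2_inner h (u j) = 0" if j: "j \<in> M" for j
    proof -
      have "l2_inner h (u j) = (\<Sum>i\<in>J. y i * l2_inner (e i) (u j))"
        unfolding h_def by (rule l2_inner_sum_left[OF fin(1) eJ]) (use j eb_l2 in \<open>auto simp: M_def\<close>)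
      also have "\<dots> = 0"
        using y(2)[of "Inl j"] j by (simp add: c_def InlI mult.commute)
      finally show ?thesis .
    qed
    ultimately have "l2_inner h (u j) = 0" if "j < card W" for j using that by blast
    then have "h = (\<lambda>_. 0)" using eb_expand[OF h] by simp
    then show False
      using orthonormal_coeff[OF onJ fin(1) eJ, of _ y] y(1) by (auto simp: h_def)
  qed
  then show ?thesis using tr unfolding M_def by linarith
qed

end

end

section \<open>Magnetic operators\<close>

text \<open>With a conjugation-symmetric \<open>\<sigma>\<close>, one sum over all arcs into
  \<open>v\<close> replaces the two sums of \<open>dml\<close>, and the orientation disappears.
  \<open>E\<close> and \<open>d\<close> are independent parameters since under Dirichlet conditions
  arcs are dropped while the full valence stays on the diagonal.\<close>

definition magnetic_op ::
  "'v set \<Rightarrow> 'e set \<Rightarrow> ('e \<Rightarrow> 'v) \<Rightarrow> ('e \<Rightarrow> 'v) \<Rightarrow> ('v \<Rightarrow> nat) \<Rightarrow> ('e \<Rightarrow> complex) \<Rightarrow>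
    ('v \<Rightarrow> complex) \<Rightarrow> 'v \<Rightarrow> complex" where
  "magnetic_op W E src tgt d \<sigma> f v =
     (if v \<in> W then of_nat (d v) * f v - (\<Sum>e | e \<in> E \<and> tgt e = v. \<sigma> e * f (src e)) else 0)"

text \<open>Summed over the arcs, each vertex value is repeated at most \<open>D\<close> times. This
  transfers square-summability from vertices to arcs.\<close>

lemma
  fixes k :: "'e \<Rightarrow> 'v" and g :: "'v \<Rightarrow> real"
  assumes g: "g summable_on UNIV" "\<And>v. 0 \<le> g v"
    and fin: "\<And>v. finite {e \<in> E. k e = v}" and card: "\<And>v. card {e \<in> E. k e = v} \<le> D"
  shows summable_on_bounded_fibres: "(\<lambda>e. g (k e)) summable_on E"
    and infsum_bounded_fibres: "(\<Sum>\<^sub>\<infinity>e\<in>E. g (k e)) \<le> real D * infsum g UNIV"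
proof -
  have le: "(\<Sum>e\<in>F. g (k e)) \<le> real D * infsum g UNIV" if F: "finite F" "F \<subseteq> E" for F
  proof -
    have "(\<Sum>e\<in>F. g (k e)) = (\<Sum>v\<in>k ` F. \<Sum>e\<in>{e \<in> F. k e = v}. g (k e))"
      by (rule sum.image_gen[OF F(1)])
    also have "\<dots> = (\<Sum>v\<in>k ` F. real (card {e \<in> F. k e = v}) * g v)"
      by (intro sum.cong refl) simp
    also have "\<dots> \<le> (\<Sum>v\<in>k ` F. real D * g v)"
    proof (intro sum_mono mult_right_mono g)
      fix v
      have "card {e \<in> F. k e = v} \<le> card {e \<in> E. k e = v}"
        using F by (intro card_mono fin) auto
      then show "real (card {e \<in> F. k e = v}) \<le> real D" using card[of v] by linarith
    qed
    also have "\<dots> = real D * (\<Sum>v\<in>k ` F. g v)" by (simp add: sum_distrib_left)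
    also have "\<dots> \<le> real D * infsum g UNIV"
      using F g by (intro mult_left_mono finite_sum_le_infsum) auto
    finally show ?thesis .
  qed
  show s: "(\<lambda>e. g (k e)) summable_on E"
    by (rule nonneg_bdd_above_summable_on) (auto intro!: bdd_aboveI[of _ "real D * infsum g UNIV"] le g)
  show "(\<Sum>\<^sub>\<infinity>e\<in>E. g (k e)) \<le> real D * infsum g UNIV"
    by (rule infsum_le_finite_sums[OF s le])
qed

lemma has_sum_fibres:
  fixes F :: "'e \<Rightarrow> complex" and k :: "'e \<Rightarrow> 'v"
  assumes "F summable_on E" and fin: "\<And>v. finite {e \<in> E. k e = v}"
  shows "((\<lambda>v. \<Sum>e | e \<in> E \<and> k e = v. F e) has_sum infsum F E) UNIV"
proof -
  let ?B = "\<lambda>v. {e \<in> E. k e = v}"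
  have bij: "bij_betw snd (Sigma UNIV ?B) E"
    by (rule bij_betwI[where g = "\<lambda>e. (k e, e)"]) auto
  have "((\<lambda>p. F (snd p)) has_sum infsum F E) (Sigma UNIV ?B)"
    using has_sum_infsum[OF assms(1)] has_sum_reindex_bij_betw[OF bij, of F] by simp
  then show ?thesis
    by (rule has_sum_SigmaD) (auto intro: has_sum_finiteI fin)
qed

section \<open>Boundedness and symmetry of magnetic operators\<close>

locale magnetic =
  fixes W :: "'v set" and E :: "'e set" and src tgt :: "'e \<Rightarrow> 'v" and rev :: "'e \<Rightarrow> 'e"
    and d :: "'v \<Rightarrow> nat" and \<sigma> :: "'e \<Rightarrow> complex" and D :: nat
  assumes src_W: "e \<in> E \<Longrightarrow> src e \<in> W" and tgt_W: "e \<in> E \<Longrightarrow> tgt e \<in> W"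
    and rev_E: "e \<in> E \<Longrightarrow> rev e \<in> E" and rev_rev: "e \<in> E \<Longrightarrow> rev (rev e) = e"
    and src_rev: "e \<in> E \<Longrightarrow> src (rev e) = tgt e"
    and \<sigma>_rev: "e \<in> E \<Longrightarrow> \<sigma> (rev e) = cnj (\<sigma> e)" and \<sigma>_unit: "e \<in> E \<Longrightarrow> cmod (\<sigma> e) = 1"
    and d_le: "v \<in> W \<Longrightarrow> d v \<le> D"
    and fin_in: "finite {e \<in> E. tgt e = v}" and card_in: "card {e \<in> E. tgt e = v} \<le> D"
begin

abbreviation M where "M \<equiv> magnetic_op W E src tgt d \<sigma>"

lemma tgt_rev: "e \<in> E \<Longrightarrow> tgt (rev e) = src e"
  using src_rev[of "rev e"] by (simp add: rev_E rev_rev)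

lemma bij_rev: "bij_betw rev E E"
  by (rule bij_betwI[where g = rev]) (auto simp: rev_E rev_rev)

lemma out_eq: "{e \<in> E. src e = v} = rev ` {e \<in> E. tgt e = v}"
proof (intro equalityI subsetI)
  fix e assume "e \<in> {e \<in> E. src e = v}"
  then have "e = rev (rev e)" "rev e \<in> {e \<in> E. tgt e = v}" by (auto simp: rev_E tgt_rev rev_rev)
  then show "e \<in> rev ` {e \<in> E. tgt e = v}" by (rule image_eqI)
qed (auto simp: rev_E src_rev)

lemma fin_out: "finite {e \<in> E. src e = v}" and card_out: "card {e \<in> E. src e = v} \<le> D"
  using card_image_le[OF fin_in[of v], of rev] card_in[of v] unfolding out_eq by (auto simp: fin_in)

text \<open>The supremum norm suits the trace estimates: delta functions have norm 1, and diagonal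
  entries of powers are bounded by a constant that does not depend on the subgraph.\<close>

lemma sup_bound:
  assumes "\<And>v. cmod (f v) \<le> C"
  shows "cmod (M f v) \<le> 2 * real D * C"
proof -
  have C: "0 \<le> C" using assms[of v] norm_ge_zero order_trans by blast
  show ?thesis
  proof (cases "v \<in> W")
    case True
    have "cmod (of_nat (d v) * f v) \<le> real D * C"
      using d_le[OF True] assms[of v] C by (simp add: norm_mult mult_mono)
    moreover have "cmod (\<Sum>e | e \<in> E \<and> tgt e = v. \<sigma> e * f (src e)) \<le> (\<Sum>e | e \<in> E \<and> tgt e = v. C)"
      by (intro sum_norm_le) (auto simp: norm_mult \<sigma>_unit assms)
    moreover have "(\<Sum>e | e \<in> E \<and> tgt e = v. C) \<le> real D * C"
      using card_in[of v] C by (simp add: mult_right_mono)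
    ultimately show ?thesis
      using True norm_triangle_ineq4[of "of_nat (d v) * f v" "\<Sum>e | e \<in> E \<and> tgt e = v. \<sigma> e * f (src e)"]
      by (simp add: magnetic_op_def)
  qed (use C in \<open>simp add: magnetic_op_def\<close>)
qed

lemma sup_bound_pow:
  assumes "\<And>v. cmod (f v) \<le> C"
  shows "cmod ((M ^^ k) f v) \<le> (2 * real D) ^ k * C"
proof (induction k arbitrary: v)
  case (Suc k)
  show ?case using sup_bound[of "(M ^^ k) f" "(2 * real D) ^ k * C", OF Suc] by (simp add: mult_ac)
qed (simp add: assms)

lemma src_summable: "f \<in> l2 V \<Longrightarrow> (\<lambda>e. (cmod (f (src e)))\<^sup>2) summable_on E"
  and src_infsum: "f \<in> l2 V \<Longrightarrow> (\<Sum>\<^sub>\<infinity>e\<in>E. (cmod (f (src e)))\<^sup>2) \<le> real D * (l2_norm f)\<^sup>2"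
  using summable_on_bounded_fibres[OF l2_summable[of f V] _ fin_out card_out]
    infsum_bounded_fibres[OF l2_summable[of f V] _ fin_out card_out]
  by (auto simp: l2_norm_def infsum_nonneg)

lemma tgt_summable: "f \<in> l2 V \<Longrightarrow> (\<lambda>e. (cmod (f (tgt e)))\<^sup>2) summable_on E"
  and tgt_infsum: "f \<in> l2 V \<Longrightarrow> (\<Sum>\<^sub>\<infinity>e\<in>E. (cmod (f (tgt e)))\<^sup>2) \<le> real D * (l2_norm f)\<^sup>2"
  using summable_on_bounded_fibres[OF l2_summable[of f V] _ fin_in card_in]
    infsum_bounded_fibres[OF l2_summable[of f V] _ fin_in card_in]
  by (auto simp: l2_norm_def infsum_nonneg)

definition hop :: "('v \<Rightarrow> complex) \<Rightarrow> 'v \<Rightarrow> complex" where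
  "hop f v = (\<Sum>e | e \<in> E \<and> tgt e = v. \<sigma> e * f (src e))"

lemma hop_outside: "v \<notin> W \<Longrightarrow> hop f v = 0"
  unfolding hop_def by (rule sum.neutral) (use tgt_W in auto)

lemma hop_l2:
  assumes f: "f \<in> l2 W"
  shows "hop f \<in> l2 W"
proof -
  have "(\<lambda>v. real D * (\<Sum>e | e \<in> E \<and> tgt e = v. (cmod (f (src e)))\<^sup>2)) summable_on UNIV"
  proof (intro summable_on_cmult_right)
    have "(\<lambda>e. complex_of_real ((cmod (f (src e)))\<^sup>2)) summable_on E"
      using src_summable[OF f] by (rule summable_on_of_real)
    from has_sum_Re[OF has_sum_fibres[OF this fin_in]]
    show "(\<lambda>v. \<Sum>e | e \<in> E \<and> tgt e = v. (cmod (f (src e)))\<^sup>2) summable_on UNIV"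
      by (auto simp: summable_on_def)
  qed
  then have "(\<lambda>v. (cmod (hop f v))\<^sup>2) summable_on UNIV"
  proof (rule summable_on_comparison_test)
    fix v
    have "cmod (hop f v) \<le> (\<Sum>e | e \<in> E \<and> tgt e = v. cmod (f (src e)))"
      unfolding hop_def by (intro sum_norm_le) (auto simp: norm_mult \<sigma>_unit)
    then have "(cmod (hop f v))\<^sup>2 \<le> (\<Sum>e | e \<in> E \<and> tgt e = v. cmod (f (src e)) * 1)\<^sup>2"
      by (intro power_mono) auto
    also have "\<dots> \<le> (\<Sum>e | e \<in> E \<and> tgt e = v. (cmod (f (src e)))\<^sup>2) * (\<Sum>e | e \<in> E \<and> tgt e = v. 1\<^sup>2)"
      by (rule Cauchy_Schwarz_ineq_sum)
    also have "\<dots> \<le> (\<Sum>e | e \<in> E \<and> tgt e = v. (cmod (f (src e)))\<^sup>2) * real D"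
      using card_in[of v] by (intro mult_left_mono sum_nonneg) auto
    finally show "(cmod (hop f v))\<^sup>2 \<le> real D * (\<Sum>e | e \<in> E \<and> tgt e = v. (cmod (f (src e)))\<^sup>2)"
      by (simp add: mult.commute)
  qed simp
  then show ?thesis by (auto simp: l2_iff hop_outside)
qed

lemma hop_term_bound:
  "cmod (\<sigma> e * f (src e) * cnj (g (tgt e))) \<le> ((cmod (f (src e)))\<^sup>2 + (cmod (g (tgt e)))\<^sup>2) / 2" if "e \<in> E"
  using that sum_squares_bound[of "cmod (f (src e))" "cmod (g (tgt e))"] by (simp add: norm_mult \<sigma>_unit)

lemma bound_summable:
  "f \<in> l2 W \<Longrightarrow> g \<in> l2 W \<Longrightarrow> (\<lambda>e. ((cmod (f (src e)))\<^sup>2 + (cmod (g (tgt e)))\<^sup>2) / 2) summable_on E"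
  using summable_on_cmult_right[OF summable_on_add[OF src_summable[of f W] tgt_summable[of g W]], of "1/2"] by simp

lemma hop_norm_summable:
  assumes "f \<in> l2 W" "g \<in> l2 W"
  shows "(\<lambda>e. norm (\<sigma> e * f (src e) * cnj (g (tgt e)))) summable_on E"
  by (rule Infinite_Sum.abs_summable_on_comparison_test'[OF bound_summable[OF assms]]) (rule hop_term_bound)

lemma hop_inner:
  assumes f: "f \<in> l2 W" and g: "g \<in> l2 W"
  shows "l2_inner (hop f) g = (\<Sum>\<^sub>\<infinity>e\<in>E. \<sigma> e * f (src e) * cnj (g (tgt e)))"
proof -
  have "(\<lambda>e. \<sigma> e * f (src e) * cnj (g (tgt e))) summable_on E"
    by (rule abs_summable_summable[OF hop_norm_summable[OF f g]])
  from has_sum_fibres[OF this fin_in]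
  have "((\<lambda>v. hop f v * cnj (g v)) has_sum (\<Sum>\<^sub>\<infinity>e\<in>E. \<sigma> e * f (src e) * cnj (g (tgt e)))) UNIV"
    by (rule has_sum_cong[THEN iffD1, rotated]) (auto simp: hop_def sum_distrib_right intro!: sum.cong)
  then show ?thesis
    unfolding l2_inner_def by (rule infsumI)
qed

text \<open>Both sides are sums over arcs, and arc reversal, which swaps the endpoints and
  conjugates the weight, carries one into the other.\<close>

lemma hop_sym:
  assumes f: "f \<in> l2 W" and g: "g \<in> l2 W"
  shows "l2_inner (hop f) g = l2_inner f (hop g)"
proof -
  have "l2_inner (hop f) g = (\<Sum>\<^sub>\<infinity>e\<in>E. \<sigma> (rev e) * f (src (rev e)) * cnj (g (tgt (rev e))))"
    unfolding hop_inner[OF f g] by (rule infsum_reindex_bij_betw[OF bij_rev, symmetric])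
  also have "\<dots> = (\<Sum>\<^sub>\<infinity>e\<in>E. cnj (\<sigma> e * g (src e) * cnj (f (tgt e))))"
    by (intro infsum_cong) (simp add: \<sigma>_rev src_rev tgt_rev)
  also have "\<dots> = cnj (l2_inner (hop g) f)"
    unfolding hop_inner[OF g f] by (rule infsum_cnj)
  finally show ?thesis
    using l2_inner_commute[of f "hop g"] by simp
qed

lemma hop_quadratic:
  assumes f: "f \<in> l2 W"
  shows "cmod (l2_inner (hop f) f) \<le> real D * (l2_norm f)\<^sup>2"
proof -
  have "cmod (l2_inner (hop f) f) \<le> (\<Sum>\<^sub>\<infinity>e\<in>E. cmod (\<sigma> e * f (src e) * cnj (f (tgt e))))"
    unfolding hop_inner[OF f f] by (rule norm_infsum_bound[OF hop_norm_summable[OF f f]])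
  also have "\<dots> \<le> (\<Sum>\<^sub>\<infinity>e\<in>E. ((cmod (f (src e)))\<^sup>2 + (cmod (f (tgt e)))\<^sup>2) / 2)"
    by (rule infsum_mono[OF hop_norm_summable[OF f f] bound_summable[OF f f]]) (rule hop_term_bound)
  also have "\<dots> = ((\<Sum>\<^sub>\<infinity>e\<in>E. (cmod (f (src e)))\<^sup>2) + (\<Sum>\<^sub>\<infinity>e\<in>E. (cmod (f (tgt e)))\<^sup>2)) / 2"
    using infsum_cmult_left'[of "\<lambda>e. (cmod (f (src e)))\<^sup>2 + (cmod (f (tgt e)))\<^sup>2" "1/2" E]
    by (simp add: infsum_add[OF src_summable[OF f] tgt_summable[OF f]])
  also have "\<dots> \<le> real D * (l2_norm f)\<^sup>2"
    using src_infsum[OF f] tgt_infsum[OF f] by simp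
  finally show ?thesis .
qed

lemma M_eq: "f \<in> l2 W \<Longrightarrow> M f = (\<lambda>v. of_nat (d v) * f v - hop f v)"
  by (auto simp: magnetic_op_def hop_def[symmetric] hop_outside fun_eq_iff l2_outside)

lemma deg_l2:
  assumes f: "f \<in> l2 W" shows "(\<lambda>v. of_nat (d v) * f v) \<in> l2 W"
proof -
  have "(\<lambda>v. (cmod (of_nat (d v) * f v))\<^sup>2) summable_on UNIV"
  proof (rule summable_on_comparison_test)
    show "(\<lambda>v. (real D)\<^sup>2 * (cmod (f v))\<^sup>2) summable_on UNIV"
      by (intro summable_on_cmult_right l2_summable[OF f])
    show "(cmod (of_nat (d v) * f v))\<^sup>2 \<le> (real D)\<^sup>2 * (cmod (f v))\<^sup>2" for v
      using d_le[of v] l2_outside[OF f, of v]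
      by (cases "v \<in> W") (auto simp: norm_mult power_mult_distrib intro!: mult_right_mono power_mono)
  qed simp
  then show ?thesis using f by (auto simp: l2_iff)
qed

lemma deg_quadratic:
  assumes f: "f \<in> l2 W"
  shows "cmod (l2_inner (\<lambda>v. of_nat (d v) * f v) f) \<le> real D * (l2_norm f)\<^sup>2"
proof -
  let ?t = "\<lambda>v. cmod (of_nat (d v) * f v * cnj (f v))"
  have "cmod (l2_inner (\<lambda>v. of_nat (d v) * f v) f) \<le> (\<Sum>\<^sub>\<infinity>v. ?t v)"
    unfolding l2_inner_def by (rule norm_infsum_bound[OF l2_prod_abs_summable[OF deg_l2[OF f] f]])
  also have "\<dots> \<le> (\<Sum>\<^sub>\<infinity>v. real D * (cmod (f v))\<^sup>2)"
  proof (rule infsum_mono[OF l2_prod_abs_summable[OF deg_l2[OF f] f]])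
    show "?t v \<le> real D * (cmod (f v))\<^sup>2" for v
      using d_le[of v] l2_outside[OF f, of v]
      by (cases "v \<in> W") (auto simp: norm_mult power2_eq_square mult.assoc intro!: mult_right_mono)
  qed (intro summable_on_cmult_right l2_summable[OF f])
  also have "\<dots> = real D * (l2_norm f)\<^sup>2"
    by (simp add: infsum_cmult_right' l2_norm_def infsum_nonneg)
  finally show ?thesis .
qed

lemma selfadjoint: "l2_selfadjoint W M"
proof
  fix f g :: "'v \<Rightarrow> complex" and a b :: complex assume f: "f \<in> l2 W"
  show "M f \<in> l2 W" unfolding M_eq[OF f] by (intro l2_diff deg_l2 hop_l2 f)
  assume g: "g \<in> l2 W"
  have "hop (\<lambda>v. a * f v + b * g v) v = a * hop f v + b * hop g v" for v
    unfolding hop_def sum_distrib_left sum.distrib[symmetric] by (intro sum.cong) (auto simp: algebra_simps)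
  then show "M (\<lambda>v. a * f v + b * g v) = (\<lambda>v. a * M f v + b * M g v)"
    unfolding M_eq[OF l2_lincomb[OF f g]] M_eq[OF f] M_eq[OF g] by (auto simp: algebra_simps)
  have "l2_inner (\<lambda>v. of_nat (d v) * f v) g = l2_inner f (\<lambda>v. of_nat (d v) * g v)"
    unfolding l2_inner_def by (simp add: mult_ac)
  then show "l2_inner (M f) g = l2_inner f (M g)"
    unfolding M_eq[OF f] M_eq[OF g]
    by (simp add: l2_inner_diff_left[OF deg_l2[OF f] hop_l2[OF f] g]
        l2_inner_diff_right[OF deg_l2[OF g] hop_l2[OF g] f] hop_sym[OF f g])
qed

lemma quadratic_bound:
  assumes f: "f \<in> l2 W"
  shows "cmod (l2_inner (M f) f) \<le> 2 * real D * (l2_norm f)\<^sup>2"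
  unfolding M_eq[OF f] l2_inner_diff_left[OF deg_l2[OF f] hop_l2[OF f] f]
  using norm_triangle_ineq4[of "l2_inner (\<lambda>v. of_nat (d v) * f v) f" "l2_inner (hop f) f"]
    deg_quadratic[OF f] hop_quadratic[OF f] by linarith

end

lemma weight_function_bar:
  assumes "weight_function X bar \<sigma>" "e \<in> arcs X"
  shows "\<sigma> (bar e) = cnj (\<sigma> e)"
proof -
  have "cmod (\<sigma> e) = 1" "\<sigma> (bar e) = inverse (\<sigma> e)" using assms by (auto simp: weight_function_def)
  then show ?thesis
    by (metis complex_cnj_one complex_div_cnj div_by_1 inverse_eq_divide mult_1 norm_one power_one of_real_1)
qed

text \<open>Reversal maps the arcs into \<open>v\<close> outside \<open>Ep\<close> bijectively to
  the arcs in \<open>Ep\<close> out of \<open>v\<close>, so that the second sum of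
  \<open>dml\<close> supplies the missing half of the incoming arcs.\<close>

lemma dml_eq_magnetic_op:
  assumes X: "bidirected_digraph X bar" and Ep: "orientation X bar Ep" and \<sigma>: "weight_function X bar \<sigma>"
    and Y: "arcs Y \<subseteq> arcs X" "bar ` arcs Y \<subseteq> arcs Y" "tail Y = tail X" "head Y = head X"
    and fin: "\<And>v. finite {e \<in> arcs Y. head X e = v}"
  shows "dml Y Ep \<sigma> f = magnetic_op (verts Y) (arcs Y) (tail X) (head X) (in_degree Y) \<sigma> f"
proof
  interpret bidirected_digraph X bar by fact
  fix v
  let ?I = "{e. e \<in> arcs Y \<and> head X e = v}"
  have o: "(e \<in> Ep) \<noteq> (bar e \<in> Ep)" if "e \<in> arcs Y" for e
    using Ep Y that by (auto simp: orientation_def)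
  have bij: "bij_betw bar {e. e \<in> arcs Y \<and> e \<notin> Ep \<and> head X e = v} {e. e \<in> Ep \<inter> arcs Y \<and> tail Y e = v}"
  proof (rule bij_betwI[where g = bar])
    show "bar \<in> {e. e \<in> arcs Y \<and> e \<notin> Ep \<and> head X e = v} \<rightarrow> {e. e \<in> Ep \<inter> arcs Y \<and> tail Y e = v}"
      using Y o by auto
    show "bar \<in> {e. e \<in> Ep \<inter> arcs Y \<and> tail Y e = v} \<rightarrow> {e. e \<in> arcs Y \<and> e \<notin> Ep \<and> head X e = v}"
      using Y o by auto
  qed auto
  have "(\<Sum>e | e \<in> Ep \<inter> arcs Y \<and> tail Y e = v. cnj (\<sigma> e) * f (head Y e))
      = (\<Sum>e | e \<in> arcs Y \<and> e \<notin> Ep \<and> head X e = v. cnj (\<sigma> (bar e)) * f (head Y (bar e)))"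
    by (rule sum.reindex_bij_betw[OF bij, symmetric])
  also have "\<dots> = (\<Sum>e | e \<in> arcs Y \<and> e \<notin> Ep \<and> head X e = v. \<sigma> e * f (tail X e))"
  proof (intro sum.cong refl)
    fix e assume "e \<in> {e. e \<in> arcs Y \<and> e \<notin> Ep \<and> head X e = v}"
    then have e: "e \<in> arcs X" using Y by auto
    then show "cnj (\<sigma> (bar e)) * f (head Y (bar e)) = \<sigma> e * f (tail X e)"
      using e Y by (simp add: weight_function_bar[OF \<sigma>])
  qed
  finally have "(\<Sum>e | e \<in> Ep \<inter> arcs Y \<and> head Y e = v. \<sigma> e * f (tail Y e))
      + (\<Sum>e | e \<in> Ep \<inter> arcs Y \<and> tail Y e = v. cnj (\<sigma> e) * f (head Y e))
      = (\<Sum>e | e \<in> Ep \<inter> arcs Y \<and> head X e = v. \<sigma> e * f (tail X e))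
      + (\<Sum>e | e \<in> arcs Y \<and> e \<notin> Ep \<and> head X e = v. \<sigma> e * f (tail X e))"
    by (simp add: Y)
  also have "\<dots> = (\<Sum>e\<in>?I. \<sigma> e * f (tail X e))"
    by (subst sum.union_disjoint[symmetric])
      (auto intro: finite_subset[OF _ fin[of v]] intro!: sum.cong)
  finally show "dml Y Ep \<sigma> f v = magnetic_op (verts Y) (arcs Y) (tail X) (head X) (in_degree Y) \<sigma> f v"
    by (simp add: dml_def magnetic_op_def algebra_simps)
qed

lemma eigenvalue_count_cong:
  assumes "\<And>f. (\<And>v. v \<notin> W \<Longrightarrow> f v = 0) \<Longrightarrow> A f = B f"
  shows "eigenvalue_count W A = eigenvalue_count W B"
proof -
  have "eigenspace W A = eigenspace W B"
    using assms by (auto simp: eigenspace_def fun_eq_iff)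
  then show ?thesis by (auto simp: eigenvalue_count_def fun_eq_iff)
qed

section \<open>Counting functions and convergence of moments\<close>

text \<open>The counts are normalised by the number of group elements, and the trace is a sum over
  the fundamental domain; accordingly the limit is a finite sum of measures whose total mass need
  not be 1.\<close>

locale moment_convergence =
  fixes n :: "nat \<Rightarrow> nat" and N :: "nat \<Rightarrow> nat" and \<mu> :: "nat \<Rightarrow> nat \<Rightarrow> real" and K :: real
    and I :: "'i set" and \<nu> :: "'i \<Rightarrow> real measure"
  assumes \<mu>_bound: "i < n m \<Longrightarrow> \<mu> m i \<in> {-K..K}" and fin: "finite I"
    and interval: "w \<in> I \<Longrightarrow> interval_measure (\<nu> w) K"
    and conv: "(\<lambda>m. (\<Sum>i<n m. \<mu> m i ^ k) / real (N m)) \<longlonglongrightarrow> (\<Sum>w\<in>I. \<integral>t. t ^ k \<partial>\<nu> w)"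
begin

lemma conv_poly:
  "(\<lambda>m. (\<Sum>i<n m. \<Sum>k\<le>r. a k * \<mu> m i ^ k) / real (N m)) \<longlonglongrightarrow> (\<Sum>w\<in>I. \<integral>t. (\<Sum>k\<le>r. a k * t ^ k) \<partial>\<nu> w)"
proof -
  have "(\<Sum>w\<in>I. \<integral>t. (\<Sum>k\<le>r. a k * t ^ k) \<partial>\<nu> w) = (\<Sum>w\<in>I. \<Sum>k\<le>r. a k * (\<integral>t. t ^ k \<partial>\<nu> w))"
  proof (intro sum.cong refl)
    fix w assume "w \<in> I"
    then interpret interval_measure "\<nu> w" K by (rule interval)
    have "integrable (\<nu> w) (\<lambda>t. a k * t ^ k)" for k
      by (intro integrable_bdd_borel bdd_borel_mult) auto
    then show "(\<integral>t. (\<Sum>k\<le>r. a k * t ^ k) \<partial>\<nu> w) = (\<Sum>k\<le>r. a k * (\<integral>t. t ^ k \<partial>\<nu> w))"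
      by (subst Bochner_Integration.integral_sum) auto
  qed
  also have "\<dots> = (\<Sum>k\<le>r. a k * (\<Sum>w\<in>I. \<integral>t. t ^ k \<partial>\<nu> w))"
    by (subst sum.swap) (simp add: sum_distrib_left)
  finally have lim: "(\<Sum>w\<in>I. \<integral>t. (\<Sum>k\<le>r. a k * t ^ k) \<partial>\<nu> w) = (\<Sum>k\<le>r. a k * (\<Sum>w\<in>I. \<integral>t. t ^ k \<partial>\<nu> w))" .
  have seq: "(\<Sum>i<n m. \<Sum>k\<le>r. a k * \<mu> m i ^ k) / real (N m) = (\<Sum>k\<le>r. a k * ((\<Sum>i<n m. \<mu> m i ^ k) / real (N m)))" for m
    by (subst sum.swap)
      (simp only: sum_distrib_left[symmetric] sum_divide_distrib[where A = "{..r}"] times_divide_eq_right)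
  show ?thesis
    unfolding lim seq by (intro tendsto_sum tendsto_mult_left conv)
qed

definition total :: real where "total = (\<Sum>w\<in>I. measure (\<nu> w) UNIV)"

lemma total_nonneg: "0 \<le> total"
  by (simp add: total_def sum_nonneg)

text \<open>One-sided approximation: a polynomial above \<open>\<phi>\<close> bounds the empirical sums from above.\<close>

lemma eventually_sum_le:
  assumes \<phi>: "continuous_on UNIV \<phi>" and e: "0 < e"
  shows "\<forall>\<^sub>F m in sequentially. (\<Sum>i<n m. \<phi> (\<mu> m i)) / real (N m) \<le> (\<Sum>w\<in>I. \<integral>t. \<phi> t \<partial>\<nu> w) + e"
proof -
  \<comment> \<open>A polynomial within \<open>c\<close> of \<open>\<phi> + c\<close> lies between
    \<open>\<phi>\<close> and \<open>\<phi> + 2 * c\<close>, which costs at most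
    \<open>2 * c * total\<close>; the summand 1 guards against \<open>total = 0\<close>. As the
    error is paid only in the limit measures, the ratio of \<open>n m\<close> to \<open>N m\<close>
    never has to be bounded.\<close>
  define c where "c = e / (4 * (total + 1))"
  have c: "0 < c" "2 * c * total < e"
    using e total_nonneg by (auto simp: c_def field_simps add_pos_nonneg)
  obtain g where g: "real_polynomial_function g" and close: "\<And>t. t \<in> {-K..K} \<Longrightarrow> \<bar>(\<phi> t + c) - g t\<bar> < c"
  proof -
    have "continuous_on {-K..K} (\<lambda>t. \<phi> t + c)"
      by (intro continuous_intros continuous_on_subset[OF \<phi>]) auto
    then show thesis
      using Stone_Weierstrass_real_polynomial_function[of "{-K..K}" "\<lambda>t. \<phi> t + c" c] c that by blast
  qed
  obtain a r where gr: "g = (\<lambda>t. \<Sum>k\<le>r. a k * t ^ k)"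
    using g unfolding real_polynomial_function_iff_sum by auto
  have int: "(\<Sum>w\<in>I. \<integral>t. g t \<partial>\<nu> w) \<le> (\<Sum>w\<in>I. \<integral>t. \<phi> t \<partial>\<nu> w) + 2 * c * total"
  proof -
    have "(\<integral>t. g t \<partial>\<nu> w) \<le> (\<integral>t. \<phi> t \<partial>\<nu> w) + 2 * c * measure (\<nu> w) UNIV" if "w \<in> I" for w
    proof -
      interpret interval_measure "\<nu> w" K by (rule interval[OF that])
      have ig: "integrable (\<nu> w) g"
        unfolding gr by (intro integrable_bdd_borel bdd_borel_sum bdd_borel_mult) auto
      have ip: "integrable (\<nu> w) \<phi>" by (intro integrable_bdd_borel bdd_borel_continuous \<phi>)
      have "(\<integral>t. g t \<partial>\<nu> w) \<le> (\<integral>t. \<phi> t + 2 * c \<partial>\<nu> w)"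
      proof (rule integral_mono_AE[OF ig])
        show "integrable (\<nu> w) (\<lambda>t. \<phi> t + 2 * c)" using ip by simp
        show "AE t in \<nu> w. g t \<le> \<phi> t + 2 * c"
        proof (rule AE_mp[OF AE_interval AE_I2], rule impI)
          fix t assume "t \<in> {-K..K}"
          then show "g t \<le> \<phi> t + 2 * c" using close[of t] by linarith
        qed
      qed
      also have "\<dots> = (\<integral>t. \<phi> t \<partial>\<nu> w) + 2 * c * measure (\<nu> w) UNIV"
        using ip by simp
      finally show ?thesis .
    qed
    then have "(\<Sum>w\<in>I. \<integral>t. g t \<partial>\<nu> w) \<le> (\<Sum>w\<in>I. (\<integral>t. \<phi> t \<partial>\<nu> w) + 2 * c * measure (\<nu> w) UNIV)"
      by (rule sum_mono)
    then show ?thesis by (simp add: sum.distrib sum_distrib_left total_def)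
  qed
  have "(\<lambda>m. (\<Sum>i<n m. g (\<mu> m i)) / real (N m)) \<longlonglongrightarrow> (\<Sum>w\<in>I. \<integral>t. g t \<partial>\<nu> w)"
    unfolding gr by (rule conv_poly)
  then have "\<forall>\<^sub>F m in sequentially. (\<Sum>i<n m. g (\<mu> m i)) / real (N m) < (\<Sum>w\<in>I. \<integral>t. \<phi> t \<partial>\<nu> w) + e"
    by (rule order_tendstoD(2)) (use int c in linarith)
  then show ?thesis
  proof eventually_elim
    case (elim m)
    have "(\<Sum>i<n m. \<phi> (\<mu> m i)) \<le> (\<Sum>i<n m. g (\<mu> m i))"
    proof (rule sum_mono)
      fix i assume "i \<in> {..<n m}"
      then show "\<phi> (\<mu> m i) \<le> g (\<mu> m i)"
        using close[OF \<mu>_bound, of i m] by (simp add: abs_less_iff)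
    qed
    then have "(\<Sum>i<n m. \<phi> (\<mu> m i)) / real (N m) \<le> (\<Sum>i<n m. g (\<mu> m i)) / real (N m)"
      by (rule divide_right_mono) simp
    then show ?case using elim by linarith
  qed
qed

lemma eventually_sum_ge:
  assumes \<phi>: "continuous_on UNIV \<phi>" and e: "0 < e"
  shows "\<forall>\<^sub>F m in sequentially. (\<Sum>w\<in>I. \<integral>t. \<phi> t \<partial>\<nu> w) - e \<le> (\<Sum>i<n m. \<phi> (\<mu> m i)) / real (N m)"
  using eventually_sum_le[of "\<lambda>t. - \<phi> t", OF continuous_on_minus[OF \<phi>] e]
  by eventually_elim (simp add: sum_negf)

text \<open>Continuous approximations of the indicator functions of \<open>{..x}\<close> (with \<open>y = x\<close>, from above) and of
  \<open>{..<x}\<close> (with \<open>y = x - 1/j\<close>, from below).\<close>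

definition ramp :: "nat \<Rightarrow> real \<Rightarrow> real \<Rightarrow> real" where
  "ramp j y t = max 0 (min 1 (1 - real j * (t - y)))"

lemma continuous_ramp: "continuous_on UNIV (ramp j y)"
  unfolding ramp_def by (intro continuous_intros)

lemma ramp_bounds: "0 \<le> ramp j y t" "ramp j y t \<le> 1"
  by (auto simp: ramp_def)

lemma ramp_le: "t \<le> y \<Longrightarrow> ramp j y t = 1"
  using mult_nonneg_nonpos[of "real j" "t - y"] by (simp add: ramp_def)

lemma ramp_ge: "1 \<le> real j * (t - y) \<Longrightarrow> ramp j y t = 0"
  by (simp add: ramp_def)

lemma integral_indicator_conv:
  assumes "\<And>j. continuous_on UNIV (\<phi> j)" "\<And>j t. \<bar>\<phi> j t\<bar> \<le> 1" "B \<in> sets borel"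
    and "\<And>t. \<forall>\<^sub>F j in sequentially. \<phi> j t = indicator B t"
  shows "(\<lambda>j. \<Sum>w\<in>I. \<integral>t. \<phi> j t \<partial>\<nu> w) \<longlonglongrightarrow> (\<Sum>w\<in>I. measure (\<nu> w) B)"
proof (rule tendsto_sum)
  fix w assume "w \<in> I"
  then interpret interval_measure "\<nu> w" K by (rule interval)
  have "(\<lambda>j. \<integral>t. \<phi> j t \<partial>\<nu> w) \<longlonglongrightarrow> (\<integral>t. indicator B t \<partial>\<nu> w)"
  proof (rule integral_dominated_convergence[where w = "\<lambda>_. 1"])
    show "AE t in \<nu> w. (\<lambda>j. \<phi> j t) \<longlonglongrightarrow> indicator B t"
      using assms(4) by (intro AE_I2 tendsto_eventually)
  qed (use assms in \<open>auto intro: borel_measurable_continuous_onI\<close>)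
  then show "(\<lambda>j. \<integral>t. \<phi> j t \<partial>\<nu> w) \<longlonglongrightarrow> measure (\<nu> w) B"
    using assms(3) by simp
qed

lemma eventually_count_le:
  assumes e: "0 < e"
  shows "\<forall>\<^sub>F m in sequentially.
    real (card {i. i < n m \<and> \<mu> m i \<le> x}) / real (N m) \<le> (\<Sum>w\<in>I. measure (\<nu> w) {..x}) + e"
proof -
  have "(\<lambda>j. \<Sum>w\<in>I. \<integral>t. ramp j x t \<partial>\<nu> w) \<longlonglongrightarrow> (\<Sum>w\<in>I. measure (\<nu> w) {..x})"
  proof (rule integral_indicator_conv)
    fix t
    show "\<forall>\<^sub>F j in sequentially. ramp j x t = indicator {..x} t"
    proof (cases "t \<le> x")
      case False
      have "\<forall>\<^sub>F j in sequentially. 1 / (t - x) < real j"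
        using filterlim_real_sequentially unfolding filterlim_at_top_dense by blast
      then show ?thesis
      proof eventually_elim
        case (elim j)
        then have "1 \<le> real j * (t - x)" using False by (simp add: field_simps)
        then show ?case using False by (simp add: ramp_ge)
      qed
    qed (simp add: ramp_le)
  qed (auto simp: continuous_ramp ramp_bounds abs_le_iff intro: order_trans[OF _ ramp_bounds(1)])
  then have "\<forall>\<^sub>F j in sequentially. (\<Sum>w\<in>I. \<integral>t. ramp j x t \<partial>\<nu> w) < (\<Sum>w\<in>I. measure (\<nu> w) {..x}) + e / 2"
    by (rule order_tendstoD(2)) (use e in simp)
  then obtain j where j: "(\<Sum>w\<in>I. \<integral>t. ramp j x t \<partial>\<nu> w) < (\<Sum>w\<in>I. measure (\<nu> w) {..x}) + e / 2"
    by (auto simp: eventually_sequentially)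
  have "0 < e / 2" using e by simp
  from eventually_sum_le[OF continuous_ramp[of j x] this] show ?thesis
  proof eventually_elim
    case (elim m)
    have "real (card {i. i < n m \<and> \<mu> m i \<le> x}) = (\<Sum>i<n m. if \<mu> m i \<le> x then 1 else 0)"
      by (subst sum.If_cases) (auto intro!: arg_cong[of _ _ card])
    also have "\<dots> \<le> (\<Sum>i<n m. ramp j x (\<mu> m i))"
      by (intro sum_mono) (simp add: ramp_le ramp_bounds)
    finally have "real (card {i. i < n m \<and> \<mu> m i \<le> x}) / real (N m) \<le> (\<Sum>i<n m. ramp j x (\<mu> m i)) / real (N m)"
      by (rule divide_right_mono) simp
    then show ?case using elim j by linarith
  qed
qed

lemma eventually_count_ge:
  assumes e: "0 < e"
  shows "\<forall>\<^sub>F m in sequentially.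
    (\<Sum>w\<in>I. measure (\<nu> w) {..<x}) - e \<le> real (card {i. i < n m \<and> \<mu> m i < x}) / real (N m)"
proof -
  \<comment> \<open>This ramp equals 1 up to x - 1/(j+1) and reaches 0 exactly at x;
    \<open>Suc j\<close> avoids division by zero.\<close>
  let ?r = "\<lambda>j t. ramp (Suc j) (x - 1 / real (Suc j)) t"
  have r0: "?r j t = 0" if "x \<le> t" for j t
  proof (rule ramp_ge)
    have "real (Suc j) * (t - (x - 1 / real (Suc j))) = real (Suc j) * (t - x) + 1"
      by (simp only: right_diff_distrib) simp
    then show "1 \<le> real (Suc j) * (t - (x - 1 / real (Suc j)))"
      using that by simp
  qed
  have "(\<lambda>j. \<Sum>w\<in>I. \<integral>t. ?r j t \<partial>\<nu> w) \<longlonglongrightarrow> (\<Sum>w\<in>I. measure (\<nu> w) {..<x})"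
  proof (rule integral_indicator_conv)
    fix t
    show "\<forall>\<^sub>F j in sequentially. ?r j t = indicator {..<x} t"
    proof (cases "t < x")
      case True
      have "\<forall>\<^sub>F j in sequentially. 1 / (x - t) < real j"
        using filterlim_real_sequentially unfolding filterlim_at_top_dense by blast
      then show ?thesis
      proof eventually_elim
        case (elim j)
        then have "1 / (x - t) < real (Suc j)" by simp
        then have "1 / real (Suc j) < x - t" using True by (simp add: field_simps)
        then show ?case using True by (simp add: ramp_le)
      qed
    next
      case False
      then have "?r j t = 0" for j by (intro r0) simp
      then show ?thesis using False by (simp del: of_nat_Suc)
    qed
  qed (auto simp: continuous_ramp ramp_bounds abs_le_iff intro: order_trans[OF _ ramp_bounds(1)])
  then have "\<forall>\<^sub>F j in sequentially. (\<Sum>w\<in>I. measure (\<nu> w) {..<x}) - e / 2 < (\<Sum>w\<in>I. \<integral>t. ?r j t \<partial>\<nu> w)"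
    by (rule order_tendstoD(1)) (use e in simp)
  then obtain j where j: "(\<Sum>w\<in>I. measure (\<nu> w) {..<x}) - e / 2 < (\<Sum>w\<in>I. \<integral>t. ?r j t \<partial>\<nu> w)"
    by (auto simp: eventually_sequentially)
  have "0 < e / 2" using e by simp
  from eventually_sum_ge[OF continuous_ramp[of "Suc j" "x - 1 / real (Suc j)"] this] show ?thesis
  proof eventually_elim
    case (elim m)
    have "(\<Sum>i<n m. ?r j (\<mu> m i)) \<le> (\<Sum>i<n m. if \<mu> m i < x then 1 else 0)"
      by (intro sum_mono) (simp add: r0 ramp_bounds del: of_nat_Suc)
    also have "\<dots> = real (card {i. i < n m \<and> \<mu> m i < x})"
      by (subst sum.If_cases) (auto intro!: arg_cong[of _ _ card])
    finally have "(\<Sum>i<n m. ?r j (\<mu> m i)) / real (N m) \<le> real (card {i. i < n m \<and> \<mu> m i < x}) / real (N m)"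
      by (rule divide_right_mono) simp
    then show ?case using elim j by linarith
  qed
qed

text \<open>The upper bound is \<open>eventually_count_le\<close>. For the lower bound the half-line
  is split into \<open>{..<x}\<close>, controlled by weak convergence, and the point x, where the
  hypothesis \<open>atom\<close> takes over with an error that is negligible by
  \<open>\<beta>\<close>.\<close>

theorem count_converges:
  assumes atom: "\<And>m. real (N m) * (\<Sum>w\<in>I. measure (\<nu> w) {x}) - \<beta> m \<le> real (card {i. i < n m \<and> \<mu> m i = x})"
    and \<beta>: "(\<lambda>m. \<beta> m / real (N m)) \<longlonglongrightarrow> 0" and N: "\<And>m. 0 < N m"
  shows "(\<lambda>m. real (card {i. i < n m \<and> \<mu> m i \<le> x}) / real (N m)) \<longlonglongrightarrow> (\<Sum>w\<in>I. measure (\<nu> w) {..x})"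
proof (rule LIMSEQ_I)
  fix r :: real assume r: "0 < r"
  define e where "e = r / 4"
  have e: "0 < e" using r by (simp add: e_def)
  have split: "(\<Sum>w\<in>I. measure (\<nu> w) {..x}) = (\<Sum>w\<in>I. measure (\<nu> w) {..<x}) + (\<Sum>w\<in>I. measure (\<nu> w) {x})"
    unfolding sum.distrib[symmetric]
  proof (intro sum.cong refl)
    fix w assume "w \<in> I"
    then interpret interval_measure "\<nu> w" K by (rule interval)
    have eq: "{..x} = {..<x} \<union> {x}" by auto
    show "measure (\<nu> w) {..x} = measure (\<nu> w) {..<x} + measure (\<nu> w) {x}"
      unfolding eq by (rule finite_measure_Union) auto
  qed
  have "\<forall>\<^sub>F m in sequentially. \<beta> m / real (N m) < e"
    using \<beta> e by (rule order_tendstoD(2))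
  with eventually_count_le[OF e, of x] eventually_count_ge[OF e, of x]
  have "\<forall>\<^sub>F m in sequentially. norm (real (card {i. i < n m \<and> \<mu> m i \<le> x}) / real (N m)
      - (\<Sum>w\<in>I. measure (\<nu> w) {..x})) < r"
  proof eventually_elim
    case (elim m)
    have "{i. i < n m \<and> \<mu> m i \<le> x} = {i. i < n m \<and> \<mu> m i < x} \<union> {i. i < n m \<and> \<mu> m i = x}" by auto
    then have "card {i. i < n m \<and> \<mu> m i \<le> x} = card {i. i < n m \<and> \<mu> m i < x} + card {i. i < n m \<and> \<mu> m i = x}"
      by (simp add: card_Un_disjoint disjoint_iff)
    then have c: "real (card {i. i < n m \<and> \<mu> m i \<le> x}) / real (N m)
        = real (card {i. i < n m \<and> \<mu> m i < x}) / real (N m) + real (card {i. i < n m \<and> \<mu> m i = x}) / real (N m)"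
      by (simp add: add_divide_distrib)
    have "(real (N m) * (\<Sum>w\<in>I. measure (\<nu> w) {x}) - \<beta> m) / real (N m)
        \<le> real (card {i. i < n m \<and> \<mu> m i = x}) / real (N m)"
      by (intro divide_right_mono atom) simp
    then have "(\<Sum>w\<in>I. measure (\<nu> w) {x}) - \<beta> m / real (N m) \<le> real (card {i. i < n m \<and> \<mu> m i = x}) / real (N m)"
      using N[of m] by (simp add: diff_divide_distrib)
    then show ?case
      using elim c split e_def r unfolding real_norm_def abs_less_iff by linarith
  qed
  then show "\<exists>no. \<forall>m\<ge>no. norm (real (card {i. i < n m \<and> \<mu> m i \<le> x}) / real (N m)
      - (\<Sum>w\<in>I. measure (\<nu> w) {..x})) < r"
    by (simp add: eventually_sequentially)
qed

end

section \<open>Regular exhaustions of the group\<close>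

context group
begin

text \<open>Ensures that the \<open>LEAST\<close> in \<open>word_length\<close> ranges over a
  nonempty set, so that the length is attained by a word.\<close>

lemma generate_word:
  assumes S: "S \<subseteq> carrier G" and g: "g \<in> generate G S"
  shows "\<exists>ws. set ws \<subseteq> S \<union> (\<lambda>s. inv s) ` S \<and> foldr (\<lambda>x y. x \<otimes> y) ws \<one> = g"
  using g
proof (induction rule: generate.induct)
  case one
  show ?case by (rule exI[of _ "[]"]) simp
next
  case (incl h)
  then show ?case using S by (intro exI[of _ "[h]"]) auto
next
  case (inv h)
  then show ?case using S by (intro exI[of _ "[inv h]"]) auto
next
  case (eng g h)
  have app: "foldr (\<lambda>x y. x \<otimes> y) (us @ vs) \<one> = foldr (\<lambda>x y. x \<otimes> y) us \<one> \<otimes> foldr (\<lambda>x y. x \<otimes> y) vs \<one>"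
    and cl: "foldr (\<lambda>x y. x \<otimes> y) us \<one> \<in> carrier G"
    if "set us \<subseteq> carrier G" "set vs \<subseteq> carrier G" for us vs
  proof -
    have cl: "foldr (\<lambda>x y. x \<otimes> y) ws \<one> \<in> carrier G" if "set ws \<subseteq> carrier G" for ws
      using that by (induction ws) auto
    then show "foldr (\<lambda>x y. x \<otimes> y) us \<one> \<in> carrier G" using that by blast
    show "foldr (\<lambda>x y. x \<otimes> y) (us @ vs) \<one> = foldr (\<lambda>x y. x \<otimes> y) us \<one> \<otimes> foldr (\<lambda>x y. x \<otimes> y) vs \<one>"
      using that(1) by (induction us) (auto simp: m_assoc cl[OF that(2)] cl)
  qed
  obtain us vs where us: "set us \<subseteq> S \<union> (\<lambda>s. inv s) ` S" "foldr (\<lambda>x y. x \<otimes> y) us \<one> = g"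
    and vs: "set vs \<subseteq> S \<union> (\<lambda>s. inv s) ` S" "foldr (\<lambda>x y. x \<otimes> y) vs \<one> = h"
    using eng by auto
  have sub: "S \<union> (\<lambda>s. inv s) ` S \<subseteq> carrier G" using S by auto
  show ?case
    using us vs app[of us vs] sub by (intro exI[of _ "us @ vs"]) auto
qed

text \<open>An infinite set has \<open>card\<close> 0, so finiteness must be known before
  cardinalities are compared. The boundary lies in the product of \<open>L\<close> with the inverses
  of a ball of words, and there are finitely many words of bounded length.\<close>

lemma finite_group_boundary:
  assumes S: "finite_generating_set G S" and L: "finite L" "L \<subseteq> carrier G"
  shows "finite (group_boundary G S \<delta> L)"
proof -
  let ?T = "S \<union> (\<lambda>s. inv s) ` S"
  let ?B = "(\<lambda>ws. foldr (\<lambda>x y. x \<otimes> y) ws \<one>) ` {ws. set ws \<subseteq> ?T \<and> length ws \<le> nat \<lceil>\<delta>\<rceil>}"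
  have Sc: "S \<subseteq> carrier G" "finite S" "generate G S = carrier G"
    using S by (auto simp: finite_generating_set_def)
  have finB: "finite ?B"
    using finite_lists_length_le[of ?T] Sc by (intro finite_imageI) auto
  have "group_boundary G S \<delta> L \<subseteq> (\<lambda>(l, b). l \<otimes> inv b) ` (L \<times> ?B)"
  proof
    fix g assume "g \<in> group_boundary G S \<delta> L"
    then have g: "g \<in> carrier G" and "word_setdist G S g L < ereal \<delta>"
      by (auto simp: group_boundary_def)
    then obtain l where l: "l \<in> L" and "word_dist G S g l < \<delta>"
      by (auto simp: word_setdist_def INF_less_iff)
    then have len: "word_length G S (inv g \<otimes> l) \<le> nat \<lceil>\<delta>\<rceil>"
      by (auto simp: word_dist_def) linarith
    have lc: "l \<in> carrier G" using l L by auto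
    let ?P = "\<lambda>n. \<exists>ws. length ws = n \<and> set ws \<subseteq> ?T \<and> foldr (\<lambda>x y. x \<otimes> y) ws \<one> = inv g \<otimes> l"
    obtain ws0 where "set ws0 \<subseteq> ?T" "foldr (\<lambda>x y. x \<otimes> y) ws0 \<one> = inv g \<otimes> l"
      using generate_word[of S "inv g \<otimes> l"] Sc g lc by auto
    then have "?P (length ws0)" by blast
    then have "?P (word_length G S (inv g \<otimes> l))"
      unfolding word_length_def by (rule LeastI)
    then obtain ws where "length ws = word_length G S (inv g \<otimes> l)" "set ws \<subseteq> ?T"
      and ws: "foldr (\<lambda>x y. x \<otimes> y) ws \<one> = inv g \<otimes> l" by blast
    then have "ws \<in> {ws. set ws \<subseteq> ?T \<and> length ws \<le> nat \<lceil>\<delta>\<rceil>}" using len by simp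
    then have "foldr (\<lambda>x y. x \<otimes> y) ws \<one> \<in> ?B" by (rule imageI)
    then have "inv g \<otimes> l \<in> ?B" by (simp only: ws)
    moreover have "g = l \<otimes> inv (inv g \<otimes> l)"
      using g lc by (simp add: inv_mult_group m_assoc[symmetric])
    ultimately show "g \<in> (\<lambda>(l, b). l \<otimes> inv b) ` (L \<times> ?B)" using l by force
  qed
  then show ?thesis
    by (rule finite_subset) (use L finB in auto)
qed

text \<open>The point \<open>g\<close> witnesses nearness to \<open>L\<close>, and
  \<open>g \<otimes> h\<close> nearness to the complement. The radius adds both word lengths, and 1
  more because the boundary is defined by strict inequalities.\<close>

lemma boundary_translate:
  assumes L: "L \<subseteq> carrier G" and g: "g \<in> L" and h: "h \<in> carrier G" and gh: "g \<otimes> h \<notin> L"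
  shows "g \<in> group_boundary G S (real (word_length G S h + word_length G S \<one>) + 1) L"
proof -
  have gc: "g \<in> carrier G" using L g by auto
  have "word_setdist G S g L \<le> ereal (real (word_dist G S g g))"
    unfolding word_setdist_def by (rule INF_lower[OF g])
  also have "word_dist G S g g = word_length G S \<one>"
    using gc by (simp add: word_dist_def)
  finally have 1: "word_setdist G S g L \<le> ereal (real (word_length G S \<one>))" .
  have "word_setdist G S g (carrier G - L) \<le> ereal (real (word_dist G S g (g \<otimes> h)))"
    unfolding word_setdist_def by (rule INF_lower) (use gc h gh in auto)
  also have "word_dist G S g (g \<otimes> h) = word_length G S h"
    using gc h by (simp add: word_dist_def m_assoc[symmetric])
  finally have 2: "word_setdist G S g (carrier G - L) \<le> ereal (real (word_length G S h))" .
  show ?thesis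
    unfolding group_boundary_def using gc
    by (auto intro: order.strict_trans1[OF 1] order.strict_trans1[OF 2])
qed

text \<open>The elements from which every product of at most \<open>j\<close> right steps in
  \<open>K\<close> stays in \<open>L\<close>. Right multiplication is the relevant one: left
  translations act on the graph, so neighbours of the translate by \<open>g\<close> are translates
  by \<open>g \<otimes> h\<close> with \<open>h\<close> from a fixed finite set.\<close>

fun deep :: "'a set \<Rightarrow> 'a set \<Rightarrow> nat \<Rightarrow> 'a set" where
  "deep K L 0 = L"
| "deep K L (Suc j) = {g \<in> deep K L j. \<forall>h\<in>K. g \<otimes> h \<in> deep K L j}"

lemma deep_subset: "deep K L j \<subseteq> L"
  by (induction j) auto

context
  fixes S :: "'a set" and \<Lambda> :: "nat \<Rightarrow> 'a set"
  assumes S: "finite_generating_set G S" and \<Lambda>: "regular_exhaustion G S \<Lambda>"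
begin

lemma exhaustion_finite: "finite (\<Lambda> m)" and exhaustion_carrier: "\<Lambda> m \<subseteq> carrier G"
  using \<Lambda> by (auto simp: regular_exhaustion_def)

lemma foelner:
  assumes h: "h \<in> carrier G"
  shows "(\<lambda>m. real (card {g \<in> \<Lambda> m. g \<otimes> h \<notin> \<Lambda> m}) / real (card (\<Lambda> m))) \<longlonglongrightarrow> 0"
proof (rule tendsto_sandwich[OF _ _ tendsto_const])
  let ?\<delta> = "real (word_length G S h + word_length G S \<one>) + 1"
  show "(\<lambda>m. real (card (group_boundary G S ?\<delta> (\<Lambda> m))) / real (card (\<Lambda> m))) \<longlonglongrightarrow> 0"
    using \<Lambda> unfolding regular_exhaustion_def by (simp add: add_nonneg_pos)
  show "\<forall>\<^sub>F m in sequentially. real (card {g \<in> \<Lambda> m. g \<otimes> h \<notin> \<Lambda> m}) / real (card (\<Lambda> m))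
      \<le> real (card (group_boundary G S ?\<delta> (\<Lambda> m))) / real (card (\<Lambda> m))"
  proof (intro always_eventually allI divide_right_mono)
    fix m
    have "card {g \<in> \<Lambda> m. g \<otimes> h \<notin> \<Lambda> m} \<le> card (group_boundary G S ?\<delta> (\<Lambda> m))"
      by (intro card_mono finite_group_boundary[OF S] exhaustion_finite exhaustion_carrier)
        (use boundary_translate[OF exhaustion_carrier[of m] _ h, of _ S] in blast)
    then show "real (card {g \<in> \<Lambda> m. g \<otimes> h \<notin> \<Lambda> m}) \<le> real (card (group_boundary G S ?\<delta> (\<Lambda> m)))"
      by simp
  qed simp
qed (simp add: always_eventually)

text \<open>An element leaves the deep part at stage \<open>Suc j\<close> if it was missing at stage
  \<open>j\<close>, or some step leaves \<open>L\<close>, or some step lands in the shallow part of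
  stage \<open>j\<close>; the last kind is counted through injectivity of right translation.\<close>

lemma card_shallow:
  assumes K: "finite K" "K \<subseteq> carrier G" and L: "finite L" "L \<subseteq> carrier G"
  shows "card (L - deep K L (Suc j)) \<le> card (L - deep K L j)
    + (\<Sum>h\<in>K. card {g \<in> L. g \<otimes> h \<notin> L} + card (L - deep K L j))"
proof -
  let ?D = "L - deep K L j"
  have "L - deep K L (Suc j) \<subseteq> ?D \<union> (\<Union>h\<in>K. {g \<in> L. g \<otimes> h \<notin> L} \<union> {g \<in> L. g \<otimes> h \<in> ?D})"
    using L K by auto
  then have "card (L - deep K L (Suc j)) \<le> card (?D \<union> (\<Union>h\<in>K. {g \<in> L. g \<otimes> h \<notin> L} \<union> {g \<in> L. g \<otimes> h \<in> ?D}))"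
    by (intro card_mono) (use K L in auto)
  also have "\<dots> \<le> card ?D + card (\<Union>h\<in>K. {g \<in> L. g \<otimes> h \<notin> L} \<union> {g \<in> L. g \<otimes> h \<in> ?D})"
    by (rule card_Un_le)
  also have "\<dots> \<le> card ?D + (\<Sum>h\<in>K. card ({g \<in> L. g \<otimes> h \<notin> L} \<union> {g \<in> L. g \<otimes> h \<in> ?D}))"
    by (intro add_left_mono card_UN_le K)
  also have "\<dots> \<le> card ?D + (\<Sum>h\<in>K. card {g \<in> L. g \<otimes> h \<notin> L} + card ?D)"
  proof (intro add_left_mono sum_mono)
    fix h assume h: "h \<in> K"
    have "inj_on (\<lambda>g. g \<otimes> h) {g \<in> L. g \<otimes> h \<in> ?D}"
      using h K(2) L(2) by (auto simp: inj_on_def subset_iff)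
    then have "card {g \<in> L. g \<otimes> h \<in> ?D} \<le> card ?D"
      by (rule card_inj_on_le) (use L in auto)
    then show "card ({g \<in> L. g \<otimes> h \<notin> L} \<union> {g \<in> L. g \<otimes> h \<in> ?D}) \<le> card {g \<in> L. g \<otimes> h \<notin> L} + card ?D"
      using card_Un_le[of "{g \<in> L. g \<otimes> h \<notin> L}" "{g \<in> L. g \<otimes> h \<in> ?D}"] by linarith
  qed
  finally show ?thesis .
qed

lemma shallow_negligible:
  assumes K: "finite K" "K \<subseteq> carrier G"
  shows "(\<lambda>m. real (card (\<Lambda> m - deep K (\<Lambda> m) j)) / real (card (\<Lambda> m))) \<longlonglongrightarrow> 0"
proof (induction j)
  case (Suc j)
  let ?r = "\<lambda>m. real (card (\<Lambda> m - deep K (\<Lambda> m) j)) / real (card (\<Lambda> m))"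
  let ?b = "\<lambda>m h. real (card {g \<in> \<Lambda> m. g \<otimes> h \<notin> \<Lambda> m}) / real (card (\<Lambda> m))"
  show ?case
  proof (rule tendsto_sandwich[OF _ _ tendsto_const])
    have "(\<lambda>m. ?r m + (\<Sum>h\<in>K. ?b m h + ?r m)) \<longlonglongrightarrow> 0 + (\<Sum>h\<in>K. 0 + 0)"
      by (intro tendsto_add tendsto_sum Suc.IH foelner) (use K in auto)
    then show "(\<lambda>m. ?r m + (\<Sum>h\<in>K. ?b m h + ?r m)) \<longlonglongrightarrow> 0" by simp
    show "\<forall>\<^sub>F m in sequentially. real (card (\<Lambda> m - deep K (\<Lambda> m) (Suc j))) / real (card (\<Lambda> m))
        \<le> ?r m + (\<Sum>h\<in>K. ?b m h + ?r m)"
    proof (intro always_eventually allI)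
      fix m
      have "real (card (\<Lambda> m - deep K (\<Lambda> m) (Suc j))) \<le> real (card (\<Lambda> m - deep K (\<Lambda> m) j)
          + (\<Sum>h\<in>K. card {g \<in> \<Lambda> m. g \<otimes> h \<notin> \<Lambda> m} + card (\<Lambda> m - deep K (\<Lambda> m) j)))"
        using card_shallow[OF K exhaustion_finite exhaustion_carrier] by (simp only: of_nat_le_iff)
      then have "real (card (\<Lambda> m - deep K (\<Lambda> m) (Suc j))) / real (card (\<Lambda> m)) \<le> real (card (\<Lambda> m - deep K (\<Lambda> m) j)
          + (\<Sum>h\<in>K. card {g \<in> \<Lambda> m. g \<otimes> h \<notin> \<Lambda> m} + card (\<Lambda> m - deep K (\<Lambda> m) j))) / real (card (\<Lambda> m))"
        by (rule divide_right_mono) simp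
      then show "real (card (\<Lambda> m - deep K (\<Lambda> m) (Suc j))) / real (card (\<Lambda> m)) \<le> ?r m + (\<Sum>h\<in>K. ?b m h + ?r m)"
        by (simp only: of_nat_add of_nat_sum add_divide_distrib sum_divide_distrib)
    qed
  qed (simp add: always_eventually)
qed simp

end

end

section \<open>Magnetic Laplacians on covering graphs\<close>

locale magnetic_cover =
  fixes X :: "('v, 'e) pre_digraph" and bar :: "'e \<Rightarrow> 'e" and Ep :: "'e set"
    and G :: "('g, 'm) monoid_scheme" and \<rho>V :: "'g \<Rightarrow> 'v \<Rightarrow> 'v" and \<rho>E :: "'g \<Rightarrow> 'e \<Rightarrow> 'e"
    and FV :: "'v set" and FE :: "'e set set" and \<sigma> :: "'e \<Rightarrow> complex"
  assumes X: "bidirected_digraph X bar" and Ep: "orientation X bar Ep" and group: "group G"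
    and free: "free_graph_action G X bar \<rho>V \<rho>E"
    and fundamental: "fundamental_domain G X bar \<rho>V \<rho>E FV FE"
    and \<sigma>: "weight_function X bar \<sigma>" and invariant: "weakly_invariant G X \<rho>E \<sigma>"
begin

sublocale bidirected_digraph X bar by (rule X)
sublocale G: group G by (rule group)

lemma V_action: "group_action G (verts X) \<rho>V" and E_action: "group_action G (arcs X) \<rho>E"
  using free by (simp_all add: free_graph_action_def graph_action_def)

lemma tail_action: "g \<in> carrier G \<Longrightarrow> e \<in> arcs X \<Longrightarrow> tail X (\<rho>E g e) = \<rho>V g (tail X e)"
  and head_action: "g \<in> carrier G \<Longrightarrow> e \<in> arcs X \<Longrightarrow> head X (\<rho>E g e) = \<rho>V g (head X e)"
  and bar_action: "g \<in> carrier G \<Longrightarrow> e \<in> arcs X \<Longrightarrow> bar (\<rho>E g e) = \<rho>E g (bar e)"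
  using free by (simp_all add: free_graph_action_def graph_action_def)

lemma V_fixed: "g \<in> carrier G \<Longrightarrow> v \<in> verts X \<Longrightarrow> \<rho>V g v = v \<Longrightarrow> g = \<one>\<^bsub>G\<^esub>"
  using free unfolding free_graph_action_def by (elim conjE) metis

sublocale V: group_action G "verts X" \<rho>V by (rule V_action)
sublocale E: group_action G "arcs X" \<rho>E by (rule E_action)

lemma V_closed: "g \<in> carrier G \<Longrightarrow> v \<in> verts X \<Longrightarrow> \<rho>V g v \<in> verts X"
  using V.element_image by blast

lemma E_closed: "g \<in> carrier G \<Longrightarrow> e \<in> arcs X \<Longrightarrow> \<rho>E g e \<in> arcs X"
  using E.element_image by blast

lemma V_inv: "g \<in> carrier G \<Longrightarrow> v \<in> verts X \<Longrightarrow> \<rho>V (inv\<^bsub>G\<^esub> g) (\<rho>V g v) = v"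
  using V.orbit_sym_aux by blast

lemma E_inv: "g \<in> carrier G \<Longrightarrow> e \<in> arcs X \<Longrightarrow> \<rho>E (inv\<^bsub>G\<^esub> g) (\<rho>E g e) = e"
  using E.orbit_sym_aux by blast

lemma E_inv': "g \<in> carrier G \<Longrightarrow> e \<in> arcs X \<Longrightarrow> \<rho>E g (\<rho>E (inv\<^bsub>G\<^esub> g) e) = e"
  using E_inv[of "inv\<^bsub>G\<^esub> g" e] by simp

lemma V_inj:
  assumes "g \<in> carrier G" "h \<in> carrier G" "v \<in> verts X" "\<rho>V g v = \<rho>V h v"
  shows "g = h"
proof -
  have "\<rho>V (inv\<^bsub>G\<^esub> h \<otimes>\<^bsub>G\<^esub> g) v = v"
    using assms by (simp add: V.composition_rule V_inv)
  then have "inv\<^bsub>G\<^esub> h \<otimes>\<^bsub>G\<^esub> g = \<one>\<^bsub>G\<^esub>"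
    using assms by (intro V_fixed) auto
  then show ?thesis
    using assms by (metis G.inv_equality G.inv_inv G.inv_closed)
qed

lemma FV_finite: "finite FV" and FV_verts: "FV \<subseteq> verts X" and FE_finite: "finite FE"
  and FE_edges: "FE \<subseteq> unoriented_edges X bar"
  using fundamental by (simp_all add: fundamental_domain_def)

lemma FV_ex1: "v \<in> verts X \<Longrightarrow> \<exists>!w. w \<in> FV \<and> (\<exists>g\<in>carrier G. w = \<rho>V g v)"
  using fundamental unfolding fundamental_domain_def by (elim conjE) (erule bspec)

lemma FE_ex1: "u \<in> unoriented_edges X bar \<Longrightarrow> \<exists>!w. w \<in> FE \<and> (\<exists>g\<in>carrier G. w = \<rho>E g ` u)"
  using fundamental unfolding fundamental_domain_def by (elim conjE) (erule bspec)

lemma vertex_cover: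
  assumes "v \<in> verts X" shows "\<exists>g\<in>carrier G. \<exists>w\<in>FV. v = \<rho>V g w"
proof -
  obtain w g where w: "w \<in> FV" "g \<in> carrier G" "w = \<rho>V g v" using FV_ex1[OF assms] by blast
  then have "v = \<rho>V (inv\<^bsub>G\<^esub> g) w" using V_inv assms by simp
  then show ?thesis using w by blast
qed

lemma vertex_unique:
  assumes "g \<in> carrier G" "h \<in> carrier G" "w \<in> FV" "w' \<in> FV" "\<rho>V g w = \<rho>V h w'"
  shows "g = h \<and> w = w'"
proof -
  have wv: "w \<in> verts X" "w' \<in> verts X" using assms FV_verts by auto
  have v: "\<rho>V g w \<in> verts X" using V_closed assms wv by blast
  have "w = \<rho>V (inv\<^bsub>G\<^esub> g) (\<rho>V g w)" by (rule V_inv[OF assms(1) wv(1), symmetric])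
  moreover have "w' = \<rho>V (inv\<^bsub>G\<^esub> h) (\<rho>V g w)"
    unfolding assms(5) by (rule V_inv[OF assms(2) wv(2), symmetric])
  ultimately have "w = w'"
    using FV_ex1[OF v] assms(3,4) G.inv_closed[OF assms(1)] G.inv_closed[OF assms(2)] by blast
  then show ?thesis using V_inj[of g h w] assms wv by blast
qed

text \<open>A uniform bound for all valences: the number of arcs lying over the finitely many edges
  of the fundamental domain.\<close>

definition D :: nat where "D = card {e \<in> arcs X. {e, bar e} \<in> FE}"

lemma finite_edge_reps: "finite {e \<in> arcs X. {e, bar e} \<in> FE}"
proof (rule finite_subset)
  show "{e \<in> arcs X. {e, bar e} \<in> FE} \<subseteq> \<Union>FE" by auto
  show "finite (\<Union>FE)" using FE_finite FE_edges by (auto simp: unoriented_edges_def)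
qed

text \<open>Sending each arc into \<open>v\<close> to a representative over \<open>FE\<close> is
  injective: equal images have equal heads, so freeness on vertices makes the translating elements
  equal, and hence the arcs.\<close>

lemma
  shows finite_in: "finite {e \<in> arcs X. head X e = v}"
    and card_in: "card {e \<in> arcs X. head X e = v} \<le> D"
proof -
  let ?I = "{e \<in> arcs X. head X e = v}" and ?R = "{e \<in> arcs X. {e, bar e} \<in> FE}"
  have "\<exists>g\<in>carrier G. \<rho>E g e \<in> ?R" if e: "e \<in> arcs X" for e
  proof -
    have "{e, bar e} \<in> unoriented_edges X bar" using e by (auto simp: unoriented_edges_def)
    then obtain g where g: "g \<in> carrier G" "\<rho>E g ` {e, bar e} \<in> FE" using FE_ex1 by blast
    then have "\<rho>E g e \<in> ?R" using e E_closed by (simp add: bar_action)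
    then show ?thesis using g by blast
  qed
  then obtain r where r: "\<And>e. e \<in> arcs X \<Longrightarrow> r e \<in> carrier G" "\<And>e. e \<in> arcs X \<Longrightarrow> \<rho>E (r e) e \<in> ?R"
    by metis
  have inj: "inj_on (\<lambda>e. \<rho>E (r e) e) ?I"
  proof (rule inj_onI)
    fix e e' assume e: "e \<in> ?I" and e': "e' \<in> ?I" and eq: "\<rho>E (r e) e = \<rho>E (r e') e'"
    have v: "v \<in> verts X" using e by auto
    have "\<rho>V (r e) v = \<rho>V (r e') v"
      using head_action[of "r e" e] head_action[of "r e'" e'] e e' eq r(1) by simp
    then have re: "r e = r e'" using V_inj r(1) e e' v by blast
    have "e = \<rho>E (inv\<^bsub>G\<^esub> (r e)) (\<rho>E (r e) e)" using e r(1) by (intro E_inv[symmetric]) auto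
    also have "\<dots> = \<rho>E (inv\<^bsub>G\<^esub> (r e')) (\<rho>E (r e') e')" by (subst eq, subst re) (rule refl)
    also have "\<dots> = e'" using e' r(1) by (intro E_inv) auto
    finally show "e = e'" .
  qed
  have sub: "(\<lambda>e. \<rho>E (r e) e) ` ?I \<subseteq> ?R"
    by (intro image_subsetI r(2)) simp
  show "finite ?I" by (rule inj_on_finite[OF inj sub finite_edge_reps])
  show "card ?I \<le> D" unfolding D_def by (rule card_inj_on_le[OF inj sub finite_edge_reps])
qed

lemma in_degree_eq: "in_degree X v = card {e \<in> arcs X. head X e = v}"
  by (simp add: in_degree_def in_arcs_def)

lemma \<sigma>_unit: "e \<in> arcs X \<Longrightarrow> cmod (\<sigma> e) = 1"
  using \<sigma> by (auto simp: weight_function_def)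

lemma \<sigma>_bar: "e \<in> arcs X \<Longrightarrow> \<sigma> (bar e) = cnj (\<sigma> e)"
  by (rule weight_function_bar[OF \<sigma>])

abbreviation \<Delta> where "\<Delta> \<equiv> magnetic_op (verts X) (arcs X) (tail X) (head X) (in_degree X) \<sigma>"

lemma dml_eq: "dml X Ep \<sigma> = \<Delta>"
  by (intro ext) (subst dml_eq_magnetic_op[OF X Ep \<sigma>], auto simp: finite_in)

sublocale mX: magnetic "verts X" "arcs X" "tail X" "head X" bar "in_degree X" \<sigma> D
  by unfold_locales (auto simp: \<sigma>_unit \<sigma>_bar in_degree_eq card_in finite_in)

section \<open>Dirichlet and Neumann operators on the exhaustion\<close>

abbreviation Y where "Y L \<equiv> exhaustion_graph X bar \<rho>V \<rho>E FV FE L"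

definition W where "W L = (\<Union>g\<in>L. \<rho>V g ` FV)"

text \<open>Compression keeps every arc of \<open>X\<close> between two vertices of
  \<open>W L\<close>, even if its edge is in none of the translates of \<open>FE\<close>; the
  Neumann operator keeps only the arcs of the subgraph.\<close>

definition bc_arcs :: "boundary_condition \<Rightarrow> 'g set \<Rightarrow> 'e set" where
  "bc_arcs bc L = (case bc of Dirichlet \<Rightarrow> {e \<in> arcs X. tail X e \<in> W L \<and> head X e \<in> W L} | Neumann \<Rightarrow> arcs (Y L))"

definition bc_deg :: "boundary_condition \<Rightarrow> 'g set \<Rightarrow> 'v \<Rightarrow> nat" where
  "bc_deg bc L = (case bc of Dirichlet \<Rightarrow> in_degree X | Neumann \<Rightarrow> in_degree (Y L))"

abbreviation \<Delta>\<^sub>L where "\<Delta>\<^sub>L bc L \<equiv> magnetic_op (W L) (bc_arcs bc L) (tail X) (head X) (bc_deg bc L) \<sigma>"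

lemma verts_Y: "verts (Y L) = W L"
  by (simp add: exhaustion_graph_def largest_subgraph_in_def W_def)

lemma arcs_Y: "arcs (Y L) = {e \<in> arcs X. {e, bar e} \<in> (\<Union>g\<in>L. (\<lambda>u. \<rho>E g ` u) ` FE) \<and> tail X e \<in> W L \<and> head X e \<in> W L}"
  by (simp add: exhaustion_graph_def largest_subgraph_in_def W_def)

lemma tail_Y: "tail (Y L) = tail X" and head_Y: "head (Y L) = head X"
  by (simp_all add: exhaustion_graph_def largest_subgraph_in_def)

lemma bar_Y: "bar ` arcs (Y L) \<subseteq> arcs (Y L)"
proof
  fix e assume "e \<in> bar ` arcs (Y L)"
  then obtain e' where e': "e' \<in> arcs (Y L)" "e = bar e'" by blast
  have "{e, bar e} = {e', bar e'}" using e'(2) by auto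
  then show "e \<in> arcs (Y L)" using e' unfolding arcs_Y by simp
qed

lemma bc_arcs_subset: "bc_arcs bc L \<subseteq> {e \<in> arcs X. tail X e \<in> W L \<and> head X e \<in> W L}"
  by (cases bc) (auto simp: bc_arcs_def arcs_Y)

lemma bc_arcs_D: "e \<in> bc_arcs bc L \<Longrightarrow> e \<in> arcs X" "e \<in> bc_arcs bc L \<Longrightarrow> tail X e \<in> W L"
  "e \<in> bc_arcs bc L \<Longrightarrow> head X e \<in> W L"
  using bc_arcs_subset by blast+

lemma bc_arcs_bar: "e \<in> bc_arcs bc L \<Longrightarrow> bar e \<in> bc_arcs bc L"
  using bar_Y[of L] by (cases bc) (auto simp: bc_arcs_def)

lemma magnetic_L: "magnetic (W L) (bc_arcs bc L) (tail X) (head X) bar (bc_deg bc L) \<sigma> D"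
proof
  have sub: "{e \<in> bc_arcs bc L. head X e = v} \<subseteq> {e \<in> arcs X. head X e = v}" for v bc
    using bc_arcs_subset by auto
  show "finite {e \<in> bc_arcs bc L. head X e = v}" for v
    by (rule finite_subset[OF sub finite_in])
  show "card {e \<in> bc_arcs bc L. head X e = v} \<le> D" for v
    using card_mono[OF finite_in sub] card_in order_trans by blast
  show "bc_deg bc L v \<le> D" for v
  proof (cases bc)
    case Dirichlet
    then show ?thesis by (simp add: bc_deg_def in_degree_eq card_in)
  next
    case Neumann
    have "in_degree (Y L) v = card {e \<in> bc_arcs Neumann L. head X e = v}"
      by (simp add: in_degree_def in_arcs_def head_Y bc_arcs_def)
    then show ?thesis
      using card_mono[OF finite_in sub[of Neumann v]] card_in[of v] Neumann by (simp add: bc_deg_def)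
  qed
qed (simp_all add: bc_arcs_bar \<sigma>_bar \<sigma>_unit bc_arcs_D)

lemma eigenvalue_count_restricted:
  "eigenvalue_count (verts (Y L)) (restricted_dml bc X Ep \<sigma> (Y L)) = eigenvalue_count (W L) (\<Delta>\<^sub>L bc L)"
  unfolding verts_Y
proof (rule eigenvalue_count_cong)
  fix f :: "'v \<Rightarrow> complex" assume f: "\<And>v. v \<notin> W L \<Longrightarrow> f v = 0"
  show "restricted_dml bc X Ep \<sigma> (Y L) f = \<Delta>\<^sub>L bc L f"
  proof (cases bc)
    case Neumann
    have fin: "finite {e \<in> arcs (Y L). head X e = v}" for v
      by (rule finite_subset[OF _ finite_in[of v]]) (auto simp: arcs_Y)
    have "dml (Y L) Ep \<sigma> f = \<Delta>\<^sub>L Neumann L f"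
      by (subst dml_eq_magnetic_op[OF X Ep \<sigma>])
        (use bar_Y[of L] fin in \<open>auto simp: tail_Y head_Y verts_Y bc_arcs_def bc_deg_def arcs_Y\<close>)
    then show ?thesis using Neumann by simp
  next
    case Dirichlet
    have rf: "restrict_support (W L) f = f" using f by (auto simp: restrict_support_def fun_eq_iff)
    have "restrict_support (W L) (\<Delta> f) v = \<Delta>\<^sub>L Dirichlet L f v" for v
    proof (cases "v \<in> W L \<and> v \<in> verts X")
      case True
      have "(\<Sum>e | e \<in> bc_arcs Dirichlet L \<and> head X e = v. \<sigma> e * f (tail X e))
          = (\<Sum>e | e \<in> arcs X \<and> head X e = v. \<sigma> e * f (tail X e))"
        by (rule sum.mono_neutral_left[OF finite_in]) (use True f in \<open>auto simp: bc_arcs_def\<close>)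
      then show ?thesis using True by (simp add: restrict_support_def magnetic_op_def bc_deg_def)
    next
      \<comment> \<open>\<open>L\<close> is an arbitrary set here, so \<open>W L\<close> may contain
        points that are not vertices; there no arc ends and both sides are zero.\<close>
      case False
      show ?thesis
      proof (cases "v \<in> W L")
        case True
        with False have v: "v \<notin> verts X" by simp
        have z: "{e. e \<in> bc_arcs Dirichlet L \<and> head X e = v} = {}" "in_degree X v = 0"
          using v by (auto simp: bc_arcs_def in_degree_eq card_eq_0_iff)
        show ?thesis using v True by (simp add: restrict_support_def magnetic_op_def bc_deg_def z)
      qed (simp add: restrict_support_def magnetic_op_def)
    qed
    then show ?thesis
      using Dirichlet by (simp add: verts_Y rf dml_eq fun_eq_iff)
  qed
qed

text \<open>By equivariance one finite set of right displacements works at every \<open>g\<close>.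
  Displacements of edges are recorded besides those of vertices, because an arc belongs to the
  Neumann graph only if its edge lies in the translates of \<open>FE\<close>.\<close>

definition neighbour_set :: "'g set \<Rightarrow> bool" where
  "neighbour_set K \<longleftrightarrow> finite K \<and> K \<subseteq> carrier G \<and>
    (\<forall>g\<in>carrier G. \<forall>w\<in>FV. \<forall>e\<in>arcs X. head X e = \<rho>V g w \<longrightarrow>
      (\<exists>h\<in>K. \<exists>w'\<in>FV. tail X e = \<rho>V (g \<otimes>\<^bsub>G\<^esub> h) w') \<and>
      (\<exists>h\<in>K. \<exists>u\<in>FE. {e, bar e} = \<rho>E (g \<otimes>\<^bsub>G\<^esub> h) ` u))"

lemma neighbour_set_exists: "\<exists>K. neighbour_set K"
proof -
  define I where "I = {e \<in> arcs X. head X e \<in> FV}"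
  have "I = (\<Union>w\<in>FV. {e \<in> arcs X. head X e = w})" by (auto simp: I_def)
  then have finI: "finite I" by (simp add: FV_finite finite_in)
  have "\<exists>h\<in>carrier G. \<exists>w'\<in>FV. tail X e = \<rho>V h w'" if "e \<in> arcs X" for e
    by (rule vertex_cover) (use that in simp)
  then obtain t where t: "\<And>e. e \<in> arcs X \<Longrightarrow> t e \<in> carrier G" "\<And>e. e \<in> arcs X \<Longrightarrow> \<exists>w'\<in>FV. tail X e = \<rho>V (t e) w'"
    by metis
  have "\<exists>h\<in>carrier G. \<exists>u\<in>FE. {e, bar e} = \<rho>E h ` u" if e: "e \<in> arcs X" for e
  proof -
    have "{e, bar e} \<in> unoriented_edges X bar" using e by (auto simp: unoriented_edges_def)
    then obtain g where g: "g \<in> carrier G" "\<rho>E g ` {e, bar e} \<in> FE" using FE_ex1 by blast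
    have "{e, bar e} = \<rho>E (inv\<^bsub>G\<^esub> g) ` (\<rho>E g ` {e, bar e})"
      using e g by (simp add: E_inv)
    then show ?thesis using g by (meson G.inv_closed)
  qed
  then obtain s where s: "\<And>e. e \<in> arcs X \<Longrightarrow> s e \<in> carrier G" "\<And>e. e \<in> arcs X \<Longrightarrow> \<exists>u\<in>FE. {e, bar e} = \<rho>E (s e) ` u"
    by metis
  show ?thesis
    unfolding neighbour_set_def
  proof (intro exI[of _ "t ` I \<union> s ` I"] conjI[OF _ conjI] ballI impI)
    show "finite (t ` I \<union> s ` I)" using finI by simp
    show "t ` I \<union> s ` I \<subseteq> carrier G" using t s by (auto simp: I_def)
    fix g w e assume g: "g \<in> carrier G" and w: "w \<in> FV" and e: "e \<in> arcs X" and he: "head X e = \<rho>V g w"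
    \<comment> \<open>Translating back by \<open>g\<close> puts the head into \<open>FV\<close>;
      only finitely many such arcs exist, and their displacements form the set.\<close>
    define e' where "e' = \<rho>E (inv\<^bsub>G\<^esub> g) e"
    have e': "e' \<in> arcs X" unfolding e'_def using g e by (simp add: E_closed)
    have ee': "e = \<rho>E g e'" unfolding e'_def using g e by (simp add: E_inv')
    have wv: "w \<in> verts X" using w FV_verts by auto
    have "head X e' = w" unfolding e'_def using g e he wv by (simp add: head_action V_inv)
    then have e'I: "e' \<in> I" using e' w by (simp add: I_def)
    obtain w' where w': "w' \<in> FV" "tail X e' = \<rho>V (t e') w'" using t(2)[OF e'] by blast
    have te: "tail X e = \<rho>V (g \<otimes>\<^bsub>G\<^esub> t e') w'"
      using ee' w' g t(1)[OF e'] e' FV_verts by (simp add: tail_action V.composition_rule subsetD)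
    obtain u where u: "u \<in> FE" "{e', bar e'} = \<rho>E (s e') ` u" using s(2)[OF e'] by blast
    have uX: "u \<subseteq> arcs X" using u FE_edges by (auto simp: unoriented_edges_def)
    have "{e, bar e} = \<rho>E g ` {e', bar e'}" using ee' g e' by (simp add: bar_action)
    also have "\<dots> = \<rho>E (g \<otimes>\<^bsub>G\<^esub> s e') ` u"
      unfolding u(2) image_image using uX g s(1)[OF e']
      by (intro image_cong) (auto simp: E.composition_rule)
    finally show "(\<exists>h\<in>t ` I \<union> s ` I. \<exists>w'\<in>FV. tail X e = \<rho>V (g \<otimes>\<^bsub>G\<^esub> h) w')
        \<and> (\<exists>h\<in>t ` I \<union> s ` I. \<exists>u\<in>FE. {e, bar e} = \<rho>E (g \<otimes>\<^bsub>G\<^esub> h) ` u)"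
      using te w' u(1) e'I by blast
  qed
qed

text \<open>Gauge transformation: \<open>f \<mapsto> cnj s * (f \<circ> g)\<close> commutes with \<open>\<Delta>\<close>.\<close>

lemma diagonal_invariant:
  assumes g: "g \<in> carrier G" and v: "v \<in> verts X"
  shows "(\<Delta> ^^ k) (delta (\<rho>V g v)) (\<rho>V g v) = (\<Delta> ^^ k) (delta v) v"
proof -
  obtain s where s: "\<And>v. v \<in> verts X \<Longrightarrow> cmod (s v) = 1"
    and \<sigma>g: "\<And>e. e \<in> arcs X \<Longrightarrow> \<sigma> (\<rho>E g e) = \<sigma> e * s (head X e) * cnj (s (tail X e))"
  proof -
    have "\<exists>s :: 'v \<Rightarrow> complex. (\<forall>v\<in>verts X. cmod (s v) = 1) \<and>
        (\<forall>e\<in>arcs X. \<sigma> (\<rho>E g e) = \<sigma> e * s (head X e) * cnj (s (tail X e)))"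
      using invariant unfolding weakly_invariant_def by (rule bspec[OF _ g])
    then show thesis using that by blast
  qed
  define U where "U f = (\<lambda>x. if x \<in> verts X then cnj (s x) * f (\<rho>V g x) else 0)" for f :: "'v \<Rightarrow> complex"
  have comm: "\<Delta> (U f) = U (\<Delta> f)" for f
  proof
    fix x
    show "\<Delta> (U f) x = U (\<Delta> f) x"
    proof (cases "x \<in> verts X")
      case True
      have bij: "bij_betw (\<rho>E g) {e. e \<in> arcs X \<and> head X e = x} {e. e \<in> arcs X \<and> head X e = \<rho>V g x}"
      proof (rule bij_betwI[where g = "\<rho>E (inv\<^bsub>G\<^esub> g)"])
        show "\<rho>E g \<in> {e. e \<in> arcs X \<and> head X e = x} \<rightarrow> {e. e \<in> arcs X \<and> head X e = \<rho>V g x}"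
          using g by (auto simp: E_closed head_action)
        show "\<rho>E (inv\<^bsub>G\<^esub> g) \<in> {e. e \<in> arcs X \<and> head X e = \<rho>V g x} \<rightarrow> {e. e \<in> arcs X \<and> head X e = x}"
          using g True by (auto simp: E_closed head_action V_inv)
      qed (use g in \<open>auto simp: E_inv E_inv'\<close>)
      have deg: "in_degree X (\<rho>V g x) = in_degree X x"
        unfolding in_degree_eq using bij_betw_same_card[OF bij] by simp
      have unit: "cnj (s x) * s x = 1"
        using s[OF True] by (metis complex_norm_square mult.commute of_real_1 power_one)
      have "cnj (s x) * (\<Sum>e | e \<in> arcs X \<and> head X e = \<rho>V g x. \<sigma> e * f (tail X e))
          = cnj (s x) * (\<Sum>e | e \<in> arcs X \<and> head X e = x. \<sigma> (\<rho>E g e) * f (tail X (\<rho>E g e)))"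
        by (subst sum.reindex_bij_betw[OF bij, symmetric]) simp
      also have "\<dots> = (\<Sum>e | e \<in> arcs X \<and> head X e = x. \<sigma> e * U f (tail X e))"
        unfolding sum_distrib_left
      proof (intro sum.cong refl)
        fix e assume "e \<in> {e. e \<in> arcs X \<and> head X e = x}"
        then have e: "e \<in> arcs X" "head X e = x" by auto
        have "cnj (s x) * (\<sigma> (\<rho>E g e) * f (tail X (\<rho>E g e)))
            = (cnj (s x) * s x) * (\<sigma> e * (cnj (s (tail X e)) * f (\<rho>V g (tail X e))))"
          using e g by (simp add: \<sigma>g tail_action mult_ac)
        then show "cnj (s x) * (\<sigma> (\<rho>E g e) * f (tail X (\<rho>E g e))) = \<sigma> e * U f (tail X e)"
          using e by (simp add: unit U_def)
      qed
      finally show ?thesis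
        using True V_closed[OF g True] by (simp add: magnetic_op_def U_def deg algebra_simps)
    qed (simp add: magnetic_op_def U_def)
  qed
  have pow: "(\<Delta> ^^ k) (U f) = U ((\<Delta> ^^ k) f)" for f
    by (induction k) (auto simp: comm)
  \<comment> \<open>The zero summand brings the right-hand side into the form expected by
    \<open>pow_lin\<close>.\<close>
  have Ud: "U (delta (\<rho>V g v)) = (\<lambda>x. cnj (s v) * delta v x + 0 * delta v x)"
  proof
    fix x
    have "\<rho>V g x = \<rho>V g v \<longleftrightarrow> x = v" if "x \<in> verts X"
      using that v V.inj_prop[OF g] by (auto simp: inj_on_def)
    then show "U (delta (\<rho>V g v)) x = cnj (s v) * delta v x + 0 * delta v x"
      using v by (auto simp: U_def delta_def)
  qed
  have "cnj (s v) * (\<Delta> ^^ k) (delta (\<rho>V g v)) (\<rho>V g v) = U ((\<Delta> ^^ k) (delta (\<rho>V g v))) v"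
    using v by (simp add: U_def)
  also have "\<dots> = cnj (s v) * (\<Delta> ^^ k) (delta v) v"
    unfolding pow[symmetric] Ud
    using l2_selfadjoint.pow_lin[OF mX.selfadjoint l2_delta[OF v] l2_delta[OF v], of k "cnj (s v)" 0] by simp
  finally show ?thesis using s[OF v] by auto
qed

section \<open>Comparison with the full operator away from the boundary\<close>

context
  fixes L :: "'g set"
  assumes L: "finite L" "L \<subseteq> carrier G"
begin

lemma W_finite: "finite (W L)"
  using L FV_finite by (simp add: W_def)

lemma W_verts: "W L \<subseteq> verts X"
  using L FV_verts V_closed by (auto simp: W_def)

lemma sum_W:
  fixes F :: "'v \<Rightarrow> 'b::comm_monoid_add"
  shows "(\<Sum>v\<in>W L. F v) = (\<Sum>g\<in>L. \<Sum>w\<in>FV. F (\<rho>V g w))"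
proof -
  have eq: "W L = (\<lambda>(g, w). \<rho>V g w) ` (L \<times> FV)" by (auto simp: W_def)
  have inj: "inj_on (\<lambda>(g, w). \<rho>V g w) (L \<times> FV)"
  proof (rule inj_onI, clarify)
    fix g w h w' assume "g \<in> L" "h \<in> L" "w \<in> FV" "w' \<in> FV" "\<rho>V g w = \<rho>V h w'"
    then show "g = h \<and> w = w'" using vertex_unique[of g h w w'] L(2) by blast
  qed
  have "(\<Sum>v\<in>W L. F v) = (\<Sum>p\<in>L \<times> FV. F (case p of (g, w) \<Rightarrow> \<rho>V g w))"
    by (simp only: eq sum.reindex[OF inj] o_def)
  also have "\<dots> = (\<Sum>g\<in>L. \<Sum>w\<in>FV. F (\<rho>V g w))"
    by (simp add: sum.cartesian_product case_prod_beta)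
  finally show ?thesis .
qed

lemma finite_selfadjoint_L: "finite_selfadjoint (W L) (\<Delta>\<^sub>L bc L)"
  using magnetic.selfadjoint[OF magnetic_L] W_finite
  by (simp add: finite_selfadjoint_def finite_selfadjoint_axioms_def)

context
  fixes K :: "'g set"
  assumes K: "neighbour_set K"
begin

lemma neighbour_arc:
  assumes "g \<in> carrier G" "w \<in> FV" "e \<in> arcs X" "head X e = \<rho>V g w"
  shows "\<exists>h\<in>K. \<exists>w'\<in>FV. tail X e = \<rho>V (g \<otimes>\<^bsub>G\<^esub> h) w'"
    and "\<exists>h\<in>K. \<exists>u\<in>FE. {e, bar e} = \<rho>E (g \<otimes>\<^bsub>G\<^esub> h) ` u"
  using K assms unfolding neighbour_set_def by blast+

text \<open>Every arc into the vertex has its tail and its edge in translates by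
  \<open>g \<otimes> h\<close> with \<open>h\<close> in \<open>K\<close>, so it survives under
  either boundary condition and the degree is the full valence. Two functions are allowed because
  for the atoms a truncated eigenfunction is compared with the eigenfunction itself.\<close>

lemma interior_agree:
  assumes g: "g \<in> L" and gK: "\<And>h. h \<in> K \<Longrightarrow> g \<otimes>\<^bsub>G\<^esub> h \<in> L" and w: "w \<in> FV"
    and f: "f (\<rho>V g w) = f' (\<rho>V g w)"
      "\<And>h w'. h \<in> K \<Longrightarrow> w' \<in> FV \<Longrightarrow> f (\<rho>V (g \<otimes>\<^bsub>G\<^esub> h) w') = f' (\<rho>V (g \<otimes>\<^bsub>G\<^esub> h) w')"
  shows "\<Delta>\<^sub>L bc L f (\<rho>V g w) = \<Delta> f' (\<rho>V g w)"
proof -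
  let ?v = "\<rho>V g w"
  have gc: "g \<in> carrier G" using g L by auto
  have vW: "?v \<in> W L" using g w by (auto simp: W_def)
  then have vX: "?v \<in> verts X" using W_verts by auto
  have in_Y: "e \<in> arcs (Y L)" if e: "e \<in> arcs X" "head X e = ?v" for e
  proof -
    obtain h w' where "h \<in> K" "w' \<in> FV" "tail X e = \<rho>V (g \<otimes>\<^bsub>G\<^esub> h) w'" using neighbour_arc(1)[OF gc w e] by blast
    then have "tail X e \<in> W L" using gK by (auto simp: W_def)
    moreover obtain h u where "h \<in> K" "u \<in> FE" "{e, bar e} = \<rho>E (g \<otimes>\<^bsub>G\<^esub> h) ` u" using neighbour_arc(2)[OF gc w e] by blast
    then have "{e, bar e} \<in> (\<Union>g\<in>L. (\<lambda>u. \<rho>E g ` u) ` FE)" using gK by blast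
    ultimately show ?thesis using e vW by (simp add: arcs_Y)
  qed
  have sub: "arcs (Y L) \<subseteq> bc_arcs bc L" by (cases bc) (auto simp: bc_arcs_def arcs_Y)
  have arcs: "{e. e \<in> bc_arcs bc L \<and> head X e = ?v} = {e. e \<in> arcs X \<and> head X e = ?v}"
    using in_Y sub bc_arcs_D(1) by blast
  have "{e \<in> arcs (Y L). head X e = ?v} = {e \<in> arcs X. head X e = ?v}"
    using in_Y by (auto simp: arcs_Y)
  then have deg: "bc_deg bc L ?v = in_degree X ?v"
    by (cases bc) (simp_all add: bc_deg_def in_degree_def in_arcs_def head_Y)
  have "(\<Sum>e | e \<in> arcs X \<and> head X e = ?v. \<sigma> e * f (tail X e)) = (\<Sum>e | e \<in> arcs X \<and> head X e = ?v. \<sigma> e * f' (tail X e))"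
  proof (intro sum.cong refl)
    fix e assume "e \<in> {e. e \<in> arcs X \<and> head X e = ?v}"
    then obtain h w' where "h \<in> K" "w' \<in> FV" "tail X e = \<rho>V (g \<otimes>\<^bsub>G\<^esub> h) w'" using neighbour_arc(1)[OF gc w] by blast
    then show "\<sigma> e * f (tail X e) = \<sigma> e * f' (tail X e)" using f(2) by simp
  qed
  then show ?thesis
    using vW vX by (simp add: magnetic_op_def arcs deg f(1))
qed

lemma deep_agree:
  "g \<in> G.deep K L j \<Longrightarrow> w \<in> FV \<Longrightarrow> (\<Delta>\<^sub>L bc L ^^ j) f (\<rho>V g w) = (\<Delta> ^^ j) f (\<rho>V g w)"
proof (induction j arbitrary: g w)
  case (Suc j)
  have g: "g \<in> G.deep K L j" "\<And>h. h \<in> K \<Longrightarrow> g \<otimes>\<^bsub>G\<^esub> h \<in> G.deep K L j" using Suc.prems(1) by auto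
  have "\<Delta>\<^sub>L bc L ((\<Delta>\<^sub>L bc L ^^ j) f) (\<rho>V g w) = \<Delta> ((\<Delta> ^^ j) f) (\<rho>V g w)"
    by (rule interior_agree) (use g G.deep_subset[of K L j] Suc in blast)+
  then show ?case by simp
qed simp

text \<open>Over deep group elements the diagonal entries of the two operators agree, and those of
  the full operator depend only on the orbit. Over each remaining element there are
  \<open>card FV\<close> vertices, and both entries at each of them are bounded by
  \<open>(2 * real D) ^ k\<close>.\<close>

lemma trace_difference:
  "cmod ((\<Sum>v\<in>W L. (\<Delta>\<^sub>L bc L ^^ k) (delta v) v) - of_nat (card L) * (\<Sum>w\<in>FV. (\<Delta> ^^ k) (delta w) w))
    \<le> real (card (L - G.deep K L k)) * (real (card FV) * (2 * (2 * real D) ^ k))"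
proof -
  let ?a = "\<lambda>g w. (\<Delta>\<^sub>L bc L ^^ k) (delta (\<rho>V g w)) (\<rho>V g w)" and ?b = "\<lambda>w. (\<Delta> ^^ k) (delta w) w"
  have d1: "cmod (delta v x) \<le> 1" for v x :: 'v by (simp add: delta_def)
  have ba: "cmod (?a g w) \<le> (2 * real D) ^ k" for g w
  proof -
    have "cmod (?a g w) \<le> (2 * real D) ^ k * 1"
      by (rule magnetic.sup_bound_pow[OF magnetic_L d1])
    then show ?thesis by simp
  qed
  have bb: "cmod (?b w) \<le> (2 * real D) ^ k" for w
  proof -
    have "cmod (?b w) \<le> (2 * real D) ^ k * 1"
      by (rule mX.sup_bound_pow[OF d1])
    then show ?thesis by simp
  qed
  have z: "?a g w - ?b w = 0" if "g \<in> G.deep K L k" "w \<in> FV" for g w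
  proof -
    have "g \<in> carrier G" "w \<in> verts X" using that G.deep_subset[of K L k] L FV_verts by auto
    then show ?thesis using deep_agree[OF that] diagonal_invariant by simp
  qed
  have "(\<Sum>v\<in>W L. (\<Delta>\<^sub>L bc L ^^ k) (delta v) v) - of_nat (card L) * (\<Sum>w\<in>FV. ?b w)
      = (\<Sum>g\<in>L. \<Sum>w\<in>FV. ?a g w - ?b w)"
    unfolding sum_W by (simp add: sum_subtractf)
  also have "\<dots> = (\<Sum>g\<in>L - G.deep K L k. \<Sum>w\<in>FV. ?a g w - ?b w)"
    by (rule sum.mono_neutral_right) (use L z in auto)
  finally have eq: "(\<Sum>v\<in>W L. (\<Delta>\<^sub>L bc L ^^ k) (delta v) v) - of_nat (card L) * (\<Sum>w\<in>FV. ?b w)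
      = (\<Sum>g\<in>L - G.deep K L k. \<Sum>w\<in>FV. ?a g w - ?b w)" .
  have "cmod (\<Sum>g\<in>L - G.deep K L k. \<Sum>w\<in>FV. ?a g w - ?b w) \<le> (\<Sum>g\<in>L - G.deep K L k. \<Sum>w\<in>FV. 2 * (2 * real D) ^ k)"
  proof (intro sum_norm_le)
    fix g w
    show "cmod (?a g w - ?b w) \<le> 2 * (2 * real D) ^ k"
      using norm_triangle_ineq4[of "?a g w" "?b w"] ba[of g w] bb[of w] by linarith
  qed
  then show ?thesis unfolding eq by simp
qed

end

end

end

section \<open>The limit of the normalised counting functions\<close>

lemma interval_measure_mono: "interval_measure M a \<Longrightarrow> a \<le> b \<Longrightarrow> interval_measure M b"
proof -
  assume M: "interval_measure M a" and ab: "a \<le> b"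
  interpret interval_measure M a by (rule M)
  show ?thesis
  proof
    show "AE t in M. t \<in> {- b..b}"
      by (rule AE_mp[OF AE_interval AE_I2]) (use ab in auto)
  qed (rule sets_M)
qed

theorem (in magnetic_cover) spectral_density_limit:
  assumes S: "finite_generating_set G S" and \<Lambda>: "regular_exhaustion G S \<Lambda>"
  shows "(\<lambda>m. real (eigenvalue_count (verts (Y (\<Lambda> m))) (restricted_dml bc X Ep \<sigma> (Y (\<Lambda> m))) x)
      / real (card (\<Lambda> m))) \<longlonglongrightarrow> spectral_density (verts X) FV (dml X Ep \<sigma>) x"
proof -
  let ?V = "verts X"
  define Q where "Q = spectral_projection ?V \<Delta>"
  have "\<exists>P. is_spectral_measure ?V \<Delta> P"
  proof (rule l2_selfadjoint.spectral_measure_exists[OF mX.selfadjoint])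
    show "0 < 2 * real D + 1" by simp
    show "\<bar>Re (l2_inner (\<Delta> f) f)\<bar> \<le> (2 * real D + 1) * (l2_norm f)\<^sup>2" if "f \<in> l2 ?V" for f
    proof -
      have "\<bar>Re (l2_inner (\<Delta> f) f)\<bar> \<le> 2 * real D * (l2_norm f)\<^sup>2"
        using abs_Re_le_cmod mX.quadratic_bound[OF that] by (rule order_trans)
      also have "\<dots> \<le> (2 * real D + 1) * (l2_norm f)\<^sup>2" by (intro mult_right_mono) auto
      finally show ?thesis .
    qed
  qed
  then have Q: "is_spectral_measure ?V \<Delta> Q"
    unfolding Q_def spectral_projection_def by (rule someI_ex)
  then have "\<exists>a>0. \<forall>f\<in>l2 ?V. Q {-a<..<a} f = f"
    unfolding is_spectral_measure_def projection_valued_measure_def by (elim conjE)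
  then obtain a where a: "\<And>f. f \<in> l2 ?V \<Longrightarrow> Q {-a<..<a} f = f"
    by auto
  interpret A: spectral_operator ?V \<Delta> Q a
    by (intro spectral_operator.intro mX.selfadjoint spectral_operator_axioms.intro Q a)
  obtain K where nb: "neighbour_set K" using neighbour_set_exists by blast
  then have K: "finite K" "K \<subseteq> carrier G" by (auto simp: neighbour_set_def)
  have L: "finite (\<Lambda> m)" "\<Lambda> m \<subseteq> carrier G" "\<Lambda> m \<noteq> {}" for m
    using \<Lambda> by (auto simp: regular_exhaustion_def)
  let ?M = "\<lambda>m. \<Delta>\<^sub>L bc (\<Lambda> m)" and ?W = "\<lambda>m. W (\<Lambda> m)"
  have fs: "finite_selfadjoint (?W m) (?M m)" for m by (rule finite_selfadjoint_L[OF L(1,2)])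
  have "\<exists>u \<mu>. finite_selfadjoint.eigenbasis (?W m) (?M m) u \<mu>" for m
    by (rule finite_selfadjoint.eigenbasis_exists[OF fs])
  then obtain u \<mu> where eb: "\<And>m. finite_selfadjoint.eigenbasis (?W m) (?M m) (u m) (\<mu> m)" by metis
  define \<nu> where "\<nu> w = scalar_measure Q (delta w)" for w
  have dl2: "delta v \<in> l2 ?V" if "v \<in> ?V" for v using that by simp
  have FVV: "w \<in> ?V" if "w \<in> FV" for w using that FV_verts by auto
  have mom: "complex_of_real (\<integral>t. t ^ k \<partial>\<nu> v) = (\<Delta> ^^ k) (delta v) v" if "v \<in> ?V" for v k
    unfolding \<nu>_def using A.fam.moments[OF dl2[OF that], of k] by simp
  \<comment> \<open>Equal diagonal entries of all powers mean equal moments, so the measures at the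
    vertices of one orbit have the same atoms.\<close>
  have \<nu>_translate: "measure (\<nu> (\<rho>V g w)) {x} = measure (\<nu> w) {x}" if g: "g \<in> carrier G" and w: "w \<in> ?V" for g w
  proof -
    have gw: "\<rho>V g w \<in> ?V" by (rule V_closed[OF g w])
    interpret N1: interval_measure "\<nu> (\<rho>V g w)" a unfolding \<nu>_def by (rule A.interval_scalar[OF dl2[OF gw]])
    interpret N2: interval_measure "\<nu> w" a unfolding \<nu>_def by (rule A.interval_scalar[OF dl2[OF w]])
    have "complex_of_real (\<integral>t. indicator {x} t \<partial>\<nu> (\<rho>V g w)) = complex_of_real (\<integral>t. indicator {x} t \<partial>\<nu> w)"
      by (rule spectral_functional_eq_if_moments[OF N1.spectral_functional_integral N2.spectral_functional_integral])
        (simp_all add: mom gw w diagonal_invariant g)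
    then show ?thesis by simp
  qed
  \<comment> \<open>A common bound, independent of m: \<open>a\<close> for the spectral measures and
    \<open>2 * real D\<close> for the eigenvalues.\<close>
  define b where "b = max a (2 * real D)"
  define \<beta> where "\<beta> m = real (card (\<Lambda> m - G.deep K (\<Lambda> m) 1)) * real (card FV)" for m
  interpret C: moment_convergence "\<lambda>m. card (?W m)" "\<lambda>m. card (\<Lambda> m)" \<mu> b FV \<nu>
  proof (rule moment_convergence.intro)
    fix m i assume i: "i < card (?W m)"
    interpret F: finite_selfadjoint "?W m" "?M m" by (rule fs)
    have ui: "u m i \<in> l2 (?W m)" by (rule F.eb_l2[OF eb i])
    have 1: "l2_inner (u m i) (u m i) = 1" using F.eb_on[OF eb] i by (simp add: orthonormal_def)
    then have n: "(l2_norm (u m i))\<^sup>2 = 1" unfolding l2_inner_self[OF ui] by (metis of_real_eq_1_iff)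
    have "cmod (l2_inner (?M m (u m i)) (u m i)) \<le> 2 * real D"
      using magnetic.quadratic_bound[OF magnetic_L ui] n by simp
    then have "\<bar>\<mu> m i\<bar> \<le> 2 * real D"
      by (simp add: F.eb_eigen[OF eb i] l2_inner_scale_left 1)
    then show "\<mu> m i \<in> {- b..b}" by (auto simp: b_def)
  next
    show "finite FV" by (rule FV_finite)
  next
    fix w assume "w \<in> FV"
    then show "interval_measure (\<nu> w) b"
      unfolding \<nu>_def by (intro interval_measure_mono[OF A.interval_scalar] dl2 FVV) (auto simp: b_def)
  next
    fix k
    let ?\<tau> = "\<Sum>w\<in>FV. \<integral>t. t ^ k \<partial>\<nu> w" and ?s = "\<lambda>m. \<Sum>i<card (?W m). \<mu> m i ^ k"
    let ?C = "real (card FV) * (2 * (2 * real D) ^ k)"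
    have "(\<lambda>m. ?s m / real (card (\<Lambda> m)) - ?\<tau>) \<longlonglongrightarrow> 0"
    proof (rule Lim_null_comparison)
      have "(\<lambda>m. real (card (\<Lambda> m - G.deep K (\<Lambda> m) k)) / real (card (\<Lambda> m)) * ?C) \<longlonglongrightarrow> 0 * ?C"
        by (intro tendsto_mult_right G.shallow_negligible[OF S \<Lambda> K])
      then show "(\<lambda>m. real (card (\<Lambda> m - G.deep K (\<Lambda> m) k)) / real (card (\<Lambda> m)) * ?C) \<longlonglongrightarrow> 0" by simp
      show "\<forall>\<^sub>F m in sequentially. norm (?s m / real (card (\<Lambda> m)) - ?\<tau>)
          \<le> real (card (\<Lambda> m - G.deep K (\<Lambda> m) k)) / real (card (\<Lambda> m)) * ?C"
      proof (intro always_eventually allI)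
        fix m
        have N: "0 < real (card (\<Lambda> m))" using L by (simp add: card_gt_0_iff)
        have "complex_of_real ?\<tau> = (\<Sum>w\<in>FV. (\<Delta> ^^ k) (delta w) w)"
          unfolding of_real_sum by (intro sum.cong refl mom FVV)
        then have eq: "complex_of_real (?s m - real (card (\<Lambda> m)) * ?\<tau>) = (\<Sum>v\<in>?W m. (?M m ^^ k) (delta v) v)
            - of_nat (card (\<Lambda> m)) * (\<Sum>w\<in>FV. (\<Delta> ^^ k) (delta w) w)"
          unfolding finite_selfadjoint.trace_power[OF fs eb] by simp
        have "cmod (complex_of_real (?s m - real (card (\<Lambda> m)) * ?\<tau>))
            \<le> real (card (\<Lambda> m - G.deep K (\<Lambda> m) k)) * ?C"
          unfolding eq by (rule trace_difference[OF L(1,2) nb])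
        then have "\<bar>?s m - real (card (\<Lambda> m)) * ?\<tau>\<bar> \<le> real (card (\<Lambda> m - G.deep K (\<Lambda> m) k)) * ?C"
          by (simp only: norm_of_real)
        then have "\<bar>?s m - real (card (\<Lambda> m)) * ?\<tau>\<bar> / real (card (\<Lambda> m))
            \<le> real (card (\<Lambda> m - G.deep K (\<Lambda> m) k)) * ?C / real (card (\<Lambda> m))"
          by (rule divide_right_mono) simp
        moreover have "?s m / real (card (\<Lambda> m)) - ?\<tau> = (?s m - real (card (\<Lambda> m)) * ?\<tau>) / real (card (\<Lambda> m))"
          using N by (simp add: field_simps)
        ultimately show "norm (?s m / real (card (\<Lambda> m)) - ?\<tau>)
            \<le> real (card (\<Lambda> m - G.deep K (\<Lambda> m) k)) / real (card (\<Lambda> m)) * ?C"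
          using N by (simp add: abs_divide)
      qed
    qed
    then show "(\<lambda>m. ?s m / real (card (\<Lambda> m))) \<longlonglongrightarrow> ?\<tau>" by (simp add: LIM_zero_iff)
  qed
  have atom: "real (card (\<Lambda> m)) * (\<Sum>w\<in>FV. measure (\<nu> w) {x}) - \<beta> m \<le> real (card {i. i < card (?W m) \<and> \<mu> m i = x})" for m
  proof -
    interpret F: finite_selfadjoint "?W m" "?M m" by (rule fs)
    let ?deep = "G.deep K (\<Lambda> m) 1"
    \<comment> \<open>The compression to \<open>?W m\<close> of the eigenprojection at x;
      \<open>B\<close> collects the vertices at which the restricted operator may fail to see the
      eigenvalue equation.\<close>
    define T where "T f = restrict_support (?W m) (Q {x} f)" for f
    define B where "B = (\<lambda>(g, w). \<rho>V g w) ` ((\<Lambda> m - ?deep) \<times> FV)"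
    have up: "f \<in> l2 ?V" if "f \<in> l2 (?W m)" for f using that W_verts[OF L(1,2)] by (rule l2_mono)
    have T_inner: "l2_inner (T f) h = l2_inner (Q {x} f) h" if "h \<in> l2 (?W m)" for f h
    proof -
      have "T f v * cnj (h v) = Q {x} f v * cnj (h v)" for v
        using l2_outside[OF that, of v] by (cases "v \<in> ?W m") (auto simp: T_def restrict_support_def)
      then show ?thesis unfolding l2_inner_def by (rule infsum_cong)
    qed
    have T: "l2_selfadjoint (?W m) T"
    proof
      fix f h :: "'v \<Rightarrow> complex" and c d :: complex assume f: "f \<in> l2 (?W m)"
      show "T f \<in> l2 (?W m)"
        by (simp add: T_def l2_finite[OF F.finite_W] restrict_support_def)
      assume h: "h \<in> l2 (?W m)"
      show "T (\<lambda>v. c * f v + d * h v) = (\<lambda>v. c * T f v + d * T h v)"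
        by (simp add: T_def A.Q_lin up f h restrict_support_def fun_eq_iff)
      show "l2_inner (T f) h = l2_inner f (T h)"
        using T_inner[OF h, of f] T_inner[OF f, of h] A.Q_sym[of "{x}" f h] up f h
          l2_inner_commute[of f "T h"] l2_inner_commute[of f "Q {x} h"] by simp
    qed
    have T_quad: "Re (l2_inner (T f) f) = measure (scalar_measure Q f) {x}" if "f \<in> l2 (?W m)" for f
      using T_inner[OF that] A.scalar_eq[OF _ up[OF that], of "{x}"] by simp
    have "Re (\<Sum>v\<in>?W m. T (delta v) v) \<le> real (card {i. i < card (?W m) \<and> \<mu> m i = x} + card B)"
    proof (rule F.trace_le_eigenspace[OF eb T])
      fix f assume f: "f \<in> l2 (?W m)"
      show "0 \<le> Re (l2_inner (T f) f)" unfolding T_quad[OF f] by simp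
      interpret N: interval_measure "scalar_measure Q f" a by (rule A.interval_scalar[OF up[OF f]])
      have "measure (scalar_measure Q f) {x} \<le> measure (scalar_measure Q f) (space (scalar_measure Q f))"
        by (rule N.bounded_measure)
      then show "Re (l2_inner (T f) f) \<le> (l2_norm f)\<^sup>2"
        unfolding T_quad[OF f] using A.fam.mass[OF up[OF f]] by simp
      fix v assume v: "v \<in> ?W m - B"
      then obtain g w where g: "g \<in> \<Lambda> m" "w \<in> FV" "v = \<rho>V g w" by (auto simp: W_def)
      have gd: "g \<in> ?deep"
      proof (rule ccontr)
        assume "g \<notin> ?deep"
        then have "(g, w) \<in> (\<Lambda> m - ?deep) \<times> FV" using g by simp
        then have "v \<in> B" unfolding B_def using g(3) by force
        then show False using v by simp
      qed
      have TQ: "T f (\<rho>V h w') = Q {x} f (\<rho>V h w')" if "h \<in> \<Lambda> m" "w' \<in> FV" for h w'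
        using that by (auto simp: T_def restrict_support_def W_def)
      \<comment> \<open>For \<open>g\<close> in the deep part all neighbouring vertices lie in
        \<open>?W m\<close>, where the truncation \<open>T f\<close> still coincides with the
        eigenfunction \<open>Q {x} f\<close>.\<close>
      have "?M m (T f) (\<rho>V g w) = \<Delta> (Q {x} f) (\<rho>V g w)"
        by (rule interior_agree[OF L(1,2) nb]) (use g gd in \<open>auto intro!: TQ\<close>)
      also have "\<dots> = of_real x * T f v"
        using A.A_atom[OF up[OF f], of x] TQ[OF g(1,2)] g(3) by simp
      finally show "?M m (T f) v = of_real x * T f v" using g(3) by simp
    next
      show "finite B" using L(1)[of m] FV_finite by (simp add: B_def)
    qed
    moreover have "card B \<le> card (\<Lambda> m - ?deep) * card FV"
      unfolding B_def using card_image_le[of "(\<Lambda> m - ?deep) \<times> FV" "\<lambda>(g, w). \<rho>V g w"] L(1)[of m] FV_finite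
      by (simp add: card_cartesian_product)
    then have "real (card B) \<le> \<beta> m" unfolding \<beta>_def by (metis of_nat_le_iff of_nat_mult)
    \<comment> \<open>The trace is exact, with no boundary correction: each diagonal entry of the
      compression is the atom of the full spectral measure at that vertex, and it is constant on
      orbits.\<close>
    moreover have "Re (\<Sum>v\<in>?W m. T (delta v) v) = real (card (\<Lambda> m)) * (\<Sum>w\<in>FV. measure (\<nu> w) {x})"
    proof -
      have "Re (T (delta v) v) = measure (\<nu> v) {x}" if v: "v \<in> ?W m" for v
        unfolding \<nu>_def using T_quad[OF l2_delta[OF v]] by simp
      then have "Re (\<Sum>v\<in>?W m. T (delta v) v) = (\<Sum>v\<in>?W m. measure (\<nu> v) {x})" by simp
      also have "\<dots> = (\<Sum>g\<in>\<Lambda> m. \<Sum>w\<in>FV. measure (\<nu> (\<rho>V g w)) {x})" by (rule sum_W[OF L(1,2)])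
      also have "\<dots> = (\<Sum>g\<in>\<Lambda> m. \<Sum>w\<in>FV. measure (\<nu> w) {x})"
        using L(2) by (intro sum.cong refl \<nu>_translate FVV) auto
      finally show ?thesis by simp
    qed
    ultimately show ?thesis by simp
  qed
  have "(\<lambda>m. real (card (\<Lambda> m - G.deep K (\<Lambda> m) 1)) / real (card (\<Lambda> m)) * real (card FV)) \<longlonglongrightarrow> 0 * real (card FV)"
    by (intro tendsto_mult_right G.shallow_negligible[OF S \<Lambda> K])
  then have \<beta>: "(\<lambda>m. \<beta> m / real (card (\<Lambda> m))) \<longlonglongrightarrow> 0" by (simp add: \<beta>_def)
  have N: "0 < card (\<Lambda> m)" for m using L by (simp add: card_gt_0_iff)
  have density: "spectral_density ?V FV (dml X Ep \<sigma>) x = (\<Sum>w\<in>FV. measure (\<nu> w) {..x})"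
  proof -
    have "spectral_density ?V FV (dml X Ep \<sigma>) x = (\<Sum>w\<in>FV. Re (l2_inner (Q {..x} (delta w)) (delta w)))"
      unfolding spectral_density_def vn_trace_def dml_eq Q_def by (rule Re_sum)
    also have "\<dots> = (\<Sum>w\<in>FV. measure (\<nu> w) {..x})"
      unfolding \<nu>_def by (intro sum.cong refl A.scalar_eq dl2 FVV) auto
    finally show ?thesis .
  qed
  show ?thesis
    unfolding density eigenvalue_count_restricted finite_selfadjoint.eigenvalue_count_eq[OF fs eb]
    by (rule C.count_converges[OF atom \<beta> N])
qed

theorem theorem0p3:
  fixes X :: "('v, 'e) pre_digraph" and bar :: "'e \<Rightarrow> 'e" and Ep :: "'e set"
    and \<Gamma> :: "('g, 'm) monoid_scheme" and S :: "'g set"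
    and \<rho>V :: "'g \<Rightarrow> 'v \<Rightarrow> 'v" and \<rho>E :: "'g \<Rightarrow> 'e \<Rightarrow> 'e"
    and FV :: "'v set" and FE :: "'e set set"
    and \<sigma> :: "'e \<Rightarrow> complex" and \<Lambda> :: "nat \<Rightarrow> 'g set"
    and bc :: boundary_condition and x :: real
  assumes "bidirected_digraph X bar"
    and "orientation X bar Ep"
    and "group \<Gamma>" and "finite_generating_set \<Gamma> S" and "amenable \<Gamma>"
    and "free_graph_action \<Gamma> X bar \<rho>V \<rho>E"
    and "fundamental_domain \<Gamma> X bar \<rho>V \<rho>E FV FE"
    and "weight_function X bar \<sigma>"
    and "weakly_invariant \<Gamma> X \<rho>E \<sigma>"
    and "rational_weight X \<sigma>"
    and "regular_exhaustion \<Gamma> S \<Lambda>"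
  shows "(\<lambda>m. let X\<^sub>m = exhaustion_graph X bar \<rho>V \<rho>E FV FE (\<Lambda> m)
              in real (eigenvalue_count (verts X\<^sub>m) (restricted_dml bc X Ep \<sigma> X\<^sub>m) x)
                 / real (card (\<Lambda> m)))
         \<longlonglongrightarrow> spectral_density (verts X) FV (dml X Ep \<sigma>) x"
proof -
  interpret magnetic_cover X bar Ep \<Gamma> \<rho>V \<rho>E FV FE \<sigma>
    by (rule magnetic_cover.intro) (rule assms)+
  show ?thesis
    unfolding Let_def by (rule spectral_density_limit[OF assms(4,11)])
qed

end
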